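(* Let $\mathfrak q\subset\mathfrak p\subset\mathfrak g$ be nested parabolic subalgebras with corresponding subgroups $Q\subset P\subset G$. Let $(\pi:\mathcal G\to M,\omega)$ be a parabolic geometry of type $(G,Q)$ with curvature function $\kappa$ and let $E:=\mathcal G\times_Q(\mathfrak p/\mathfrak q)\subset TM$ be the smooth distribution corresponding to the subalgebra $\mathfrak p\supset\mathfrak q$. Then the distribution $E$ is integrable if and only if for all $u\in\mathcal G$ and $X,Y\in\mathfrak p/\mathfrak q$ we have $\kappa(u)(X,Y)\in\mathfrak p\subset\mathfrak g$.
   Context: $\mathfrak g$ is a real or complex semisimple Lie algebra and $G$ a Lie group with Lie algebra $\mathfrak g$. A parabolic subalgebra $\mathfrak q$ corresponds to a grading $\mathfrak g=\mathfrak g_{-m}\oplus\dots\oplus\mathfrak g_m$ with $\mathfrak g_1$ generating $\mathfrak q_+:=\bigoplus_{i>0}\mathfrak g_i$ and no simple ideal contained in $\mathfrak g_0$; $\mathfrak q=\mathfrak g_0\oplus\mathfrak q_+$, and $Q\subset G$ is the subgroup of elements whose adjoint action preserves the filtration $\mathfrak g^i:=\bigoplus_{l\ge i}\mathfrak g_l$. Likewise for $\mathfrak p$ and $P$; $Q$ is a closed subgroup of $P$. A parabolic geometry of type $(G,Q)$ on a manifold $M$ with $\dim M=\dim G/Q$ is a principal $Q$-bundle $\pi:\mathcal G\to M$ with a Cartan connection $\omega\in\Omega^1(\mathcal G,\mathfrak g)$: $\omega(\zeta_A)=A$ for fundamental fields with $A\in\mathfrak q$, $(r^g)^*\omega=\mathrm{Ad}(g^{-1})\circ\omega$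 for $g\in Q$, and $\omega|_{T_u\mathcal G}:T_u\mathcal G\to\mathfrak g$ is a linear isomorphism for all $u$. Its curvature function is $\kappa(u)(X,Y)=d\omega(\omega_u^{-1}(X),\omega_u^{-1}(Y))+[X,Y]$, viewed as a $Q$-equivariant function $\mathcal G\to L(\Lambda^2\mathfrak g/\mathfrak q,\mathfrak g)$. Via $\omega$ one has $TM\cong\mathcal G\times_Q(\mathfrak g/\mathfrak q)$; explicitly, $\xi\in T_xM$ lies in $E_x$ iff for one (equivalently any) $u\in\mathcal G$ with $\pi(u)=x$ and one (equivalently any) lift $\tilde\xi\in T_u\mathcal G$ of $\xi$ one has $\omega(\tilde\xi)\in\mathfrak p$. *)

theory Defs
  imports "HOL-Analysis.Analysis" "HOL-Algebra.Group"
begin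

section \<open>Smooth maps between open subsets of Euclidean spaces\<close>

primrec Ck_on :: "nat \<Rightarrow> 'a::euclidean_space set \<Rightarrow> ('a \<Rightarrow> 'b::euclidean_space) \<Rightarrow> bool" where
  "Ck_on 0 S f \<longleftrightarrow> continuous_on S f"
| "Ck_on (Suc k) S f \<longleftrightarrow>
     (\<forall>x\<in>S. f differentiable (at x)) \<and> (\<forall>v. Ck_on k S (\<lambda>x. frechet_derivative f (at x) v))"

definition smooth_on :: "'a::euclidean_space set \<Rightarrow> ('a \<Rightarrow> 'b::euclidean_space) \<Rightarrow> bool" where
  "smooth_on S f \<longleftrightarrow> (\<forall>k. Ck_on k S f)"


section \<open>Smooth manifolds\<close>

text \<open>The underlying set of a manifold is a whole type, whose type class supplies a Hausdorff, second
  countable topology. A chart is a pair of a domain and a coordinate map.\<close>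

type_synonym ('m, 'a) chart = "'m set \<times> ('m \<Rightarrow> 'a)"

definition chart_inv :: "('m, 'a) chart \<Rightarrow> 'a \<Rightarrow> 'm" where
  "chart_inv c = inv_into (fst c) (snd c)"

definition is_chart :: "('m::topological_space, 'a::euclidean_space) chart \<Rightarrow> bool" where
  "is_chart c \<longleftrightarrow> open (fst c) \<and> open (snd c ` fst c) \<and>
     homeomorphism (fst c) (snd c ` fst c) (snd c) (chart_inv c)"

definition compatible :: "('m, 'a::euclidean_space) chart \<Rightarrow> ('m, 'a) chart \<Rightarrow> bool" where
  "compatible c d \<longleftrightarrow>
     smooth_on (snd c ` (fst c \<inter> fst d)) (snd d \<circ> chart_inv c) \<and>
     smooth_on (snd d ` (fst c \<inter> fst d)) (snd c \<circ> chart_inv d)"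

definition smooth_atlas ::
  "('m::{t2_space, second_countable_topology}, 'a::euclidean_space) chart set \<Rightarrow> bool" where
  "smooth_atlas A \<longleftrightarrow>
     (\<forall>c\<in>A. is_chart c) \<and> (\<Union>c\<in>A. fst c) = UNIV \<and> (\<forall>c\<in>A. \<forall>d\<in>A. compatible c d)"

definition prod_atlas ::
  "('m, 'a) chart set \<Rightarrow> ('n, 'b) chart set \<Rightarrow> ('m \<times> 'n, 'a \<times> 'b) chart set" where
  "prod_atlas A B = {(fst c \<times> fst d, map_prod (snd c) (snd d)) | c d. c \<in> A \<and> d \<in> B}"

definition std_atlas :: "('a, 'a) chart set" where
  "std_atlas = {(UNIV, \<lambda>x. x)}"

definition smooth_map_open ::
  "('m::topological_space, 'a::euclidean_space) chart set \<Rightarrow>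
   ('n::topological_space, 'b::euclidean_space) chart set \<Rightarrow> 'm set \<Rightarrow> ('m \<Rightarrow> 'n) \<Rightarrow> bool" where
  "smooth_map_open A B W f \<longleftrightarrow> open W \<and> continuous_on W f \<and>
     (\<forall>c\<in>A. \<forall>d\<in>B. smooth_on (snd c ` {x \<in> W \<inter> fst c. f x \<in> fst d}) (snd d \<circ> f \<circ> chart_inv c))"

text \<open>A map is smooth on an arbitrary subset if it extends locally to smooth maps on open sets. If the
  subset is an embedded submanifold, such as a closed subgroup of a Lie group, this is smoothness with
  respect to the induced manifold structure.\<close>

definition smooth_map_on ::
  "('m::topological_space, 'a::euclidean_space) chart set \<Rightarrow>
   ('n::topological_space, 'b::euclidean_space) chart set \<Rightarrow> 'm set \<Rightarrow> ('m \<Rightarrow> 'n) \<Rightarrow> bool" where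
  "smooth_map_on A B S f \<longleftrightarrow>
     (\<forall>x\<in>S. \<exists>W g. x \<in> W \<and> smooth_map_open A B W g \<and> (\<forall>y\<in>W \<inter> S. g y = f y))"


section \<open>Tangent vectors, forms and vector fields\<close>

text \<open>Each tangent space is identified with the model space by means of one preferred chart around the
  point; \<open>in_chart\<close> and \<open>of_chart\<close> translate to and from the coordinates of
  another chart.\<close>

definition chart_at :: "('m, 'a) chart set \<Rightarrow> 'm \<Rightarrow> ('m, 'a) chart" where
  "chart_at A x = (SOME c. c \<in> A \<and> x \<in> fst c)"

definition in_chart ::
  "('m, 'a::euclidean_space) chart set \<Rightarrow> ('m, 'a) chart \<Rightarrow> 'm \<Rightarrow> 'a \<Rightarrow> 'a" where
  "in_chart A c x =
     frechet_derivative (snd c \<circ> chart_inv (chart_at A x)) (at (snd (chart_at A x) x))"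

definition of_chart ::
  "('m, 'a::euclidean_space) chart set \<Rightarrow> ('m, 'a) chart \<Rightarrow> 'm \<Rightarrow> 'a \<Rightarrow> 'a" where
  "of_chart A c x =
     frechet_derivative (snd (chart_at A x) \<circ> chart_inv c) (at (snd c x))"

definition tangent_map ::
  "('m, 'a::euclidean_space) chart set \<Rightarrow> ('n, 'b::euclidean_space) chart set \<Rightarrow>
   ('m \<Rightarrow> 'n) \<Rightarrow> 'm \<Rightarrow> 'a \<Rightarrow> 'b" where
  "tangent_map A B f x =
     frechet_derivative (snd (chart_at B (f x)) \<circ> f \<circ> chart_inv (chart_at A x))
       (at (snd (chart_at A x) x))"

definition velocity :: "('m, 'a::euclidean_space) chart set \<Rightarrow> (real \<Rightarrow> 'm) \<Rightarrow> real \<Rightarrow> 'a" where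
  "velocity A \<gamma> t = tangent_map std_atlas A \<gamma> t 1"

definition field_rep ::
  "('m, 'a::euclidean_space) chart set \<Rightarrow> ('m, 'a) chart \<Rightarrow> ('m \<Rightarrow> 'a) \<Rightarrow> 'a \<Rightarrow> 'a" where
  "field_rep A c \<xi> y = in_chart A c (chart_inv c y) (\<xi> (chart_inv c y))"

text \<open>The Lie bracket of vector fields at a point and the exterior derivative of a one-form are given
  by their coordinate formulas
  \<open>[\<xi>, \<eta>] = D\<eta>(\<xi>) - D\<xi>(\<eta>)\<close> and
  \<open>d\<omega>(v, w) = (D\<^sub>v \<omega>)(w) - (D\<^sub>w \<omega>)(v)\<close>, evaluated in the preferred chart. The latter is the
  normalisation \<open>d\<omega>(\<xi>, \<eta>) = \<xi>(\<omega>(\<eta>)) - \<eta>(\<omega>(\<xi>)) - \<omega>([\<xi>, \<eta>])\<close>.\<close>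

definition field_bracket ::
  "('m, 'a::euclidean_space) chart set \<Rightarrow> ('m \<Rightarrow> 'a) \<Rightarrow> ('m \<Rightarrow> 'a) \<Rightarrow> 'm \<Rightarrow> 'a" where
  "field_bracket A \<xi> \<eta> x =
     (let c = chart_at A x; y = snd c x in
        frechet_derivative (field_rep A c \<eta>) (at y) (\<xi> x) -
        frechet_derivative (field_rep A c \<xi>) (at y) (\<eta> x))"

definition form_rep ::
  "('m, 'a::euclidean_space) chart set \<Rightarrow> ('m, 'a) chart \<Rightarrow> ('m \<Rightarrow> 'a \<Rightarrow> 'g) \<Rightarrow> 'a \<Rightarrow> 'a \<Rightarrow> 'g" where
  "form_rep A c \<omega> y w = \<omega> (chart_inv c y) (of_chart A c (chart_inv c y) w)"

definition smooth_one_form ::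
  "('m, 'a::euclidean_space) chart set \<Rightarrow> ('m \<Rightarrow> 'a \<Rightarrow> 'g::euclidean_space) \<Rightarrow> bool" where
  "smooth_one_form A \<omega> \<longleftrightarrow> (\<forall>x. linear (\<omega> x)) \<and>
     (\<forall>c\<in>A. \<forall>w. smooth_on (snd c ` fst c) (\<lambda>y. form_rep A c \<omega> y w))"

definition ext_deriv ::
  "('m, 'a::euclidean_space) chart set \<Rightarrow> ('m \<Rightarrow> 'a \<Rightarrow> 'g::euclidean_space) \<Rightarrow>
   'm \<Rightarrow> 'a \<Rightarrow> 'a \<Rightarrow> 'g" where
  "ext_deriv A \<omega> x v w =
     (let c = chart_at A x; y = snd c x in
        frechet_derivative (\<lambda>z. form_rep A c \<omega> z w) (at y) v -
        frechet_derivative (\<lambda>z. form_rep A c \<omega> z v) (at y) w)"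


section \<open>Submanifolds and integrable distributions\<close>

definition adapted_chart ::
  "('m::topological_space, 'a::euclidean_space) chart set \<Rightarrow> 'm set \<Rightarrow> 'm \<Rightarrow>
   ('m, 'a) chart \<Rightarrow> 'a set \<Rightarrow> bool" where
  "adapted_chart A N x c V \<longleftrightarrow>
     is_chart c \<and> (\<forall>d\<in>A. compatible c d) \<and> x \<in> fst c \<and>
     subspace V \<and> snd c ` (fst c \<inter> N) = snd c ` fst c \<inter> V"

definition submanifold ::
  "('m::topological_space, 'a::euclidean_space) chart set \<Rightarrow> 'm set \<Rightarrow> bool" where
  "submanifold A N \<longleftrightarrow> (\<forall>x\<in>N. \<exists>c V. adapted_chart A N x c V)"

definition submanifold_tangent ::
  "('m::topological_space, 'a::euclidean_space) chart set \<Rightarrow> 'm set \<Rightarrow> 'm \<Rightarrow> 'a set" where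
  "submanifold_tangent A N x = {v. \<exists>c V. adapted_chart A N x c V \<and> in_chart A c x v \<in> V}"

text \<open>Integrability means that there is an integral submanifold through every point; involutivity is not
  built into the definition.\<close>

definition integrable_distribution ::
  "('m::topological_space, 'a::euclidean_space) chart set \<Rightarrow> ('m \<Rightarrow> 'a set) \<Rightarrow> bool" where
  "integrable_distribution A E \<longleftrightarrow>
     (\<forall>x. \<exists>N. submanifold A N \<and> x \<in> N \<and> (\<forall>y\<in>N. submanifold_tangent A N y = E y))"


section \<open>Lie algebras and parabolic subalgebras\<close>

text \<open>A finite-dimensional Lie algebra over a ground field \<open>'k\<close>, where the underlying real vector
  space is the type \<open>'g\<close> and \<open>sc\<close> is multiplication by scalars. A (commutative) real
  normed field acting in this way on a nonzero finite-dimensional real space is isomorphic to the real or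
  the complex numbers, so this covers precisely real and complex Lie algebras.\<close>

definition lie_algebra ::
  "('k::real_normed_field \<Rightarrow> 'g::euclidean_space \<Rightarrow> 'g) \<Rightarrow> ('g \<Rightarrow> 'g \<Rightarrow> 'g) \<Rightarrow> bool" where
  "lie_algebra sc br \<longleftrightarrow>
     vector_space sc \<and> (\<forall>t x. sc (of_real t) x = t *\<^sub>R x) \<and>
     (\<forall>x. Vector_Spaces.linear sc sc (\<lambda>y. br x y)) \<and>
     (\<forall>y. Vector_Spaces.linear sc sc (\<lambda>x. br x y)) \<and>
     (\<forall>x. br x x = 0) \<and>
     (\<forall>x y z. br x (br y z) + br y (br z x) + br z (br x y) = 0)"

definition lie_subalgebra ::
  "('k::real_normed_field \<Rightarrow> 'g::euclidean_space \<Rightarrow> 'g) \<Rightarrow> ('g \<Rightarrow> 'g \<Rightarrow> 'g) \<Rightarrow> 'g set \<Rightarrow> bool" where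
  "lie_subalgebra sc br S \<longleftrightarrow> module.subspace sc S \<and> (\<forall>x\<in>S. \<forall>y\<in>S. br x y \<in> S)"

definition lie_ideal ::
  "('k::real_normed_field \<Rightarrow> 'g::euclidean_space \<Rightarrow> 'g) \<Rightarrow> ('g \<Rightarrow> 'g \<Rightarrow> 'g) \<Rightarrow> 'g set \<Rightarrow> bool" where
  "lie_ideal sc br I \<longleftrightarrow> module.subspace sc I \<and> (\<forall>x. \<forall>y\<in>I. br x y \<in> I)"

definition simple_ideal ::
  "('k::real_normed_field \<Rightarrow> 'g::euclidean_space \<Rightarrow> 'g) \<Rightarrow> ('g \<Rightarrow> 'g \<Rightarrow> 'g) \<Rightarrow> 'g set \<Rightarrow> bool" where
  "simple_ideal sc br I \<longleftrightarrow>
     lie_ideal sc br I \<and> (\<exists>x\<in>I. \<exists>y\<in>I. br x y \<noteq> 0) \<and>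
     (\<forall>J. module.subspace sc J \<and> J \<subseteq> I \<and> (\<forall>x\<in>I. \<forall>y\<in>J. br x y \<in> J) \<longrightarrow> J = {0} \<or> J = I)"

primrec derived_series ::
  "('k::real_normed_field \<Rightarrow> 'g::euclidean_space \<Rightarrow> 'g) \<Rightarrow> ('g \<Rightarrow> 'g \<Rightarrow> 'g) \<Rightarrow> 'g set \<Rightarrow> nat \<Rightarrow> 'g set"
where
  "derived_series sc br I 0 = I"
| "derived_series sc br I (Suc n) =
     module.span sc {br x y | x y. x \<in> derived_series sc br I n \<and> y \<in> derived_series sc br I n}"

definition semisimple ::
  "('k::real_normed_field \<Rightarrow> 'g::euclidean_space \<Rightarrow> 'g) \<Rightarrow> ('g \<Rightarrow> 'g \<Rightarrow> 'g) \<Rightarrow> bool" where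
  "semisimple sc br \<longleftrightarrow> lie_algebra sc br \<and>
     (\<forall>I. lie_ideal sc br I \<and> (\<exists>n. derived_series sc br I n = {0}) \<longrightarrow> I = {0})"

definition filtration ::
  "('k::real_normed_field \<Rightarrow> 'g::euclidean_space \<Rightarrow> 'g) \<Rightarrow> (int \<Rightarrow> 'g set) \<Rightarrow> int \<Rightarrow> 'g set" where
  "filtration sc gr i = module.span sc (\<Union>l\<in>{i..}. gr l)"

definition parabolic_grading ::
  "('k::real_normed_field \<Rightarrow> 'g::euclidean_space \<Rightarrow> 'g) \<Rightarrow> ('g \<Rightarrow> 'g \<Rightarrow> 'g) \<Rightarrow>
   nat \<Rightarrow> (int \<Rightarrow> 'g set) \<Rightarrow> bool" where
  "parabolic_grading sc br m gr \<longleftrightarrow>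
     (\<forall>i. module.subspace sc (gr i)) \<and>
     (\<forall>i. \<bar>i\<bar> > int m \<longrightarrow> gr i = {0}) \<and>
     (\<forall>x. \<exists>!f. (\<forall>i. f i \<in> gr i) \<and> x = (\<Sum>i = - int m..int m. f i)) \<and>
     (\<forall>i j. \<forall>x\<in>gr i. \<forall>y\<in>gr j. br x y \<in> gr (i + j)) \<and>
     \<Inter>{S. lie_subalgebra sc br S \<and> gr 1 \<subseteq> S} = filtration sc gr 1 \<and>
     (\<nexists>I. simple_ideal sc br I \<and> I \<subseteq> gr 0)"

definition parabolic_subalgebra ::
  "('k::real_normed_field \<Rightarrow> 'g::euclidean_space \<Rightarrow> 'g) \<Rightarrow> (int \<Rightarrow> 'g set) \<Rightarrow> 'g set" where
  "parabolic_subalgebra sc gr = filtration sc gr 0"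


section \<open>Lie groups\<close>

text \<open>The Lie algebra of a Lie group is its tangent space at the unit, that is the model space, with
  the bracket of left invariant vector fields.\<close>

definition lie_group ::
  "('h::{t2_space, second_countable_topology}, 'g::euclidean_space) chart set \<Rightarrow> 'h monoid \<Rightarrow> bool"
where
  "lie_group GA G \<longleftrightarrow>
     group G \<and> carrier G = UNIV \<and> smooth_atlas GA \<and>
     smooth_map_on (prod_atlas GA GA) GA UNIV (\<lambda>(g, h). g \<otimes>\<^bsub>G\<^esub> h) \<and>
     smooth_map_on GA GA UNIV (\<lambda>g. m_inv G g)"

definition left_inv_field ::
  "('h, 'g::euclidean_space) chart set \<Rightarrow> 'h monoid \<Rightarrow> 'g \<Rightarrow> 'h \<Rightarrow> 'g" where
  "left_inv_field GA G X g = tangent_map GA GA (\<lambda>h. g \<otimes>\<^bsub>G\<^esub> h) \<one>\<^bsub>G\<^esub> X"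

definition lie_bracket ::
  "('h, 'g::euclidean_space) chart set \<Rightarrow> 'h monoid \<Rightarrow> 'g \<Rightarrow> 'g \<Rightarrow> 'g" where
  "lie_bracket GA G X Y =
     field_bracket GA (left_inv_field GA G X) (left_inv_field GA G Y) \<one>\<^bsub>G\<^esub>"

definition Ad :: "('h, 'g::euclidean_space) chart set \<Rightarrow> 'h monoid \<Rightarrow> 'h \<Rightarrow> 'g \<Rightarrow> 'g" where
  "Ad GA G g = tangent_map GA GA (\<lambda>h. g \<otimes>\<^bsub>G\<^esub> h \<otimes>\<^bsub>G\<^esub> m_inv G g) \<one>\<^bsub>G\<^esub>"

definition parabolic_subgroup ::
  "('k::real_normed_field \<Rightarrow> 'g::euclidean_space \<Rightarrow> 'g) \<Rightarrow> ('h, 'g) chart set \<Rightarrow> 'h monoid \<Rightarrow>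
   (int \<Rightarrow> 'g set) \<Rightarrow> 'h set" where
  "parabolic_subgroup sc GA G gr =
     {g \<in> carrier G. \<forall>i. Ad GA G g ` filtration sc gr i \<subseteq> filtration sc gr i}"


section \<open>Principal bundles and parabolic geometries\<close>

text \<open>The structure group \<open>Q\<close> is a closed subgroup of the Lie group \<open>G\<close>. A right action
  \<open>r\<close> is only relevant for group elements in \<open>Q\<close>.\<close>

definition principal_bundle ::
  "('h::{t2_space, second_countable_topology}, 'g::euclidean_space) chart set \<Rightarrow> 'h monoid \<Rightarrow> 'h set \<Rightarrow>
   ('p::{t2_space, second_countable_topology}, 'b::euclidean_space) chart set \<Rightarrow>
   ('m::{t2_space, second_countable_topology}, 'a::euclidean_space) chart set \<Rightarrow>
   ('p \<Rightarrow> 'm) \<Rightarrow> ('p \<Rightarrow> 'h \<Rightarrow> 'p) \<Rightarrow> bool" where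
  "principal_bundle GA G Q PA MA \<pi> r \<longleftrightarrow>
     smooth_atlas PA \<and> smooth_atlas MA \<and> smooth_map_on PA MA UNIV \<pi> \<and>
     smooth_map_on (prod_atlas PA GA) PA (UNIV \<times> Q) (\<lambda>(u, g). r u g) \<and>
     (\<forall>u. r u \<one>\<^bsub>G\<^esub> = u) \<and>
     (\<forall>u. \<forall>g\<in>Q. \<forall>h\<in>Q. r (r u g) h = r u (g \<otimes>\<^bsub>G\<^esub> h)) \<and>
     (\<forall>u. \<forall>g\<in>Q. \<pi> (r u g) = \<pi> u) \<and>
     (\<forall>x. \<exists>U \<tau>. open U \<and> x \<in> U \<and>
        bij_betw (\<lambda>u. (\<pi> u, \<tau> u)) (\<pi> -` U) (U \<times> Q) \<and>
        smooth_map_on PA (prod_atlas MA GA) (\<pi> -` U) (\<lambda>u. (\<pi> u, \<tau> u)) \<and>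
        smooth_map_on (prod_atlas MA GA) PA (U \<times> Q) (inv_into (\<pi> -` U) (\<lambda>u. (\<pi> u, \<tau> u))) \<and>
        (\<forall>u\<in>\<pi> -` U. \<forall>g\<in>Q. \<tau> (r u g) = \<tau> u \<otimes>\<^bsub>G\<^esub> g))"

text \<open>\<open>v\<close> is the value at \<open>u\<close> of the fundamental vector field generated by
  \<open>X\<close>, that is the image of \<open>X\<close> under the tangent map at the unit of
  the orbit map \<open>g \<mapsto> r u g\<close> on \<open>Q\<close>, computed along a curve in \<open>Q\<close>.\<close>

definition fundamental_vector ::
  "('h::topological_space, 'g::euclidean_space) chart set \<Rightarrow> 'h monoid \<Rightarrow> 'h set \<Rightarrow>
   ('p, 'b::euclidean_space) chart set \<Rightarrow> ('p \<Rightarrow> 'h \<Rightarrow> 'p) \<Rightarrow> 'g \<Rightarrow> 'p \<Rightarrow> 'b \<Rightarrow> bool" where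
  "fundamental_vector GA G Q PA r X u v \<longleftrightarrow>
     (\<exists>\<gamma>. smooth_map_on std_atlas GA UNIV \<gamma> \<and> range \<gamma> \<subseteq> Q \<and> \<gamma> 0 = \<one>\<^bsub>G\<^esub> \<and>
        velocity GA \<gamma> 0 = X \<and> v = velocity PA (\<lambda>t. r u (\<gamma> t)) 0)"

definition cartan_connection ::
  "('h::topological_space, 'g::euclidean_space) chart set \<Rightarrow> 'h monoid \<Rightarrow> 'h set \<Rightarrow> 'g set \<Rightarrow>
   ('p, 'b::euclidean_space) chart set \<Rightarrow> ('p \<Rightarrow> 'h \<Rightarrow> 'p) \<Rightarrow> ('p \<Rightarrow> 'b \<Rightarrow> 'g) \<Rightarrow> bool" where
  "cartan_connection GA G Q q PA r \<omega> \<longleftrightarrow>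
     smooth_one_form PA \<omega> \<and>
     (\<forall>X\<in>q. \<forall>u v. fundamental_vector GA G Q PA r X u v \<longrightarrow> \<omega> u v = X) \<and>
     (\<forall>g\<in>Q. \<forall>u v. \<omega> (r u g) (tangent_map PA PA (\<lambda>w. r w g) u v) = Ad GA G (m_inv G g) (\<omega> u v)) \<and>
     (\<forall>u. bij (\<omega> u))"

definition parabolic_geometry ::
  "('k::real_normed_field \<Rightarrow> 'g::euclidean_space \<Rightarrow> 'g) \<Rightarrow>
   ('h::{t2_space, second_countable_topology}, 'g) chart set \<Rightarrow> 'h monoid \<Rightarrow> (int \<Rightarrow> 'g set) \<Rightarrow>
   ('p::{t2_space, second_countable_topology}, 'b::euclidean_space) chart set \<Rightarrow>
   ('m::{t2_space, second_countable_topology}, 'a::euclidean_space) chart set \<Rightarrow>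
   ('p \<Rightarrow> 'm) \<Rightarrow> ('p \<Rightarrow> 'h \<Rightarrow> 'p) \<Rightarrow> ('p \<Rightarrow> 'b \<Rightarrow> 'g) \<Rightarrow> bool" where
  "parabolic_geometry sc GA G gr PA MA \<pi> r \<omega> \<longleftrightarrow>
     DIM('a) + dim (parabolic_subalgebra sc gr) = DIM('g) \<and>
     principal_bundle GA G (parabolic_subgroup sc GA G gr) PA MA \<pi> r \<and>
     cartan_connection GA G (parabolic_subgroup sc GA G gr) (parabolic_subalgebra sc gr) PA r \<omega>"

definition curvature ::
  "('p, 'b::euclidean_space) chart set \<Rightarrow> ('g \<Rightarrow> 'g \<Rightarrow> 'g) \<Rightarrow> ('p \<Rightarrow> 'b \<Rightarrow> 'g::euclidean_space) \<Rightarrow>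
   'p \<Rightarrow> 'g \<Rightarrow> 'g \<Rightarrow> 'g" where
  "curvature PA br \<omega> u X Y =
     ext_deriv PA \<omega> u (inv_into UNIV (\<omega> u) X) (inv_into UNIV (\<omega> u) Y) + br X Y"

text \<open>The distribution corresponding to a subspace \<open>p\<close>: all projections of tangent vectors that
  are mapped to \<open>p\<close> by the Cartan connection.\<close>

definition subalgebra_distribution ::
  "('p, 'b::euclidean_space) chart set \<Rightarrow> ('m, 'a::euclidean_space) chart set \<Rightarrow>
   ('p \<Rightarrow> 'm) \<Rightarrow> ('p \<Rightarrow> 'b \<Rightarrow> 'g) \<Rightarrow> 'g set \<Rightarrow> 'm \<Rightarrow> 'a set" where
  "subalgebra_distribution PA MA \<pi> \<omega> p x =
     {tangent_map PA MA \<pi> u v | u v. \<pi> u = x \<and> \<omega> u v \<in> p}"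

end

theory Submission
  imports Defs
begin

text \<open>As \<open>p\<close> is a subalgebra, the curvature condition says that \<open>d\<omega>(v, w) \<in> p\<close> whenever \<open>\<omega>(v)\<close> and
  \<open>\<omega>(w)\<close> lie in \<open>p\<close>. Vertical vectors are mapped to \<open>q\<close>, because a curve in \<open>Q\<close> preserves the
  filtration under \<open>Ad\<close>, and an element whose adjoint action preserves the filtration has no component
  of negative degree, as such a component would be central. With \<open>Q \<subseteq> P\<close> it follows that
  a tangent vector at \<open>u\<close> projects to \<open>E\<close> if and only if \<open>\<omega>\<close> maps it to \<open>p\<close>.

  If \<open>E\<close> is integrable, then \<open>\<omega>\<close> modulo \<open>p\<close> pulls back to zero along a retraction onto the preimage of an
  integral submanifold, so its exterior derivative vanishes on \<open>\<omega>\<^sup>-\<^sup>1(p)\<close>. Conversely, pulled back along a local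
  section, \<open>\<omega>\<close> modulo \<open>p\<close> becomes a form \<open>\<theta>\<close> on \<open>M\<close> with kernel \<open>E\<close>, and Frobenius' theorem applies: writing
  \<open>E\<close> at \<open>y\<close> as the range of a linear map \<open>\<Gamma>(y)\<close>, a leaf is the graph of a solution of the total differential
  equation \<open>D\<psi> = \<Gamma> \<circ> \<psi>\<close>. It is the limit of the Picard iteration along rays
  \<open>\<psi>\<^sub>n\<^sub>+\<^sub>1(z) = x\<^sub>0 + \<integral>\<^sub>0\<^sup>1 \<Gamma>(\<psi>\<^sub>n(t z)) z dt\<close>, whose defects \<open>D\<psi>\<^sub>n - \<Gamma> \<circ> \<psi>\<^sub>n\<close> tend to zero uniformly since \<open>E\<close> is
  involutive.\<close>


section \<open>Calculus of smooth maps\<close>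

text \<open>Tangent spaces are read in one preferred chart per point, and this choice may jump
  between neighbouring points. Forms are therefore differentiated only in a fixed chart, and the
  geometry runs through the functoriality of \<open>tangent_map\<close> and the naturality of the
  exterior derivative, which rests on the symmetry of second derivatives. Integrability demands
  genuine submanifolds, so a parametrised solution of the total differential equation has to be
  turned into a chart that flattens the leaf. Writing the solution as a graph over the kernel at the
  base point makes this chart a shear with an explicit inverse. The group \<open>Q\<close> carries
  no manifold structure of its own, and its Lie algebra is not assumed to be \<open>q\<close>, while
  \<omega> is prescribed only on fundamental vectors with generator in \<open>q\<close>. That every
  vertical vector has such a generator must be derived. Frobenius' theorem needs constant rank. It
  holds because \<omega> is bijective at each point and vertical vectors vanish modulo
  \<open>p\<close>: along a section, \<omega> modulo \<open>p\<close> already takes all its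
  values.\<close>

lemma frechet_derivativeI: "(f has_derivative f') (at x) \<Longrightarrow> frechet_derivative f (at x) = f'"
  using frechet_derivative_at by metis

section \<open>Closure properties of maps of class C^k\<close>

lemma Ck_on_subset: "Ck_on k S f \<Longrightarrow> T \<subseteq> S \<Longrightarrow> Ck_on k T f"
  by (induction k arbitrary: f) (auto intro: continuous_on_subset)

lemma Ck_on_Suc_imp: "Ck_on (Suc k) S f \<Longrightarrow> Ck_on k S f"
proof (induction k arbitrary: f)
  case 0
  then show ?case
    by (auto intro!: continuous_at_imp_continuous_on differentiable_imp_continuous_within)
next
  case (Suc k)
  then show ?case by (metis Ck_on.simps(2))
qed

lemma Ck_on_continuous: "Ck_on k S f \<Longrightarrow> continuous_on S f"
  by (induction k) (simp, blast dest: Ck_on_Suc_imp)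

text \<open>Openness of \<open>S\<close> matters: derivatives are taken in the full space, so
  agreement on \<open>S\<close> has to mean agreement near each of its points.\<close>

lemma Ck_on_cong:
  assumes "open S" "\<And>x. x \<in> S \<Longrightarrow> f x = g x"
  shows "Ck_on k S f \<longleftrightarrow> Ck_on k S g"
  using assms(2)
proof (induction k arbitrary: f g)
  case 0
  then show ?case by (simp cong: continuous_on_cong)
next
  case (Suc k)
  have fg: "(f has_derivative f') (at x) \<longleftrightarrow> (g has_derivative f') (at x)" if "x \<in> S" for x f'
    using has_derivative_transform_within_open[OF _ assms(1) that, of f f' UNIV g]
      has_derivative_transform_within_open[OF _ assms(1) that, of g f' UNIV f] Suc.prems by auto
  then have eq: "frechet_derivative f (at x) = frechet_derivative g (at x)" if "x \<in> S" for x
    using that by (simp add: frechet_derivative_def)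
  show ?case using Suc.IH[of "\<lambda>x. frechet_derivative f (at x) _" "\<lambda>x. frechet_derivative g (at x) _"] eq
    by (auto simp: differentiable_def fg)
qed

lemma Ck_on_local:
  assumes "\<And>x. x \<in> S \<Longrightarrow> \<exists>T. open T \<and> x \<in> T \<and> Ck_on k T f"
  shows "Ck_on k S f"
  using assms
proof (induction k arbitrary: f)
  case 0
  show ?case
    unfolding Ck_on.simps
  proof (rule continuous_at_imp_continuous_on, rule ballI)
    fix x assume "x \<in> S"
    then obtain T where "open T" "x \<in> T" "continuous_on T f" using 0 by auto
    then show "isCont f x" by (simp add: continuous_on_eq_continuous_at)
  qed
next
  case (Suc k)
  have "f differentiable at x" if "x \<in> S" for x using Suc.prems[OF that] by auto
  moreover have "Ck_on k S (\<lambda>x. frechet_derivative f (at x) v)" for v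
    by (rule Suc.IH) (use Suc.prems in force)
  ultimately show ?case by simp
qed

text \<open>With an explicit candidate for the derivative, closure properties reduce to
  differentiation rules and the induction hypothesis.\<close>

lemma Ck_on_Suc_I:
  assumes "open S" "\<And>x. x \<in> S \<Longrightarrow> (f has_derivative f' x) (at x)" "\<And>v. Ck_on k S (\<lambda>x. f' x v)"
  shows "Ck_on (Suc k) S f"
proof -
  have "Ck_on k S (\<lambda>x. frechet_derivative f (at x) v)" for v
    using assms(3)[of v] by (subst Ck_on_cong[OF assms(1)]) (auto dest!: frechet_derivativeI[OF assms(2)])
  then show ?thesis using assms(2) by (auto simp: differentiable_def)
qed

lemma Ck_on_SucD:
  assumes "Ck_on (Suc k) S f"
  shows "x \<in> S \<Longrightarrow> (f has_derivative frechet_derivative f (at x)) (at x)"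
    and "Ck_on k S (\<lambda>x. frechet_derivative f (at x) v)"
  using assms frechet_derivative_works by auto

lemma Ck_on_const [simp]: "open S \<Longrightarrow> Ck_on k S (\<lambda>x. c)"
  by (induction k arbitrary: c) auto

lemma Ck_on_bounded_linear:
  assumes "bounded_linear L" "open S" "Ck_on k S f"
  shows "Ck_on k S (\<lambda>x. L (f x))"
  using assms(3)
proof (induction k arbitrary: f)
  case 0
  then show ?case using bounded_linear.continuous_on[OF assms(1)] by simp
next
  case (Suc k)
  show ?case
    by (rule Ck_on_Suc_I[OF assms(2) bounded_linear.has_derivative[OF assms(1) Ck_on_SucD(1)[OF Suc.prems]]
          Suc.IH[OF Ck_on_SucD(2)[OF Suc.prems]]])
qed

lemma Ck_on_add:
  assumes "open S" "Ck_on k S f" "Ck_on k S g"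
  shows "Ck_on k S (\<lambda>x. f x + g x)"
  using assms(2,3)
proof (induction k arbitrary: f g)
  case 0
  then show ?case by (simp add: continuous_on_add)
next
  case (Suc k)
  show ?case
    by (rule Ck_on_Suc_I[OF assms(1) has_derivative_add[OF Ck_on_SucD(1)[OF Suc.prems(1)]
            Ck_on_SucD(1)[OF Suc.prems(2)]] Suc.IH[OF Ck_on_SucD(2)[OF Suc.prems(1)]
            Ck_on_SucD(2)[OF Suc.prems(2)]]])
qed

lemma Ck_on_sum:
  assumes "open S" "\<And>i. i \<in> I \<Longrightarrow> Ck_on k S (f i)"
  shows "Ck_on k S (\<lambda>x. \<Sum>i\<in>I. f i x)"
  using assms(2) by (induction I rule: infinite_finite_induct) (auto simp: assms(1) Ck_on_add)

lemma Ck_on_bilinear: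
  assumes "bounded_bilinear B" "open S" "Ck_on k S f" "Ck_on k S g"
  shows "Ck_on k S (\<lambda>x. B (f x) (g x))"
  using assms(3,4)
proof (induction k arbitrary: f g)
  case 0
  then show ?case using bounded_bilinear.continuous_on[OF assms(1)] by simp
next
  case (Suc k)
  show ?case
    by (rule Ck_on_Suc_I[OF assms(2) bounded_bilinear.FDERIV[OF assms(1) Ck_on_SucD(1)[OF Suc.prems(1)]
            Ck_on_SucD(1)[OF Suc.prems(2)]]])
      (auto intro!: Ck_on_add[OF assms(2)] Suc.IH Ck_on_SucD(2)[OF Suc.prems(1)]
        Ck_on_SucD(2)[OF Suc.prems(2)] Ck_on_Suc_imp[OF Suc.prems(1)] Ck_on_Suc_imp[OF Suc.prems(2)]
        simp del: Ck_on.simps)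
qed

lemma linear_expand_Basis:
  fixes L :: "'a::euclidean_space \<Rightarrow> 'b::real_vector"
  assumes "linear L" shows "L v = (\<Sum>i\<in>Basis. (v \<bullet> i) *\<^sub>R L i)"
proof -
  have "L v = L (\<Sum>i\<in>Basis. (v \<bullet> i) *\<^sub>R i)" by (simp add: euclidean_representation)
  then show ?thesis by (simp add: linear_sum[OF assms] linear_cmul[OF assms])
qed

text \<open>Families of linear maps are handled vector by vector, without a topology on the space of
  linear maps. Expanding the argument in the basis turns evaluation into a finite sum of
  products.\<close>

lemma Ck_on_apply:
  fixes F :: "'a::euclidean_space \<Rightarrow> 'b::euclidean_space \<Rightarrow> 'c::euclidean_space"
  assumes "open S" "\<And>x. x \<in> S \<Longrightarrow> linear (F x)" "\<And>v. Ck_on k S (\<lambda>x. F x v)" "Ck_on k S f"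
  shows "Ck_on k S (\<lambda>x. F x (f x))"
proof -
  have "Ck_on k S (\<lambda>x. \<Sum>i\<in>Basis. (f x \<bullet> i) *\<^sub>R F x i)"
    by (intro Ck_on_sum assms(1) Ck_on_bilinear[OF bounded_bilinear_scaleR]
        Ck_on_bounded_linear[OF bounded_linear_inner_left] assms)
  then show ?thesis
    by (subst Ck_on_cong[OF assms(1)]) (auto intro: linear_expand_Basis assms(2))
qed

text \<open>By the chain rule the derivative is an evaluation of the derivative of \<open>g\<close>
  along \<open>f\<close>, so \<open>Ck_on_apply\<close> closes the step. Only \<open>g\<close>
  varies in the induction; \<open>f\<close> merely drops one order.\<close>

lemma Ck_on_compose:
  fixes f :: "'a::euclidean_space \<Rightarrow> 'b::euclidean_space" and g :: "'b \<Rightarrow> 'c::euclidean_space"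
  assumes "open S" "open T" "\<And>x. x \<in> S \<Longrightarrow> f x \<in> T" "Ck_on k S f" "Ck_on k T g"
  shows "Ck_on k S (\<lambda>x. g (f x))"
  using assms(4,5)
proof (induction k arbitrary: g)
  case 0
  then show ?case using assms(3) by (auto intro: continuous_on_compose2[of T g S f])
next
  case (Suc k)
  let ?Df = "\<lambda>x. frechet_derivative f (at x)" and ?Dg = "\<lambda>x. frechet_derivative g (at x)"
  have d: "((\<lambda>x. g (f x)) has_derivative (\<lambda>v. ?Dg (f x) (?Df x v))) (at x)" if "x \<in> S" for x
    using diff_chain_at[OF Ck_on_SucD(1)[OF Suc.prems(1) that]
        Ck_on_SucD(1)[OF Suc.prems(2) assms(3)[OF that]]] by (simp add: o_def)
  show ?case
  proof (rule Ck_on_Suc_I[OF assms(1) d])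
    fix v
    show "Ck_on k S (\<lambda>x. ?Dg (f x) (?Df x v))"
    proof (rule Ck_on_apply[OF assms(1), where F = "\<lambda>x. ?Dg (f x)" and f = "\<lambda>x. ?Df x v"])
      show "linear (?Dg (f x))" if "x \<in> S" for x
        using Ck_on_SucD(1)[OF Suc.prems(2) assms(3)[OF that]] by (rule has_derivative_linear)
    qed (rule Suc.IH[OF Ck_on_Suc_imp[OF Suc.prems(1)] Ck_on_SucD(2)[OF Suc.prems(2)]]
        Ck_on_SucD(2)[OF Suc.prems(1)])+
  qed
qed

section \<open>Rules for smooth maps\<close>

lemma smooth_on_open_subset: "smooth_on S f \<Longrightarrow> T \<subseteq> S \<Longrightarrow> smooth_on T f"
  by (auto simp: smooth_on_def intro: Ck_on_subset)

lemma smooth_on_cong: "open S \<Longrightarrow> (\<And>x. x \<in> S \<Longrightarrow> f x = g x) \<Longrightarrow> smooth_on S f \<longleftrightarrow> smooth_on S g"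
  unfolding smooth_on_def by (metis Ck_on_cong)

lemma smooth_on_local:
  "(\<And>x. x \<in> S \<Longrightarrow> \<exists>T. open T \<and> x \<in> T \<and> smooth_on T f) \<Longrightarrow> smooth_on S f"
  unfolding smooth_on_def by (meson Ck_on_local)

lemma smooth_on_continuous: "smooth_on S f \<Longrightarrow> continuous_on S f"
  by (auto simp: smooth_on_def intro: Ck_on_continuous)

lemma smooth_on_has_derivative:
  "smooth_on S f \<Longrightarrow> x \<in> S \<Longrightarrow> (f has_derivative frechet_derivative f (at x)) (at x)"
  unfolding smooth_on_def using Ck_on_SucD(1) by blast

lemma smooth_on_derivative: "smooth_on S f \<Longrightarrow> smooth_on S (\<lambda>x. frechet_derivative f (at x) v)"
  unfolding smooth_on_def using Ck_on_SucD(2) by blast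

lemma smooth_on_linear_derivative:
  "smooth_on S f \<Longrightarrow> x \<in> S \<Longrightarrow> linear (frechet_derivative f (at x))"
  by (rule has_derivative_linear[OF smooth_on_has_derivative])

lemma smooth_on_const [simp]: "open S \<Longrightarrow> smooth_on S (\<lambda>x. c)"
  by (simp add: smooth_on_def)

lemma smooth_on_linear: "open S \<Longrightarrow> linear L \<Longrightarrow> smooth_on S f \<Longrightarrow> smooth_on S (\<lambda>x. L (f x))"
  by (simp add: smooth_on_def linear_conv_bounded_linear Ck_on_bounded_linear)

lemma smooth_on_ident [simp]:
  assumes "open S" shows "smooth_on S (\<lambda>x. x)"
proof -
  have "Ck_on k S (\<lambda>x. x)" for k
    by (cases k) (auto intro!: Ck_on_Suc_I[OF assms has_derivative_ident] simp: assms)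
  then show ?thesis by (simp add: smooth_on_def)
qed

lemma smooth_on_add: "open S \<Longrightarrow> smooth_on S f \<Longrightarrow> smooth_on S g \<Longrightarrow> smooth_on S (\<lambda>x. f x + g x)"
  by (simp add: smooth_on_def Ck_on_add)

lemma smooth_on_diff:
  assumes "open S" "smooth_on S f" "smooth_on S g" shows "smooth_on S (\<lambda>x. f x - g x)"
  using smooth_on_add[OF assms(1,2) smooth_on_linear[OF assms(1) linear_uminus assms(3)]] by simp

lemma smooth_on_apply:
  fixes F :: "'a::euclidean_space \<Rightarrow> 'b::euclidean_space \<Rightarrow> 'c::euclidean_space"
  assumes "open S" "\<And>x. x \<in> S \<Longrightarrow> linear (F x)" "\<And>v. smooth_on S (\<lambda>x. F x v)" "smooth_on S f"
  shows "smooth_on S (\<lambda>x. F x (f x))"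
  using assms unfolding smooth_on_def by (blast intro: Ck_on_apply)

lemma smooth_on_compose:
  assumes "open S" "open T" "\<And>x. x \<in> S \<Longrightarrow> f x \<in> T" "smooth_on S f" "smooth_on T g"
  shows "smooth_on S (\<lambda>x. g (f x))"
  using assms unfolding smooth_on_def by (blast intro: Ck_on_compose)

lemma smooth_on_Pair:
  assumes "open S" "smooth_on S f" "smooth_on S g" shows "smooth_on S (\<lambda>x. (f x, g x))"
proof -
  have "smooth_on S (\<lambda>x. (f x, 0) + (0, g x))"
    by (intro smooth_on_add assms(1) smooth_on_linear[where f=f, OF assms(1) _ assms(2)]
        smooth_on_linear[where f=g, OF assms(1) _ assms(3)]) (auto intro!: linearI)
  then show ?thesis by simp
qed

lemma smooth_on_fst: "open S \<Longrightarrow> smooth_on S f \<Longrightarrow> smooth_on S (\<lambda>x. fst (f x))"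
  by (rule smooth_on_linear) (auto intro: linearI)

lemma smooth_on_snd: "open S \<Longrightarrow> smooth_on S f \<Longrightarrow> smooth_on S (\<lambda>x. snd (f x))"
  by (rule smooth_on_linear) (auto intro: linearI)

text \<open>Expansion in the basis again reduces evaluation to finitely many products. The explicit
  derivative serves for the second-order terms in \<open>form_deriv_pullback\<close> and for
  differentiating identities such as \<open>\<theta> y (\<Gamma> y v) = 0\<close>.\<close>

lemma has_derivative_apply:
  fixes F :: "'a::euclidean_space \<Rightarrow> 'b::euclidean_space \<Rightarrow> 'c::euclidean_space"
  assumes "open S" "x \<in> S" "\<And>y. y \<in> S \<Longrightarrow> linear (F y)"
    and F': "\<And>v. ((\<lambda>y. F y v) has_derivative F' v) (at x)"
    and f': "(f has_derivative f') (at x)"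
  shows "((\<lambda>y. F y (f y)) has_derivative (\<lambda>h. F' (f x) h + F x (f' h))) (at x)"
proof -
  let ?g = "\<lambda>y. \<Sum>i\<in>Basis. (f y \<bullet> i) *\<^sub>R F y i"
  have sum: "((\<lambda>y. F y v) has_derivative (\<lambda>h. \<Sum>i\<in>Basis. (v \<bullet> i) *\<^sub>R F' i h)) (at x)" for v
  proof -
    have "((\<lambda>y. \<Sum>i\<in>Basis. (v \<bullet> i) *\<^sub>R F y i) has_derivative (\<lambda>h. \<Sum>i\<in>Basis. (v \<bullet> i) *\<^sub>R F' i h)) (at x)"
      by (intro derivative_intros F')
    then show ?thesis
      by (rule has_derivative_transform_within_open[OF _ assms(1,2)])
        (rule linear_expand_Basis[OF assms(3), symmetric])
  qed
  \<comment> \<open>The derivatives \<open>F' v\<close> are given separately for each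
    \<open>v\<close>; uniqueness of derivatives makes them linear in \<open>v\<close>.\<close>
  have F'sum: "F' v h = (\<Sum>i\<in>Basis. (v \<bullet> i) *\<^sub>R F' i h)" for v h
    using has_derivative_unique[OF F'[of v] sum[of v]] by metis
  have "(?g has_derivative (\<lambda>h. \<Sum>i\<in>Basis. (f x \<bullet> i) *\<^sub>R F' i h + (f' h \<bullet> i) *\<^sub>R F x i)) (at x)"
    by (intro derivative_intros has_derivative_scaleR has_derivative_inner_left f' F')
  moreover have "(\<Sum>i\<in>Basis. (f x \<bullet> i) *\<^sub>R F' i h + (f' h \<bullet> i) *\<^sub>R F x i) = F' (f x) h + F x (f' h)" for h
    by (simp add: sum.distrib F'sum[of "f x"] linear_expand_Basis[OF assms(3)[OF assms(2)], of "f' h"])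
  ultimately have "(?g has_derivative (\<lambda>h. F' (f x) h + F x (f' h))) (at x)" by simp
  then show ?thesis
    by (rule has_derivative_transform_within_open[OF _ assms(1,2)])
      (rule linear_expand_Basis[OF assms(3), symmetric])
qed

section \<open>Symmetry of second derivatives\<close>

lemma mixed_difference_quotient:
  fixes f :: "'a::euclidean_space \<Rightarrow> real" and v w :: 'a
  assumes "open S" "smooth_on S f" "z \<in> S" "e > 0"
  defines "D \<equiv> \<lambda>x. frechet_derivative (\<lambda>y. frechet_derivative f (at y) v) (at x) w"
  shows "\<exists>d>0. \<forall>h. 0 < h \<and> h < d \<longrightarrow>
    \<bar>(f (z + h *\<^sub>R v + h *\<^sub>R w) - f (z + h *\<^sub>R v) - f (z + h *\<^sub>R w) + f z) / (h * h) - D z\<bar> < e"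
proof -
  have "continuous_on S D"
    unfolding D_def by (intro smooth_on_continuous smooth_on_derivative assms)
  then obtain d1 where d1: "d1 > 0" "\<And>y. y \<in> S \<Longrightarrow> dist y z < d1 \<Longrightarrow> dist (D y) (D z) < e"
    using assms(3,4) by (force simp: continuous_on_iff)
  obtain d2 where d2: "d2 > 0" "ball z d2 \<subseteq> S"
    using assms(1,3) open_contains_ball by blast
  \<comment> \<open>For steps below \<open>d\<close> the parallelogram with sides along
    \<open>v\<close> and \<open>w\<close> stays inside both balls; the summand 1 keeps the
    denominator positive when \<open>v\<close> and \<open>w\<close> vanish.\<close>
  define d where "d = min d1 d2 / (norm v + norm w + 1)"
  have pos: "norm v + norm w + 1 > 0" by (smt (verit) norm_ge_zero)
  have d: "d > 0" using d1 d2 pos by (simp add: d_def)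
  have near: "dist (z + s *\<^sub>R v + t *\<^sub>R w) z < min d1 d2" if "0 \<le> s" "s < d" "0 \<le> t" "t < d" for s t
  proof -
    have "dist (z + s *\<^sub>R v + t *\<^sub>R w) z \<le> s * norm v + t * norm w"
      using norm_triangle_ineq[of "s *\<^sub>R v" "t *\<^sub>R w"] that by (simp add: dist_norm algebra_simps)
    also have "\<dots> \<le> d * norm v + d * norm w"
      using that by (intro add_mono mult_right_mono) auto
    also have "\<dots> < d * (norm v + norm w + 1)" using d by (simp add: algebra_simps)
    also have "\<dots> = min d1 d2" using pos by (simp add: d_def)
    finally show ?thesis .
  qed
  then have inS: "z + s *\<^sub>R v + t *\<^sub>R w \<in> S" if "0 \<le> s" "s < d" "0 \<le> t" "t < d" for s t
    using d2(2) that by (fastforce simp: dist_commute)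
  have inS': "z + t *\<^sub>R w + s *\<^sub>R v \<in> S" if "0 \<le> s" "s < d" "0 \<le> t" "t < d" for s t
    using inS[OF that] by (simp add: add_ac)
  have inS0: "z + s *\<^sub>R v \<in> S" if "0 \<le> s" "s < d" for s
    using inS[OF that, of 0] d by simp
  have deriv: "((\<lambda>s. g (c + s *\<^sub>R u)) has_field_derivative frechet_derivative g (at (c + s *\<^sub>R u)) u) (at s)"
    if "smooth_on S g" "c + s *\<^sub>R u \<in> S" for g :: "'a \<Rightarrow> real" and c u s
  proof -
    have "((\<lambda>s. c + s *\<^sub>R u) has_derivative (\<lambda>h. h *\<^sub>R u)) (at s)" by (auto intro!: derivative_eq_intros)
    from diff_chain_at[OF this smooth_on_has_derivative[OF that]]
    have "((\<lambda>s. g (c + s *\<^sub>R u)) has_derivative (\<lambda>h. frechet_derivative g (at (c + s *\<^sub>R u)) (h *\<^sub>R u))) (at s)"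
      by (simp add: o_def)
    moreover have "frechet_derivative g (at (c + s *\<^sub>R u)) (h *\<^sub>R u) = h * frechet_derivative g (at (c + s *\<^sub>R u)) u" for h
      using linear_cmul[OF smooth_on_linear_derivative[OF that]] by simp
    ultimately show ?thesis by (simp add: has_field_derivative_def mult.commute[of _ "frechet_derivative _ _ _"])
  qed
  show ?thesis
  proof (intro exI[of _ d] conjI d allI impI)
    fix h assume h: "0 < h \<and> h < d"
    \<comment> \<open>The mean value theorem is applied along \<open>v\<close> to the difference of
      \<open>f\<close> over the side \<open>h *\<^sub>R w\<close>. A second application along
      \<open>w\<close> then exhibits the second difference as \<open>h * h\<close> times a value of
      \<open>D\<close> near \<open>z\<close>.\<close>
    have "\<exists>s. 0 < s \<and> s < h \<and> (f (z + h *\<^sub>R w + h *\<^sub>R v) - f (z + h *\<^sub>R v)) - (f (z + h *\<^sub>R w + 0 *\<^sub>R v) - f (z + 0 *\<^sub>R v))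
        = (h - 0) * (frechet_derivative f (at (z + h *\<^sub>R w + s *\<^sub>R v)) v - frechet_derivative f (at (z + s *\<^sub>R v)) v)"
      by (rule MVT2) (use h in \<open>auto intro!: DERIV_diff deriv assms(2) inS' inS0\<close>)
    then obtain s where s: "0 < s" "s < h" and 1: "f (z + h *\<^sub>R v + h *\<^sub>R w) - f (z + h *\<^sub>R v) - f (z + h *\<^sub>R w) + f z
        = h * (frechet_derivative f (at (z + s *\<^sub>R v + h *\<^sub>R w)) v - frechet_derivative f (at (z + s *\<^sub>R v)) v)"
      by (auto simp: algebra_simps)
    have "\<exists>t. 0 < t \<and> t < h \<and> frechet_derivative f (at (z + s *\<^sub>R v + h *\<^sub>R w)) v - frechet_derivative f (at (z + s *\<^sub>R v + 0 *\<^sub>R w)) v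
        = (h - 0) * D (z + s *\<^sub>R v + t *\<^sub>R w)"
      unfolding D_def
      by (rule MVT2) (use h s inS[of s] in \<open>auto intro!: deriv smooth_on_derivative assms(2)\<close>)
    then obtain t where t: "0 < t" "t < h" and 2: "frechet_derivative f (at (z + s *\<^sub>R v + h *\<^sub>R w)) v - frechet_derivative f (at (z + s *\<^sub>R v)) v
        = h * D (z + s *\<^sub>R v + t *\<^sub>R w)" by auto
    have "dist (D (z + s *\<^sub>R v + t *\<^sub>R w)) (D z) < e"
      using s t h by (intro d1(2) inS) (use near[of s t] in auto)
    then show "\<bar>(f (z + h *\<^sub>R v + h *\<^sub>R w) - f (z + h *\<^sub>R v) - f (z + h *\<^sub>R w) + f z) / (h * h) - D z\<bar> < e"
      using h unfolding 1 2 by (simp add: dist_real_def)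
  qed
qed

text \<open>The second difference quotient does not change when \<open>v\<close> and
  \<open>w\<close> are exchanged, and both mixed derivatives are its limit. No number is closer to
  each of two distinct values than half their distance.\<close>

lemma smooth_on_second_derivative_real:
  fixes f :: "'a::euclidean_space \<Rightarrow> real"
  assumes "open S" "smooth_on S f" "z \<in> S"
  shows "frechet_derivative (\<lambda>y. frechet_derivative f (at y) v) (at z) w =
    frechet_derivative (\<lambda>y. frechet_derivative f (at y) w) (at z) v" (is "?a = ?b")
proof (rule ccontr)
  assume "?a \<noteq> ?b"
  then have e: "\<bar>?a - ?b\<bar> / 2 > 0" by simp
  obtain d1 where d1: "d1 > 0" "\<And>h. 0 < h \<and> h < d1 \<Longrightarrow>
    \<bar>(f (z + h *\<^sub>R v + h *\<^sub>R w) - f (z + h *\<^sub>R v) - f (z + h *\<^sub>R w) + f z) / (h * h) - ?a\<bar> < \<bar>?a - ?b\<bar> / 2"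
    using mixed_difference_quotient[OF assms e] by metis
  obtain d2 where d2: "d2 > 0" "\<And>h. 0 < h \<and> h < d2 \<Longrightarrow>
    \<bar>(f (z + h *\<^sub>R w + h *\<^sub>R v) - f (z + h *\<^sub>R w) - f (z + h *\<^sub>R v) + f z) / (h * h) - ?b\<bar> < \<bar>?a - ?b\<bar> / 2"
    using mixed_difference_quotient[OF assms e] by metis
  define h where "h = min d1 d2 / 2"
  have h: "0 < h \<and> h < d1" "0 < h \<and> h < d2" using d1 d2 by (auto simp: h_def)
  have "f (z + h *\<^sub>R w + h *\<^sub>R v) - f (z + h *\<^sub>R w) - f (z + h *\<^sub>R v) + f z =
      f (z + h *\<^sub>R v + h *\<^sub>R w) - f (z + h *\<^sub>R v) - f (z + h *\<^sub>R w) + f z"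
    by (simp add: algebra_simps)
  moreover have "\<not> (\<bar>X - a\<bar> < \<bar>a - b\<bar> / 2 \<and> \<bar>X - b\<bar> < \<bar>a - b\<bar> / 2)" for X a b :: real
  proof -
    have "\<bar>a - b\<bar> \<le> \<bar>X - b\<bar> + \<bar>X - a\<bar>"
      using abs_triangle_ineq4[of "X - b" "X - a"] by simp
    then show ?thesis by argo
  qed
  ultimately show False using d1(2)[OF h(1)] d2(2)[OF h(2)] by (metis (no_types, lifting))
qed

lemma smooth_on_second_derivative:
  fixes f :: "'a::euclidean_space \<Rightarrow> 'b::euclidean_space"
  assumes "open S" "smooth_on S f" "z \<in> S"
  shows "frechet_derivative (\<lambda>y. frechet_derivative f (at y) v) (at z) w =
    frechet_derivative (\<lambda>y. frechet_derivative f (at y) w) (at z) v"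
proof (rule euclidean_eqI)
  fix i :: 'b assume "i \<in> Basis"
  have sm: "smooth_on S (\<lambda>y. f y \<bullet> i)"
    by (rule smooth_on_linear[OF assms(1) _ assms(2)]) (simp add: bounded_linear_inner_left bounded_linear.linear)
  have 1: "frechet_derivative (\<lambda>y. f y \<bullet> i) (at y) v = frechet_derivative f (at y) v \<bullet> i" if "y \<in> S" for y v
    using frechet_derivativeI[OF has_derivative_inner_left[OF smooth_on_has_derivative[OF assms(2) that]], of i] by simp
  have 2: "frechet_derivative (\<lambda>y. frechet_derivative (\<lambda>y. f y \<bullet> i) (at y) v) (at z) w =
      frechet_derivative (\<lambda>y. frechet_derivative f (at y) v) (at z) w \<bullet> i" for v w
  proof -
    have "((\<lambda>y. frechet_derivative f (at y) v \<bullet> i) has_derivative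
        (\<lambda>w. frechet_derivative (\<lambda>y. frechet_derivative f (at y) v) (at z) w \<bullet> i)) (at z)"
      by (intro has_derivative_inner_left smooth_on_has_derivative[OF smooth_on_derivative[OF assms(2)] assms(3)])
    then have "((\<lambda>y. frechet_derivative (\<lambda>y. f y \<bullet> i) (at y) v) has_derivative
        (\<lambda>w. frechet_derivative (\<lambda>y. frechet_derivative f (at y) v) (at z) w \<bullet> i)) (at z)"
      by (rule has_derivative_transform_within_open[OF _ assms(1,3)]) (simp add: 1)
    then show ?thesis by (auto dest!: frechet_derivativeI)
  qed
  show "frechet_derivative (\<lambda>y. frechet_derivative f (at y) v) (at z) w \<bullet> i =
      frechet_derivative (\<lambda>y. frechet_derivative f (at y) w) (at z) v \<bullet> i"
    using smooth_on_second_derivative_real[OF assms(1) sm assms(3), of v w] by (simp add: 2)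
qed

section \<open>Exterior derivatives in coordinates\<close>

definition form_deriv :: "('a::euclidean_space \<Rightarrow> 'a \<Rightarrow> 'g::euclidean_space) \<Rightarrow> 'a \<Rightarrow> 'a \<Rightarrow> 'a \<Rightarrow> 'g" where
  "form_deriv \<Theta> z v w =
     frechet_derivative (\<lambda>y. \<Theta> y w) (at z) v - frechet_derivative (\<lambda>y. \<Theta> y v) (at z) w"

lemma form_deriv_cong:
  assumes "open S" "z \<in> S" "\<And>y v. y \<in> S \<Longrightarrow> \<Theta> y v = \<Theta>' y v"
    and "\<And>v. (\<lambda>y. \<Theta> y v) differentiable at z"
  shows "form_deriv \<Theta> z v w = form_deriv \<Theta>' z v w"
proof -
  have "frechet_derivative (\<lambda>y. \<Theta> y u) (at z) = frechet_derivative (\<lambda>y. \<Theta>' y u) (at z)" for u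
    using assms by (intro frechet_derivative_transform_within_open[of _ z S]) auto
  then show ?thesis by (simp add: form_deriv_def)
qed

text \<open>The product rule yields two terms. The one with the second derivative of
  \<open>f\<close> is symmetric in \<open>v\<close> and \<open>w\<close> and cancels; the other is
  the pullback of the exterior derivative.\<close>

lemma form_deriv_pullback:
  fixes f :: "'c::euclidean_space \<Rightarrow> 'b::euclidean_space" and \<Theta> :: "'b \<Rightarrow> 'b \<Rightarrow> 'g::euclidean_space"
  assumes "open S" "smooth_on S f" "\<And>x. x \<in> S \<Longrightarrow> f x \<in> T"
    and "\<And>y. y \<in> T \<Longrightarrow> linear (\<Theta> y)" "\<And>v. smooth_on T (\<lambda>y. \<Theta> y v)" "z \<in> S"
  shows "form_deriv (\<lambda>x v. \<Theta> (f x) (frechet_derivative f (at x) v)) z v w =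
    form_deriv \<Theta> (f z) (frechet_derivative f (at z) v) (frechet_derivative f (at z) w)"
proof -
  let ?D = "\<lambda>x. frechet_derivative f (at x)"
  have "((\<lambda>x. \<Theta> (f x) (?D x w)) has_derivative
      (\<lambda>h. frechet_derivative (\<lambda>y. \<Theta> y (?D z w)) (at (f z)) (?D z h) +
           \<Theta> (f z) (frechet_derivative (\<lambda>x. ?D x w) (at z) h))) (at z)" for w
  proof (rule has_derivative_apply[OF assms(1,6), where F = "\<lambda>x. \<Theta> (f x)" and
        F' = "\<lambda>v h. frechet_derivative (\<lambda>y. \<Theta> y v) (at (f z)) (?D z h)" and f' = "frechet_derivative (\<lambda>x. ?D x w) (at z)"])
    show "linear (\<Theta> (f y))" if "y \<in> S" for y using assms that by blast
    show "((\<lambda>y. \<Theta> (f y) v) has_derivative (\<lambda>h. frechet_derivative (\<lambda>y. \<Theta> y v) (at (f z)) (?D z h))) (at z)" for v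
      using diff_chain_at[OF smooth_on_has_derivative[OF assms(2,6)]
          smooth_on_has_derivative[OF assms(5) assms(3)[OF assms(6)]]] by (simp add: o_def)
  qed (rule smooth_on_has_derivative[OF smooth_on_derivative[OF assms(2)] assms(6)])
  from frechet_derivativeI[OF this] show ?thesis
    by (simp add: form_deriv_def smooth_on_second_derivative[OF assms(1,2,6), of v w])
qed

section \<open>Smooth dependence of inverses of linear maps\<close>

lemma has_derivative_scaleR_zero:
  fixes \<phi> :: "'a::real_normed_vector \<Rightarrow> real" and \<psi> :: "'a \<Rightarrow> 'b::real_normed_vector"
  assumes "(\<phi> has_derivative \<phi>') (at x)" "\<phi> x = 0" "isCont \<psi> x"
  shows "((\<lambda>y. \<phi> y *\<^sub>R \<psi> y) has_derivative (\<lambda>h. \<phi>' h *\<^sub>R \<psi> x)) (at x)"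
proof -
  have bl: "bounded_linear \<phi>'" using assms(1) by (rule has_derivative_bounded_linear)
  obtain K where K: "\<And>h. \<bar>\<phi>' h\<bar> \<le> norm h * K" using bounded_linear.bounded[OF bl] by auto
  have lim: "((\<lambda>y. (\<phi> y - \<phi>' (y - x)) /\<^sub>R norm (y - x)) \<longlongrightarrow> 0) (at x)"
    using assms(1,2) by (simp add: has_derivative_at_within)
  have cont: "(\<psi> \<longlongrightarrow> \<psi> x) (at x)" using assms(3) by (simp add: isCont_def)
  \<comment> \<open>The second factor is merely continuous. Since \<open>\<phi>\<close> vanishes at
    \<open>x\<close>, its increment only meets the bounded quotient of \<open>\<phi>'\<close>, so it
    contributes nothing to first order.\<close>
  have "((\<lambda>y. (\<phi>' (y - x) / norm (y - x)) *\<^sub>R (\<psi> y - \<psi> x)) \<longlongrightarrow> 0) (at x)"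
  proof (rule tendsto_0_le[where K = K])
    show "((\<lambda>y. \<psi> y - \<psi> x) \<longlongrightarrow> 0) (at x)" using cont by (simp add: LIM_zero)
    show "\<forall>\<^sub>F y in at x. norm ((\<phi>' (y - x) / norm (y - x)) *\<^sub>R (\<psi> y - \<psi> x)) \<le> norm (\<psi> y - \<psi> x) * K"
    proof (rule eventually_at_topological[THEN iffD2], intro exI[of _ UNIV] conjI ballI impI)
      fix y assume "y \<noteq> x"
      then have "\<bar>\<phi>' (y - x)\<bar> / norm (y - x) \<le> K"
        using K[of "y - x"] by (simp add: divide_le_eq mult.commute)
      then show "norm ((\<phi>' (y - x) / norm (y - x)) *\<^sub>R (\<psi> y - \<psi> x)) \<le> norm (\<psi> y - \<psi> x) * K"
        unfolding norm_scaleR real_norm_def abs_divide abs_norm_cancel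
        using mult_right_mono[OF _ norm_ge_zero] by (simp only: mult.commute[of _ K])
    qed auto
  qed
  from tendsto_add[OF tendsto_scaleR[OF lim cont] this]
  have "((\<lambda>y. (\<phi> y *\<^sub>R \<psi> y - \<phi>' (y - x) *\<^sub>R \<psi> x) /\<^sub>R norm (y - x)) \<longlongrightarrow> 0) (at x)"
    by (simp add: algebra_simps divide_inverse)
  then show ?thesis using bl assms(2)
    by (auto simp: has_derivative_at_within intro: bounded_linear_compose[OF bounded_linear_scaleR_left])
qed

lemma linear_norm_le_Basis:
  fixes L :: "'a::euclidean_space \<Rightarrow> 'b::real_normed_vector"
  assumes "linear L" shows "norm (L v) \<le> norm v * (\<Sum>i\<in>Basis. norm (L i))"
proof -
  have "norm (L v) \<le> (\<Sum>i\<in>Basis. norm ((v \<bullet> i) *\<^sub>R L i))"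
    unfolding linear_expand_Basis[OF assms, of v] by (rule norm_sum)
  also have "\<dots> \<le> (\<Sum>i\<in>Basis. norm v * norm (L i))"
    by (intro sum_mono) (auto intro!: mult_right_mono Basis_le_norm)
  finally show ?thesis by (simp add: sum_distrib_left)
qed

context
  fixes L M :: "'a::euclidean_space \<Rightarrow> 'b::euclidean_space \<Rightarrow> 'b" and S :: "'a set"
  assumes S: "open S"
    and L: "\<And>y. y \<in> S \<Longrightarrow> linear (L y)" and smooth_L: "\<And>v. smooth_on S (\<lambda>y. L y v)"
    and inv_right: "\<And>y v. y \<in> S \<Longrightarrow> L y (M y v) = v" and inv_left: "\<And>y v. y \<in> S \<Longrightarrow> M y (L y v) = v"
begin

lemma linear_inverse_family: "y \<in> S \<Longrightarrow> linear (M y)"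
proof (rule linearI)
  assume y: "y \<in> S"
  show "M y (a + b) = M y a + M y b" for a b
    using inv_left[OF y, of "M y a + M y b"] by (simp add: linear_add[OF L[OF y]] inv_right y)
  show "M y (c *\<^sub>R a) = c *\<^sub>R M y a" for c a
    using inv_left[OF y, of "c *\<^sub>R M y a"] by (simp add: linear_cmul[OF L[OF y]] inv_right y)
qed

text \<open>Let \<open>C\<close> bound \<open>M x\<close>. Once \<open>L y\<close> is within
  \<open>1 / (2 * C)\<close> of \<open>L x\<close>, the maps \<open>M y\<close> are bounded by
  \<open>2 * C\<close>, and \<open>M y u - M x u = - M y (L y (M x u) - L x (M x u))\<close> tends
  to zero.\<close>

lemma isCont_inverse_family:
  assumes x: "x \<in> S" shows "isCont (\<lambda>y. M y u) x"
proof -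
  obtain C where C: "C > 0" "\<And>v. norm (M x v) \<le> norm v * C"
    using bounded_linear.pos_bounded[of "M x"] linear_inverse_family[OF x]
    by (auto simp: linear_conv_bounded_linear)
  let ?N = "\<lambda>y. \<Sum>i\<in>Basis. norm (L y i - L x i)"
  have contL: "(\<lambda>y. L y v) \<midarrow>x\<rightarrow> L x v" for v
    using smooth_on_continuous[OF smooth_L] S x
    by (metis continuous_on_eq_continuous_at isCont_def)
  have "(?N \<longlongrightarrow> (\<Sum>i\<in>Basis. norm (L x i - L x i))) (at x)"
    by (intro tendsto_intros contL)
  then have "\<forall>\<^sub>F y in at x. ?N y < 1 / (2 * C)"
    by (rule order_tendstoD) (use C in simp)
  then have ev: "\<forall>\<^sub>F y in at x. ?N y < 1 / (2 * C) \<and> y \<in> S"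
    using S x by (intro eventually_conj) (auto simp: eventually_at_topological)
  have bound: "norm (M y w) \<le> 2 * C * norm w" if "?N y < 1 / (2 * C)" "y \<in> S" for y w
  proof -
    let ?v = "M y w"
    have "norm (L y ?v - L x ?v) \<le> norm ?v * ?N y"
      using linear_norm_le_Basis[OF linear_compose_sub[OF L[OF that(2)] L[OF x]]] by simp
    also have "\<dots> \<le> norm ?v * (1 / (2 * C))" using that by (intro mult_left_mono) auto
    finally have 1: "norm (w - L x ?v) \<le> norm ?v / (2 * C)" using inv_right that by simp
    have "norm ?v \<le> norm (L x ?v) * C" using C(2)[of "L x ?v"] inv_left[OF x] by simp
    also have "\<dots> \<le> (norm w + norm ?v / (2 * C)) * C"
      using norm_triangle_ineq3[of w "L x ?v"] 1 C by (intro mult_right_mono) auto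
    also have "\<dots> = C * norm w + norm ?v / 2" using C by (simp add: field_simps)
    finally show ?thesis by simp
  qed
  have "((\<lambda>y. M y u - M x u) \<longlongrightarrow> 0) (at x)"
  proof (rule tendsto_0_le[where K = "2 * C"])
    show "((\<lambda>y. L y (M x u) - L x (M x u)) \<longlongrightarrow> 0) (at x)" using contL by (rule LIM_zero)
    show "\<forall>\<^sub>F y in at x. norm (M y u - M x u) \<le> norm (L y (M x u) - L x (M x u)) * (2 * C)"
      using ev
    proof eventually_elim
      case (elim y)
      have "M y u - M x u = - M y (L y (M x u) - L x (M x u))"
        using elim linear_diff[OF linear_inverse_family, of y] inv_left inv_right x by simp
      then show ?case using bound[of y "L y (M x u) - L x (M x u)"] elim by (simp add: mult.commute)
    qed
  qed
  then show ?thesis unfolding isCont_def by (rule LIM_zero_cancel)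
qed

text \<open>The same identity expands \<open>M y u\<close> with coefficients that vanish at
  \<open>x\<close>, so continuity of \<open>M\<close> is already enough for a derivative, by
  \<open>has_derivative_scaleR_zero\<close>.\<close>

lemma has_derivative_inverse_family:
  assumes x: "x \<in> S"
  shows "((\<lambda>y. M y u) has_derivative
    (\<lambda>h. - M x (frechet_derivative (\<lambda>y. L y (M x u)) (at x) h))) (at x)"
proof -
  define a where "a = M x u"
  define k where "k = (\<lambda>y. L y a - L x a)"
  have lM: "y \<in> S \<Longrightarrow> linear (M y)" for y by (rule linear_inverse_family)
  have k: "(k has_derivative frechet_derivative (\<lambda>y. L y a) (at x)) (at x)"
    unfolding k_def using has_derivative_diff[OF smooth_on_has_derivative[OF smooth_L x] has_derivative_const] by simp
  have "((\<lambda>y. M x u - (\<Sum>i\<in>Basis. (k y \<bullet> i) *\<^sub>R M y i)) has_derivative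
      (\<lambda>h. 0 - (\<Sum>i\<in>Basis. (frechet_derivative (\<lambda>y. L y a) (at x) h \<bullet> i) *\<^sub>R M x i))) (at x)"
    by (intro has_derivative_diff has_derivative_const has_derivative_sum has_derivative_scaleR_zero
        has_derivative_inner_left k isCont_inverse_family x) (simp add: k_def)
  then have "((\<lambda>y. M x u - (\<Sum>i\<in>Basis. (k y \<bullet> i) *\<^sub>R M y i)) has_derivative
      (\<lambda>h. - M x (frechet_derivative (\<lambda>y. L y (M x u)) (at x) h))) (at x)"
    by (simp flip: linear_expand_Basis[OF lM[OF x]] a_def)
  then show ?thesis
  proof (rule has_derivative_transform_within_open[OF _ S x])
    fix y assume y: "y \<in> S"
    show "M x u - (\<Sum>i\<in>Basis. (k y \<bullet> i) *\<^sub>R M y i) = M y u"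
      using linear_diff[OF lM[OF y]] inv_left inv_right x y
      by (simp add: k_def a_def flip: linear_expand_Basis[OF lM[OF y]])
  qed
qed

text \<open>The derivative is expressed by \<open>M\<close> itself and the derivative of
  \<open>L\<close>, so each order of differentiability of \<open>M\<close> gives the next.\<close>

lemma smooth_on_inverse_family: "smooth_on S (\<lambda>y. M y u)"
proof -
  have "Ck_on k S (\<lambda>y. M y u)" for k
  proof (induction k arbitrary: u)
    case 0
    then show ?case by (auto intro: continuous_at_imp_continuous_on isCont_inverse_family)
  next
    case (Suc k)
    show ?case
    proof (rule Ck_on_Suc_I[OF S has_derivative_inverse_family])
      fix h
      have "Ck_on k S (\<lambda>y. frechet_derivative (\<lambda>y. L y v) (at y) h)" for v
        using smooth_on_derivative[OF smooth_L] by (simp add: smooth_on_def)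
      \<comment> \<open>The vector \<open>M y u\<close> moves with \<open>y\<close> but is held
        fixed while \<open>L\<close> is differentiated; expanding it in the basis separates the two
        roles of \<open>y\<close>.\<close>
      then have "Ck_on k S (\<lambda>y. \<Sum>i\<in>Basis. (M y u \<bullet> i) *\<^sub>R frechet_derivative (\<lambda>y. L y i) (at y) h)"
        by (intro Ck_on_sum S Ck_on_bilinear[OF bounded_bilinear_scaleR] Suc
            Ck_on_bounded_linear[OF bounded_linear_inner_left])
      moreover have "(\<Sum>i\<in>Basis. (M y u \<bullet> i) *\<^sub>R frechet_derivative (\<lambda>y. L y i) (at y) h) =
          frechet_derivative (\<lambda>y'. L y' (M y u)) (at y) h" if "y \<in> S" for y
      proof -
        have "((\<lambda>y'. \<Sum>i\<in>Basis. (M y u \<bullet> i) *\<^sub>R L y' i) has_derivative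
            (\<lambda>h. \<Sum>i\<in>Basis. (M y u \<bullet> i) *\<^sub>R frechet_derivative (\<lambda>y. L y i) (at y) h)) (at y)"
          by (intro derivative_intros smooth_on_has_derivative[OF smooth_L that])
        then have "((\<lambda>y'. L y' (M y u)) has_derivative
            (\<lambda>h. \<Sum>i\<in>Basis. (M y u \<bullet> i) *\<^sub>R frechet_derivative (\<lambda>y. L y i) (at y) h)) (at y)"
          by (rule has_derivative_transform_within_open[OF _ S that])
            (rule linear_expand_Basis[OF L, symmetric])
        from frechet_derivativeI[OF this] show ?thesis by simp
      qed
      ultimately have "Ck_on k S (\<lambda>y. frechet_derivative (\<lambda>y'. L y' (M y u)) (at y) h)"
        using Ck_on_cong[OF S, of "\<lambda>y. \<Sum>i\<in>Basis. (M y u \<bullet> i) *\<^sub>R frechet_derivative (\<lambda>y. L y i) (at y) h"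
            "\<lambda>y. frechet_derivative (\<lambda>y'. L y' (M y u)) (at y) h" k] by blast
      then have "Ck_on k S (\<lambda>y. M y (frechet_derivative (\<lambda>y'. L y' (M y u)) (at y) h))"
        
        using Ck_on_apply[where F = M, OF S _ Suc] linear_inverse_family by blast
      then show "Ck_on k S (\<lambda>y. - M y (frechet_derivative (\<lambda>y'. L y' (M y u)) (at y) h))"
        by (rule Ck_on_bounded_linear[OF bounded_linear_minus[OF bounded_linear_ident] S])
    qed
  qed
  then show ?thesis by (simp add: smooth_on_def)
qed

end

section \<open>Total differential equations and the Frobenius theorem\<close>

definition picard ::
  "('a::euclidean_space \<Rightarrow> 'z::euclidean_space \<Rightarrow>\<^sub>L 'a) \<Rightarrow> 'a \<Rightarrow> ('z \<Rightarrow> 'a) \<Rightarrow> 'z \<Rightarrow> 'a" where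
  "picard \<Gamma> x0 \<psi> z = x0 + integral (cbox 0 1) (\<lambda>t::real. \<Gamma> (\<psi> (t *\<^sub>R z)) z)"

text \<open>The derivative in \<open>z\<close> of the integrand
  \<open>\<Gamma> (\<psi> (t *\<^sub>R z)) z\<close>: one term from the explicit \<open>z\<close>,
  one from the chain rule, which brings in the factor \<open>t\<close>.\<close>

definition picard_integrand ::
  "('a::euclidean_space \<Rightarrow> 'z::euclidean_space \<Rightarrow>\<^sub>L 'a) \<Rightarrow> ('a \<Rightarrow> 'a \<Rightarrow>\<^sub>L 'z \<Rightarrow>\<^sub>L 'a) \<Rightarrow>
   ('z \<Rightarrow> 'a) \<Rightarrow> ('z \<Rightarrow> 'z \<Rightarrow>\<^sub>L 'a) \<Rightarrow> 'z \<Rightarrow> real \<Rightarrow> 'z \<Rightarrow>\<^sub>L 'a" where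
  "picard_integrand \<Gamma> \<Gamma>' \<psi> \<psi>' z t = \<Gamma> (\<psi> (t *\<^sub>R z)) +
     t *\<^sub>R (blinfun.prod_left z o\<^sub>L \<Gamma>' (\<psi> (t *\<^sub>R z)) o\<^sub>L \<psi>' (t *\<^sub>R z))"

text \<open>The derivatives travel along with the iterates, because differentiability of the limit
  is drawn from uniform convergence of the derivatives.\<close>

primrec picard_seq ::
  "('a::euclidean_space \<Rightarrow> 'z::euclidean_space \<Rightarrow>\<^sub>L 'a) \<Rightarrow> ('a \<Rightarrow> 'a \<Rightarrow>\<^sub>L 'z \<Rightarrow>\<^sub>L 'a) \<Rightarrow> 'a \<Rightarrow> nat \<Rightarrow>
   ('z \<Rightarrow> 'a) \<times> ('z \<Rightarrow> 'z \<Rightarrow>\<^sub>L 'a)" where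
  "picard_seq \<Gamma> \<Gamma>' x0 0 = (\<lambda>z. x0, \<lambda>z. 0)"
| "picard_seq \<Gamma> \<Gamma>' x0 (Suc n) = (picard \<Gamma> x0 (fst (picard_seq \<Gamma> \<Gamma>' x0 n)),
     \<lambda>z. integral (cbox 0 1) (picard_integrand \<Gamma> \<Gamma>' (fst (picard_seq \<Gamma> \<Gamma>' x0 n)) (snd (picard_seq \<Gamma> \<Gamma>' x0 n)) z))"

lemma has_integral_unit_interval_bound:
  fixes f :: "real \<Rightarrow> 'b::real_normed_vector"
  assumes "0 \<le> B" "(f has_integral i) (cbox 0 1)" "\<And>t. t \<in> cbox 0 1 \<Longrightarrow> norm (f t) \<le> B"
  shows "norm i \<le> B"
  using has_integral_bound[OF assms] by simp

text \<open>The condition \<open>sym\<close> is what the symmetry of second derivatives demands of a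
  solution, whose second derivative is given by \<open>\<Gamma>'\<close> and \<Gamma>. The bound
  \<open>r * M \<le> R\<close> keeps the iterates in the ball. The 1/4 is dictated by
  \<open>picard_defect\<close>, where the defect enters twice and still has to be halved.\<close>

context
  fixes \<Gamma> :: "'a::euclidean_space \<Rightarrow> 'z::euclidean_space \<Rightarrow>\<^sub>L 'a" and \<Gamma>' :: "'a \<Rightarrow> 'a \<Rightarrow>\<^sub>L 'z \<Rightarrow>\<^sub>L 'a"
    and x0 :: 'a and R r M K :: real
  assumes \<Gamma>: "\<And>y. y \<in> cball x0 R \<Longrightarrow> (\<Gamma> has_derivative blinfun_apply (\<Gamma>' y)) (at y)"
    and cont_\<Gamma>': "continuous_on (cball x0 R) \<Gamma>'"
    and sym: "\<And>y w z. y \<in> cball x0 R \<Longrightarrow> \<Gamma>' y (\<Gamma> y w) z = \<Gamma>' y (\<Gamma> y z) w"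
    and M: "\<And>y. y \<in> cball x0 R \<Longrightarrow> norm (\<Gamma> y) \<le> M"
    and K: "\<And>y. y \<in> cball x0 R \<Longrightarrow> norm (\<Gamma>' y) \<le> K"
    and r: "r > 0" "r * M \<le> R" "r * K \<le> 1 / 4" and R: "R > 0"
begin

lemma picard_bounds_nonneg: "M \<ge> 0" "K \<ge> 0"
  using order_trans[OF norm_ge_zero M[of x0]] order_trans[OF norm_ge_zero K[of x0]] R by auto

lemma picard_Lipschitz:
  "y \<in> cball x0 R \<Longrightarrow> y' \<in> cball x0 R \<Longrightarrow> norm (\<Gamma> y - \<Gamma> y') \<le> K * norm (y - y')"
  by (rule differentiable_bound[where S = "cball x0 R" and f' = "\<lambda>y. blinfun_apply (\<Gamma>' y)"])
    (auto intro: has_derivative_at_withinI[OF \<Gamma>] K simp flip: norm_blinfun.rep_eq)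

lemma picard_ball_scaleR: "(z::'z) \<in> ball 0 r \<Longrightarrow> t \<in> {0..1} \<Longrightarrow> t *\<^sub>R z \<in> ball 0 r"
  using mult_left_le_one_le[of "norm z" t] by auto

lemma continuous_on_\<Gamma>: "continuous_on (cball x0 R) \<Gamma>"
  by (meson \<Gamma> continuous_at_imp_continuous_on has_derivative_continuous)

lemma picard_cont:
  assumes "continuous_on (ball 0 r) \<psi>" "\<And>z. z \<in> ball 0 r \<Longrightarrow> \<psi> z \<in> cball x0 R" "z \<in> ball 0 r"
  shows "continuous_on (cbox 0 1) (\<lambda>t. \<Gamma> (\<psi> (t *\<^sub>R z)) z)"
proof -
  have "continuous_on (cbox 0 1) (\<lambda>t::real. \<psi> (t *\<^sub>R z))"
    by (rule continuous_on_compose2[OF assms(1)]) (use picard_ball_scaleR[OF assms(3)] in \<open>auto intro!: continuous_intros\<close>)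
  then have "continuous_on (cbox 0 1) (\<lambda>t::real. \<Gamma> (\<psi> (t *\<^sub>R z)))"
    by (rule continuous_on_compose2[OF continuous_on_\<Gamma>]) (use picard_ball_scaleR[OF assms(3)] assms(2) in auto)
  then show ?thesis by (intro continuous_intros)
qed

lemma picard_has_integral:
  assumes "continuous_on (ball 0 r) \<psi>" "\<And>z. z \<in> ball 0 r \<Longrightarrow> \<psi> z \<in> cball x0 R" "z \<in> ball 0 r"
  shows "((\<lambda>t. \<Gamma> (\<psi> (t *\<^sub>R z)) z) has_integral (picard \<Gamma> x0 \<psi> z - x0)) (cbox 0 1)"
  using integrable_integral[OF integrable_continuous[OF picard_cont[OF assms]]] by (simp add: picard_def)

lemma picard_norm_le:
  assumes "continuous_on (ball 0 r) \<psi>" "\<And>z. z \<in> ball 0 r \<Longrightarrow> \<psi> z \<in> cball x0 R" "z \<in> ball 0 r"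
  shows "picard \<Gamma> x0 \<psi> z \<in> cball x0 R"
proof -
  have "norm (picard \<Gamma> x0 \<psi> z - x0) \<le> (M * norm z)"
  proof (rule has_integral_unit_interval_bound[OF _ picard_has_integral[OF assms]])
    fix t :: real assume "t \<in> cbox 0 1"
    then have "\<psi> (t *\<^sub>R z) \<in> cball x0 R" using picard_ball_scaleR[OF assms(3)] assms(2) by auto
    then show "norm (\<Gamma> (\<psi> (t *\<^sub>R z)) z) \<le> M * norm z"
      using norm_blinfun[of "\<Gamma> (\<psi> (t *\<^sub>R z))" z] M mult_right_mono[of _ M "norm z"] order_trans by fastforce
  qed (simp add: picard_bounds_nonneg)
  also have "\<dots> \<le> R"
    using mult_left_mono[of "norm z" r M] assms(3) r(2) picard_bounds_nonneg by (simp add: mult.commute)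
  finally show ?thesis by (simp add: dist_norm norm_minus_commute)
qed

lemma picard_contraction:
  assumes "continuous_on (ball 0 r) \<psi>" "\<And>z. z \<in> ball 0 r \<Longrightarrow> \<psi> z \<in> cball x0 R"
    and "continuous_on (ball 0 r) \<phi>" "\<And>z. z \<in> ball 0 r \<Longrightarrow> \<phi> z \<in> cball x0 R"
    and d: "\<And>z. z \<in> ball 0 r \<Longrightarrow> norm (\<psi> z - \<phi> z) \<le> d" and z: "z \<in> ball 0 r"
  shows "norm (picard \<Gamma> x0 \<psi> z - picard \<Gamma> x0 \<phi> z) \<le> d / 2"
proof -
  have d0: "d \<ge> 0" using order_trans[OF norm_ge_zero d[OF z]] .
  have "norm ((picard \<Gamma> x0 \<psi> z - x0) - (picard \<Gamma> x0 \<phi> z - x0)) \<le> (K * d * norm z)"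
  proof (rule has_integral_unit_interval_bound[OF _ has_integral_diff[OF picard_has_integral[OF assms(1,2) z] picard_has_integral[OF assms(3,4) z]]])
    fix t :: real assume "t \<in> cbox 0 1"
    then have tz: "t *\<^sub>R z \<in> ball 0 r" using picard_ball_scaleR[OF z] by auto
    have "norm (\<Gamma> (\<psi> (t *\<^sub>R z)) z - \<Gamma> (\<phi> (t *\<^sub>R z)) z) \<le> norm (\<Gamma> (\<psi> (t *\<^sub>R z)) - \<Gamma> (\<phi> (t *\<^sub>R z))) * norm z"
      using norm_blinfun[of "\<Gamma> (\<psi> (t *\<^sub>R z)) - \<Gamma> (\<phi> (t *\<^sub>R z))" z] by (simp add: blinfun.diff_left)
    also have "\<dots> \<le> (K * norm (\<psi> (t *\<^sub>R z) - \<phi> (t *\<^sub>R z))) * norm z"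
      by (intro mult_right_mono picard_Lipschitz assms(2,4) tz) auto
    also have "\<dots> \<le> (K * d) * norm z"
      by (intro mult_right_mono mult_left_mono d tz picard_bounds_nonneg) auto
    finally show "norm (\<Gamma> (\<psi> (t *\<^sub>R z)) z - \<Gamma> (\<phi> (t *\<^sub>R z)) z) \<le> K * d * norm z" .
  qed (simp add: picard_bounds_nonneg d0)
  also have "\<dots> \<le> d * (r * K)"
    using mult_left_mono[of "norm z" r "K * d"] z picard_bounds_nonneg d0 by (simp add: mult_ac)
  also have "\<dots> \<le> d * (1 / 4)" by (intro mult_left_mono r d0)
  finally show ?thesis using d0 by simp
qed

context
  fixes \<psi> :: "'z \<Rightarrow> 'a" and \<psi>' :: "'z \<Rightarrow> 'z \<Rightarrow>\<^sub>L 'a"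
  assumes \<psi>: "\<And>z. z \<in> ball 0 r \<Longrightarrow> (\<psi> has_derivative blinfun_apply (\<psi>' z)) (at z)"
    and cont_\<psi>': "continuous_on (ball 0 r) \<psi>'"
    and \<psi>_ball: "\<And>z. z \<in> ball 0 r \<Longrightarrow> \<psi> z \<in> cball x0 R"
begin

lemma picard_continuous_on: "continuous_on (ball 0 r) \<psi>"
  by (meson \<psi> continuous_at_imp_continuous_on has_derivative_continuous)

lemma picard_integrand_continuous:
  "continuous_on (ball 0 r \<times> cbox 0 1) (\<lambda>(z, t). picard_integrand \<Gamma> \<Gamma>' \<psi> \<psi>' z t)"
proof -
  have sub: "snd zt *\<^sub>R fst zt \<in> ball 0 r" if "zt \<in> ball 0 r \<times> cbox 0 1" for zt :: "'z \<times> real"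
    using picard_ball_scaleR that by auto
  have s: "continuous_on (ball 0 r \<times> cbox 0 1) (\<lambda>zt::'z \<times> real. snd zt *\<^sub>R fst zt)"
    by (intro continuous_intros)
  have 1: "continuous_on (ball 0 r \<times> cbox 0 1) (\<lambda>zt. \<psi> (snd zt *\<^sub>R fst zt))"
    by (rule continuous_on_compose2[OF picard_continuous_on s]) (use sub in blast)
  have 2: "continuous_on (ball 0 r \<times> cbox 0 1) (\<lambda>zt. \<psi>' (snd zt *\<^sub>R fst zt))"
    by (rule continuous_on_compose2[OF cont_\<psi>' s]) (use sub in blast)
  have 3: "continuous_on (ball 0 r \<times> cbox 0 1) (\<lambda>zt. \<Gamma> (\<psi> (snd zt *\<^sub>R fst zt)))"
    by (rule continuous_on_compose2[OF continuous_on_\<Gamma> 1]) (use sub \<psi>_ball in blast)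
  have 4: "continuous_on (ball 0 r \<times> cbox 0 1) (\<lambda>zt. \<Gamma>' (\<psi> (snd zt *\<^sub>R fst zt)))"
    by (rule continuous_on_compose2[OF cont_\<Gamma>' 1]) (use sub \<psi>_ball in blast)
  show ?thesis
    unfolding picard_integrand_def case_prod_unfold
    by (intro continuous_intros 2 3 4
        bounded_bilinear.continuous_on[OF bounded_bilinear_blinfun_compose]
        bounded_linear.continuous_on[OF blinfun.bounded_linear_prod_left])
qed

lemma picard_integrand_has_integral:
  assumes "z \<in> ball 0 r"
  shows "(picard_integrand \<Gamma> \<Gamma>' \<psi> \<psi>' z has_integral
    integral (cbox 0 1) (picard_integrand \<Gamma> \<Gamma>' \<psi> \<psi>' z)) (cbox 0 1)"
proof -
  have "continuous_on (cbox 0 1) (\<lambda>t. (\<lambda>(z, t). picard_integrand \<Gamma> \<Gamma>' \<psi> \<psi>' z t) (z, t))"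
    by (rule continuous_on_compose2[OF picard_integrand_continuous]) (use assms in \<open>auto intro!: continuous_intros\<close>)
  then have "continuous_on (cbox 0 1) (picard_integrand \<Gamma> \<Gamma>' \<psi> \<psi>' z)" by simp
  then show ?thesis by (intro integrable_integral integrable_continuous)
qed

lemma picard_derivative_continuous:
  "continuous_on (ball 0 r) (\<lambda>z. integral (cbox 0 1) (picard_integrand \<Gamma> \<Gamma>' \<psi> \<psi>' z))"
  by (rule integral_continuous_on_param[OF picard_integrand_continuous])

lemma picard_has_derivative:
  assumes z: "z \<in> ball 0 r"
  shows "(picard \<Gamma> x0 \<psi> has_derivative integral (cbox 0 1) (picard_integrand \<Gamma> \<Gamma>' \<psi> \<psi>' z)) (at z)"
proof -
  have "((\<lambda>z. integral (cbox 0 1) (\<lambda>t::real. \<Gamma> (\<psi> (t *\<^sub>R z)) z)) has_derivative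
      integral (cbox 0 1) (picard_integrand \<Gamma> \<Gamma>' \<psi> \<psi>' z)) (at z within ball 0 r)"
  proof (rule leibniz_rule[OF _ _ picard_integrand_continuous z convex_ball])
    fix z :: 'z and t :: real assume z: "z \<in> ball 0 r" and t: "t \<in> cbox 0 1"
    have tz: "t *\<^sub>R z \<in> ball 0 r" using picard_ball_scaleR[OF z] t by auto
    have "((\<lambda>z. t *\<^sub>R z) has_derivative (\<lambda>h. t *\<^sub>R h)) (at z)" by (auto intro!: derivative_eq_intros)
    from has_derivative_compose[OF has_derivative_compose[OF this \<psi>[OF tz]] \<Gamma>[OF \<psi>_ball[OF tz]]]
    have "((\<lambda>z. \<Gamma> (\<psi> (t *\<^sub>R z))) has_derivative (\<lambda>h. \<Gamma>' (\<psi> (t *\<^sub>R z)) (\<psi>' (t *\<^sub>R z) (t *\<^sub>R h)))) (at z)"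
      by (simp add: o_def)
    from blinfun.FDERIV[OF this has_derivative_ident]
    have "((\<lambda>z. \<Gamma> (\<psi> (t *\<^sub>R z)) z) has_derivative
        (\<lambda>h. \<Gamma> (\<psi> (t *\<^sub>R z)) h + \<Gamma>' (\<psi> (t *\<^sub>R z)) (\<psi>' (t *\<^sub>R z) (t *\<^sub>R h)) z)) (at z)" .
    moreover have "(\<lambda>h. \<Gamma> (\<psi> (t *\<^sub>R z)) h + \<Gamma>' (\<psi> (t *\<^sub>R z)) (\<psi>' (t *\<^sub>R z) (t *\<^sub>R h)) z) =
        blinfun_apply (picard_integrand \<Gamma> \<Gamma>' \<psi> \<psi>' z t)"
      by (auto simp: picard_integrand_def blinfun.bilinear_simps)
    ultimately show "((\<lambda>z. \<Gamma> (\<psi> (t *\<^sub>R z)) z) has_derivative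
        blinfun_apply (picard_integrand \<Gamma> \<Gamma>' \<psi> \<psi>' z t)) (at z within ball 0 r)"
      using has_derivative_at_withinI by metis
  next
    show "(\<lambda>t::real. \<Gamma> (\<psi> (t *\<^sub>R z)) z) integrable_on cbox 0 1" if "z \<in> ball 0 r" for z
      by (rule integrable_continuous[OF picard_cont[OF picard_continuous_on \<psi>_ball that]])
  qed
  then have "((\<lambda>z. x0 + integral (cbox 0 1) (\<lambda>t::real. \<Gamma> (\<psi> (t *\<^sub>R z)) z)) has_derivative
      integral (cbox 0 1) (picard_integrand \<Gamma> \<Gamma>' \<psi> \<psi>' z)) (at z within ball 0 r)"
    using has_derivative_add[OF has_derivative_const] by fastforce
  then show ?thesis
    using z by (simp add: picard_def[abs_def] at_within_open[OF z open_ball])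
qed

text \<open>By the symmetry of \<open>\<Gamma>'\<close>, only the defect \<open>D\<psi> - \<Gamma> \<circ> \<psi>\<close> of the given function contributes to the defect of
  its Picard iterate, and the factor \<open>r * K\<close> makes it small.\<close>

lemma picard_defect:
  assumes e: "\<And>z. z \<in> ball 0 r \<Longrightarrow> norm (\<psi>' z - \<Gamma> (\<psi> z)) \<le> e" and z: "z \<in> ball 0 r"
  shows "norm (integral (cbox 0 1) (picard_integrand \<Gamma> \<Gamma>' \<psi> \<psi>' z) - \<Gamma> (\<psi> z)) \<le> e / 2"
proof (rule norm_blinfun_bound)
  have e0: "e \<ge> 0" using order_trans[OF norm_ge_zero e[OF z]] .
  then show "0 \<le> e / 2" by simp
  fix w
  let ?y = "\<lambda>t. \<psi> (t *\<^sub>R z)"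
  \<comment> \<open>The value \<open>\<Gamma> (\<psi> z) w\<close> is written as the integral of the
    derivative of \<open>t *\<^sub>R \<Gamma> (?y t) w\<close>, so that it can be compared with the
    integrand of the Picard derivative at each \<open>t\<close>.\<close>
  have "((\<lambda>t. \<Gamma> (?y t) w + t *\<^sub>R \<Gamma>' (?y t) (\<psi>' (t *\<^sub>R z) z) w) has_integral
      (1 *\<^sub>R \<Gamma> (?y 1) w - 0 *\<^sub>R \<Gamma> (?y 0) w)) {0..1}"
  proof (rule fundamental_theorem_of_calculus)
    fix t :: real assume t: "t \<in> {0..1}"
    have tz: "t *\<^sub>R z \<in> ball 0 r" using picard_ball_scaleR[OF z t] .
    have "((\<lambda>t. t *\<^sub>R z) has_derivative (\<lambda>h. h *\<^sub>R z)) (at t)" by (auto intro!: derivative_eq_intros)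
    from has_derivative_compose[OF has_derivative_compose[OF this \<psi>[OF tz]] \<Gamma>[OF \<psi>_ball[OF tz]]]
    have "((\<lambda>t. \<Gamma> (?y t)) has_derivative (\<lambda>h. \<Gamma>' (?y t) (\<psi>' (t *\<^sub>R z) (h *\<^sub>R z)))) (at t)"
      by (simp add: o_def)
    from has_derivative_scaleR[OF has_derivative_ident blinfun.FDERIV[OF this has_derivative_const[of w]]]
    have "((\<lambda>t. t *\<^sub>R \<Gamma> (?y t) w) has_derivative
       (\<lambda>h. h *\<^sub>R (\<Gamma> (?y t) w + t *\<^sub>R \<Gamma>' (?y t) (\<psi>' (t *\<^sub>R z) z) w))) (at t)"
      by (simp add: blinfun.bilinear_simps algebra_simps)
    then show "((\<lambda>t. t *\<^sub>R \<Gamma> (?y t) w) has_vector_derivative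
       (\<Gamma> (?y t) w + t *\<^sub>R \<Gamma>' (?y t) (\<psi>' (t *\<^sub>R z) z) w)) (at t within {0..1})"
      by (simp add: has_vector_derivative_def has_derivative_at_withinI)
  qed simp
  then have 1: "((\<lambda>t. \<Gamma> (?y t) w + t *\<^sub>R \<Gamma>' (?y t) (\<psi>' (t *\<^sub>R z) z) w) has_integral \<Gamma> (\<psi> z) w) (cbox 0 1)"
    by simp
  have 2: "((\<lambda>t. picard_integrand \<Gamma> \<Gamma>' \<psi> \<psi>' z t w) has_integral
      integral (cbox 0 1) (picard_integrand \<Gamma> \<Gamma>' \<psi> \<psi>' z) w) (cbox 0 1)"
    using has_integral_linear[OF picard_integrand_has_integral[OF z] blinfun.bounded_linear_left[of w]]
    by (simp add: o_def)
  have "norm (integral (cbox 0 1) (picard_integrand \<Gamma> \<Gamma>' \<psi> \<psi>' z) w - \<Gamma> (\<psi> z) w) \<le>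
      (2 * K * e * norm w * norm z)"
  proof (rule has_integral_unit_interval_bound[OF _ has_integral_diff[OF 2 1]])
    fix t :: real assume "t \<in> cbox 0 1"
    then have t: "t \<in> {0..1}" by simp
    have tz: "t *\<^sub>R z \<in> ball 0 r" using picard_ball_scaleR[OF z t] .
    define \<epsilon> where "\<epsilon> = \<psi>' (t *\<^sub>R z) - \<Gamma> (?y t)"
    have \<psi>'_eq: "\<psi>' (t *\<^sub>R z) = \<Gamma> (?y t) + \<epsilon>" by (simp add: \<epsilon>_def)
    have b: "norm (\<Gamma>' (?y t) (\<epsilon> u) v) \<le> K * (e * norm u) * norm v" for u v
    proof -
      have "norm (\<Gamma>' (?y t) (\<epsilon> u) v) \<le> norm (\<Gamma>' (?y t)) * norm (\<epsilon> u) * norm v"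
        using norm_blinfun[of "\<Gamma>' (?y t) (\<epsilon> u)" v] norm_blinfun[of "\<Gamma>' (?y t)" "\<epsilon> u"]
          mult_right_mono[of "norm (\<Gamma>' (?y t) (\<epsilon> u))" _ "norm v"] by fastforce
      also have "\<dots> \<le> K * (e * norm u) * norm v"
      proof (intro mult_right_mono mult_mono K \<psi>_ball tz)
        show "norm (\<epsilon> u) \<le> e * norm u"
          using norm_blinfun[of \<epsilon> u] mult_right_mono[OF e[OF tz], of "norm u"] by (simp add: \<epsilon>_def)
      qed (auto simp: picard_bounds_nonneg)
      finally show ?thesis .
    qed
    \<comment> \<open>Once the defect \<epsilon> is split off from \<open>\<psi>'\<close>, the
      remaining parts of the two integrands are equal by \<open>sym\<close>.\<close>
    have "picard_integrand \<Gamma> \<Gamma>' \<psi> \<psi>' z t w - (\<Gamma> (?y t) w + t *\<^sub>R \<Gamma>' (?y t) (\<psi>' (t *\<^sub>R z) z) w) =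
        t *\<^sub>R (\<Gamma>' (?y t) (\<epsilon> w) z - \<Gamma>' (?y t) (\<epsilon> z) w)"
      using sym[OF \<psi>_ball[OF tz], of w z]
      by (simp add: picard_integrand_def \<psi>'_eq blinfun.bilinear_simps algebra_simps)
    also have "norm \<dots> \<le> 1 * (norm (\<Gamma>' (?y t) (\<epsilon> w) z) + norm (\<Gamma>' (?y t) (\<epsilon> z) w))"
      unfolding norm_scaleR using t by (intro mult_mono norm_triangle_ineq4) auto
    also have "\<dots> \<le> 1 * (K * (e * norm w) * norm z + K * (e * norm z) * norm w)"
      by (intro mult_left_mono add_mono b) auto
    finally show "norm (picard_integrand \<Gamma> \<Gamma>' \<psi> \<psi>' z t w -
        (\<Gamma> (?y t) w + t *\<^sub>R \<Gamma>' (?y t) (\<psi>' (t *\<^sub>R z) z) w)) \<le> 2 * K * e * norm w * norm z"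
      by (simp add: algebra_simps)
  qed (simp add: picard_bounds_nonneg e0)
  also have "\<dots> \<le> (2 * e * norm w) * (r * K)"
    using mult_left_mono[of "norm z" r "2 * K * e * norm w"] z picard_bounds_nonneg e0 by (simp add: mult_ac)
  also have "\<dots> \<le> (2 * e * norm w) * (1 / 4)" by (intro mult_left_mono r) (simp add: e0)
  finally show "norm ((integral (cbox 0 1) (picard_integrand \<Gamma> \<Gamma>' \<psi> \<psi>' z) - \<Gamma> (\<psi> z)) w) \<le> e / 2 * norm w"
    by (simp add: blinfun.diff_left)
qed

end

abbreviation (input) "\<psi>s n \<equiv> fst (picard_seq \<Gamma> \<Gamma>' x0 n)"
abbreviation (input) "\<psi>s' n \<equiv> snd (picard_seq \<Gamma> \<Gamma>' x0 n)"

text \<open>The claims support each other: an iterate is differentiated under the integral because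
  its predecessor is continuously differentiable and stays in the ball.\<close>

lemma picard_seq_invariant:
  "(\<forall>z\<in>ball 0 r. (\<psi>s n has_derivative blinfun_apply (\<psi>s' n z)) (at z) \<and> \<psi>s n z \<in> cball x0 R) \<and>
    continuous_on (ball 0 r) (\<psi>s' n)"
proof (induction n)
  case 0
  then show ?case using R by (auto simp: zero_blinfun.rep_eq[abs_def])
next
  case (Suc n)
  then have a: "\<And>z. z \<in> ball 0 r \<Longrightarrow> (\<psi>s n has_derivative blinfun_apply (\<psi>s' n z)) (at z)"
    and b: "continuous_on (ball 0 r) (\<psi>s' n)" and c: "\<And>z. z \<in> ball 0 r \<Longrightarrow> \<psi>s n z \<in> cball x0 R"
    by blast+
  have "continuous_on (ball 0 r) (\<psi>s n)" using a b c by (rule picard_continuous_on)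
  then show ?case
    using picard_norm_le[OF _ c] picard_has_derivative[OF a b c] picard_derivative_continuous[OF a b c]
    by auto
qed

lemma picard_seq_derivative: "z \<in> ball 0 r \<Longrightarrow> (\<psi>s n has_derivative blinfun_apply (\<psi>s' n z)) (at z)"
  and picard_seq_derivative_continuous: "continuous_on (ball 0 r) (\<psi>s' n)"
  and picard_seq_in_ball: "z \<in> ball 0 r \<Longrightarrow> \<psi>s n z \<in> cball x0 R"
  using picard_seq_invariant[of n] by auto

lemma picard_seq_continuous: "continuous_on (ball 0 r) (\<psi>s n)"
  using picard_seq_derivative picard_seq_derivative_continuous picard_seq_in_ball by (rule picard_continuous_on)

lemma picard_seq_diff: "z \<in> ball 0 r \<Longrightarrow> norm (\<psi>s (Suc n) z - \<psi>s n z) \<le> R * (1 / 2) ^ n"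
proof (induction n arbitrary: z)
  case 0
  then show ?case using picard_seq_in_ball[OF 0, of 1] by (simp add: dist_norm norm_minus_commute)
next
  case (Suc n)
  have "norm (picard \<Gamma> x0 (\<psi>s (Suc n)) z - picard \<Gamma> x0 (\<psi>s n) z) \<le> R * (1 / 2) ^ n / 2"
    using picard_seq_continuous picard_seq_in_ball picard_seq_continuous picard_seq_in_ball Suc.IH Suc.prems
    by (rule picard_contraction)
  then show ?case by simp
qed

text \<open>A Picard step halves the defect measured against the old iterate, and passing to the new
  one costs at most \<open>K * R * (1 / 2) ^ n\<close>. A bound \<open>A * (3 / 4) ^ n\<close> is
  preserved as soon as \<open>A / 4\<close> is at least \<open>K * R\<close>; the summand
  \<open>M\<close> covers the start, where the derivative is zero.\<close>

lemma picard_seq_defect: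
  "z \<in> ball 0 r \<Longrightarrow> norm (\<psi>s' n z - \<Gamma> (\<psi>s n z)) \<le> (4 * K * R + M) * (3 / 4) ^ n"
proof (induction n arbitrary: z)
  case 0
  then show ?case using M[of x0] R picard_bounds_nonneg by (auto intro: add_increasing)
next
  case (Suc n)
  have 1: "norm (\<psi>s' (Suc n) z - \<Gamma> (\<psi>s n z)) \<le> (4 * K * R + M) * (3 / 4) ^ n / 2"
    using picard_defect[OF picard_seq_derivative picard_seq_derivative_continuous picard_seq_in_ball Suc.IH Suc.prems] by simp
  have "norm (\<Gamma> (\<psi>s n z) - \<Gamma> (\<psi>s (Suc n) z)) \<le> K * norm (\<psi>s n z - \<psi>s (Suc n) z)"
    by (intro picard_Lipschitz picard_seq_in_ball Suc.prems)
  also have "\<dots> \<le> K * (R * (1 / 2) ^ n)"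
    using picard_seq_diff[OF Suc.prems, of n] picard_bounds_nonneg by (intro mult_left_mono) (auto simp: norm_minus_commute)
  also have "\<dots> \<le> K * (R * (3 / 4) ^ n)"
    using R picard_bounds_nonneg by (intro mult_left_mono power_mono) auto
  finally have 2: "norm (\<Gamma> (\<psi>s n z) - \<Gamma> (\<psi>s (Suc n) z)) \<le> K * R * (3 / 4) ^ n" by simp
  have "norm (\<psi>s' (Suc n) z - \<Gamma> (\<psi>s (Suc n) z)) \<le> (4 * K * R + M) * (3 / 4) ^ n / 2 + K * R * (3 / 4) ^ n"
    using norm_triangle_ineq[of "\<psi>s' (Suc n) z - \<Gamma> (\<psi>s n z)" "\<Gamma> (\<psi>s n z) - \<Gamma> (\<psi>s (Suc n) z)"] 1 2 by simp
  also have "\<dots> \<le> (4 * K * R + M) * (3 / 4) ^ Suc n"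
    using picard_bounds_nonneg R by (simp add: algebra_simps)
  finally show ?case .
qed

lemma total_differential_equation_bounded:
  "\<exists>\<psi>. \<psi> 0 = x0 \<and> (\<forall>z\<in>ball 0 r. \<psi> z \<in> cball x0 R \<and> (\<psi> has_derivative \<Gamma> (\<psi> z)) (at z))"
proof -
  \<comment> \<open>Written as a telescoping series, so that the Weierstrass test yields uniform
    convergence.\<close>
  define \<psi> where "\<psi> z = (\<Sum>n. \<psi>s (Suc n) z - \<psi>s n z) + x0" for z
  have "summable (\<lambda>n. R * (1 / 2) ^ n)" by (intro summable_mult summable_geometric) simp
  from Weierstrass_m_test[of "ball 0 r" "\<lambda>n z. \<psi>s (Suc n) z - \<psi>s n z", OF picard_seq_diff this]
  have "uniform_limit (ball 0 r) (\<lambda>n z. (\<Sum>i<n. \<psi>s (Suc i) z - \<psi>s i z) + x0) \<psi> sequentially"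
    unfolding \<psi>_def[abs_def] by (rule uniform_limit_add[OF _ uniform_limit_const])
  moreover have telescope: "(\<Sum>i<n. \<psi>s (Suc i) z - \<psi>s i z) + x0 = \<psi>s n z" for n z
    using sum_lessThan_telescope[of "\<lambda>i. \<psi>s i z" n] by simp
  ultimately have unif: "uniform_limit (ball 0 r) \<psi>s \<psi> sequentially"
    by (simp only: telescope)
  have lim: "(\<lambda>n. \<psi>s n z) \<longlonglongrightarrow> \<psi> z" if "z \<in> ball 0 r" for z
    using tendsto_uniform_limitI[OF unif that] .
  have \<psi>_ball: "\<psi> z \<in> cball x0 R" if "z \<in> ball 0 r" for z
    using closed_sequentially[OF closed_cball _ lim[OF that]] picard_seq_in_ball[OF that] by blast
  have "\<forall>\<^sub>F n in sequentially. \<forall>z\<in>ball 0 r. \<forall>h. norm (\<psi>s' n z h - \<Gamma> (\<psi> z) h) \<le> e * norm h" if "e > 0" for e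
  proof -
    have "(\<lambda>n. (4 * K * R + M) * (3 / 4) ^ n) \<longlonglongrightarrow> (4 * K * R + M) * 0"
      by (intro tendsto_intros LIMSEQ_realpow_zero) auto
    then have 1: "\<forall>\<^sub>F n in sequentially. (4 * K * R + M) * (3 / 4) ^ n < e / 2"
      using that by (intro order_tendstoD) auto
    have "\<forall>\<^sub>F n in sequentially. \<forall>z\<in>ball 0 r. dist (\<psi>s n z) (\<psi> z) < e / (2 * (K + 1))"
      using that picard_bounds_nonneg by (intro uniform_limitD[OF unif]) auto
    with 1 show ?thesis
    proof eventually_elim
      case (elim n)
      show ?case
      proof (intro ballI allI)
        fix z h :: 'z assume z: "z \<in> ball 0 r"
        \<comment> \<open>The denominator contains \<open>K + 1\<close> because \<open>K\<close> may
          be zero.\<close>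
        have "K * norm (\<psi>s n z - \<psi> z) \<le> (K + 1) * (e / (2 * (K + 1)))"
          using elim(2) z picard_bounds_nonneg by (intro mult_mono) (auto simp: dist_norm less_imp_le)
        also have "(K + 1) * (e / (2 * (K + 1))) = e / 2" using picard_bounds_nonneg by (simp add: field_simps)
        finally have "norm (\<Gamma> (\<psi>s n z) - \<Gamma> (\<psi> z)) \<le> e / 2"
          using picard_Lipschitz[OF picard_seq_in_ball[OF z, of n] \<psi>_ball[OF z]] picard_bounds_nonneg by simp
        then have "norm (\<psi>s' n z - \<Gamma> (\<psi> z)) \<le> e"
          using norm_triangle_ineq[of "\<psi>s' n z - \<Gamma> (\<psi>s n z)" "\<Gamma> (\<psi>s n z) - \<Gamma> (\<psi> z)"]
            picard_seq_defect[OF z, of n] elim(1) by simp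
        then show "norm (\<psi>s' n z h - \<Gamma> (\<psi> z) h) \<le> e * norm h"
          using norm_blinfun[of "\<psi>s' n z - \<Gamma> (\<psi> z)" h] mult_right_mono[of _ e "norm h"]
          by (fastforce simp: blinfun.diff_left)
      qed
    qed
  qed
  then have "\<exists>g. \<forall>z\<in>ball 0 r. (\<lambda>n. \<psi>s n z) \<longlonglongrightarrow> g z \<and> (g has_derivative \<Gamma> (\<psi> z)) (at z within ball 0 r)"
    using r(1) lim[of 0] has_derivative_at_withinI[OF picard_seq_derivative]
    by (intro has_derivative_sequence[OF convex_ball, where ?x0.0 = 0 and f' = "\<lambda>n z. blinfun_apply (\<psi>s' n z)"]) auto
  then obtain g where g: "\<And>z. z \<in> ball 0 r \<Longrightarrow> (\<lambda>n. \<psi>s n z) \<longlonglongrightarrow> g z"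
      "\<And>z. z \<in> ball 0 r \<Longrightarrow> (g has_derivative \<Gamma> (\<psi> z)) (at z within ball 0 r)"
    by blast
  have g_eq: "g z = \<psi> z" if "z \<in> ball 0 r" for z
    using LIMSEQ_unique[OF g(1)[OF that] lim[OF that]] .
  have "(\<psi> has_derivative \<Gamma> (\<psi> z)) (at z)" if "z \<in> ball 0 r" for z
    using has_derivative_transform_within_open[OF g(2)[OF that, unfolded at_within_open[OF that open_ball]] open_ball that g_eq] .
  moreover have "\<psi>s n 0 = x0" for n by (cases n) (auto simp: picard_def)
  then have "(\<lambda>n. \<psi>s n 0) \<longlonglongrightarrow> x0" by (simp only: tendsto_const)
  then have "\<psi> 0 = x0" using LIMSEQ_unique lim[of 0] r(1) centre_in_ball by blast
  ultimately show ?thesis using \<psi>_ball by blast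
qed

end

lemma total_differential_equation:
  fixes \<Gamma> :: "'a::euclidean_space \<Rightarrow> 'z::euclidean_space \<Rightarrow>\<^sub>L 'a"
  assumes "open U" "x0 \<in> U"
    and \<Gamma>: "\<And>y. y \<in> U \<Longrightarrow> (\<Gamma> has_derivative blinfun_apply (\<Gamma>' y)) (at y)"
    and cont: "continuous_on U \<Gamma>'"
    and sym: "\<And>y w z. y \<in> U \<Longrightarrow> \<Gamma>' y (\<Gamma> y w) z = \<Gamma>' y (\<Gamma> y z) w"
  obtains r \<psi> where "r > 0" "\<psi> 0 = x0"
    "\<And>z. z \<in> ball 0 r \<Longrightarrow> \<psi> z \<in> U"
    "\<And>z. z \<in> ball 0 r \<Longrightarrow> (\<psi> has_derivative \<Gamma> (\<psi> z)) (at z)"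
proof -
  obtain R where R: "R > 0" "cball x0 R \<subseteq> U" using assms(1,2) open_contains_cball by blast
  have "continuous_on (cball x0 R) \<Gamma>"
    by (meson R(2) \<Gamma> continuous_at_imp_continuous_on has_derivative_continuous subsetD)
  then have "compact (\<Gamma> ` cball x0 R)" by (intro compact_continuous_image) auto
  then obtain M where M: "M > 0" "\<And>y. y \<in> cball x0 R \<Longrightarrow> norm (\<Gamma> y) \<le> M"
    using compact_imp_bounded bounded_pos by (metis imageI)
  have cont': "continuous_on (cball x0 R) \<Gamma>'" using cont R(2) continuous_on_subset by blast
  then have "compact (\<Gamma>' ` cball x0 R)" by (intro compact_continuous_image) auto
  then obtain K where K: "K > 0" "\<And>y. y \<in> cball x0 R \<Longrightarrow> norm (\<Gamma>' y) \<le> K"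
    using compact_imp_bounded bounded_pos by (metis imageI)
  define r where "r = min (R / M) (1 / (4 * K))"
  have r: "r > 0" "r * M \<le> R" "r * K \<le> 1 / 4"
    using R M K by (auto simp: r_def min_def field_simps)
  obtain \<psi> where "\<psi> 0 = x0" "\<forall>z\<in>ball 0 r. \<psi> z \<in> cball x0 R \<and> (\<psi> has_derivative \<Gamma> (\<psi> z)) (at z)"
    using total_differential_equation_bounded[of x0 R \<Gamma> \<Gamma>' M K r] \<Gamma> cont' sym M K r R by blast
  then show thesis using that[of r \<psi>] r R by blast
qed

section \<open>Leaves of an involutive kernel\<close>

lemma has_derivative_Blinfun_family:
  fixes F :: "'a::euclidean_space \<Rightarrow> 'b::euclidean_space \<Rightarrow> 'c::euclidean_space"
  assumes "open S" and lin: "\<And>y. y \<in> S \<Longrightarrow> linear (F y)" and sm: "\<And>v. smooth_on S (\<lambda>y. F y v)"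
  obtains G' where "\<And>y. y \<in> S \<Longrightarrow> ((\<lambda>y. Blinfun (F y)) has_derivative blinfun_apply (G' y)) (at y)"
    "continuous_on S G'"
    "\<And>y h v. y \<in> S \<Longrightarrow> G' y h v = frechet_derivative (\<lambda>y. F y v) (at y) h"
proof -
  \<comment> \<open>\<open>E i c\<close> sends \<open>v\<close> to
    \<open>(v \<bullet> i) *\<^sub>R c\<close>. It transports vectorwise smoothness into the normed
    space of bounded linear maps, in which the Picard iteration works.\<close>
  define E where "E i c = blinfun_scaleR_left c o\<^sub>L blinfun_inner_left i" for i :: 'b and c :: 'c
  define D where "D i y = frechet_derivative (\<lambda>y. F y i) (at y)" for i y
  define G' where "G' y = Blinfun (\<lambda>h. \<Sum>i\<in>Basis. E i (D i y h))" for y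
  have E: "bounded_linear (E i)" for i
    unfolding E_def by (rule bounded_linear_compose[OF
          bounded_bilinear.bounded_linear_left[OF bounded_bilinear_blinfun_compose] bounded_linear_blinfun_scaleR_left])
  have D: "((\<lambda>y. F y i) has_derivative D i y) (at y)" if "y \<in> S" for i y
    unfolding D_def by (rule smooth_on_has_derivative[OF sm that])
  have G'_apply: "G' y h = (\<Sum>i\<in>Basis. E i (D i y h))" if "y \<in> S" for y h
    unfolding G'_def
    by (subst bounded_linear_Blinfun_apply)
      (auto intro!: bounded_linear_sum bounded_linear_compose[OF E] has_derivative_bounded_linear[OF D[OF that]])
  have F_eq: "Blinfun (F y) = (\<Sum>i\<in>Basis. E i (F y i))" if "y \<in> S" for y
  proof (rule blinfun_eqI)
    fix v
    show "blinfun_apply (Blinfun (F y)) v = blinfun_apply (\<Sum>i\<in>Basis. E i (F y i)) v"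
      using lin[OF that] linear_expand_Basis[OF lin[OF that], of v]
      by (simp add: bounded_linear_Blinfun_apply linear_conv_bounded_linear blinfun.sum_left E_def inner_commute)
  qed
  have deriv: "((\<lambda>y. Blinfun (F y)) has_derivative blinfun_apply (G' y)) (at y)" if "y \<in> S" for y
  proof -
    have "((\<lambda>y. \<Sum>i\<in>Basis. E i (F y i)) has_derivative (\<lambda>h. \<Sum>i\<in>Basis. E i (D i y h))) (at y)"
      by (intro has_derivative_sum bounded_linear.has_derivative[OF E] D that)
    then have "((\<lambda>y. \<Sum>i\<in>Basis. E i (F y i)) has_derivative blinfun_apply (G' y)) (at y)"
      using G'_apply[OF that] by presburger
    then show ?thesis
      by (rule has_derivative_transform_within_open[OF _ assms(1) that]) (simp add: F_eq)
  qed
  have "continuous_on S (\<lambda>y. \<Sum>i\<in>Basis. E i (D i y j))" for j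
    unfolding D_def by (intro continuous_on_sum bounded_linear.continuous_on[OF E] smooth_on_continuous
        smooth_on_derivative sm)
  then have cont: "continuous_on S G'"
    by (intro continuous_on_blinfun_componentwise[of S G']) (subst continuous_on_cong[OF refl G'_apply], auto)
  have "G' y h v = frechet_derivative (\<lambda>y. F y v) (at y) h" if "y \<in> S" for y h v
  proof -
    have "((\<lambda>y. Blinfun (F y) v) has_derivative (\<lambda>h. G' y h v)) (at y)"
      using blinfun.FDERIV[OF deriv[OF that] has_derivative_const[of v]] by (simp add: blinfun.zero_right)
    then have "((\<lambda>y. F y v) has_derivative (\<lambda>h. G' y h v)) (at y)"
      by (rule has_derivative_transform_within_open[OF _ assms(1) that])
        (simp add: bounded_linear_Blinfun_apply lin linear_conv_bounded_linear[symmetric])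
    then show ?thesis by (simp add: frechet_derivativeI)
  qed
  with deriv cont show thesis using that by blast
qed

lemma subspace_projection:
  fixes V :: "'a::euclidean_space set"
  assumes "subspace V"
  obtains P where "linear P" "\<And>x. P x \<in> V" "\<And>x. x \<in> V \<Longrightarrow> P x = x"
  using linear_exists_left_inverse_on[OF linear_id assms] by (auto simp: image_subset_iff)

text \<open>The map \<Phi> flattens the leaf through \<open>x0\<close> into the subspace
  \<open>S\<close>, in the shape required of an adapted chart. Only this leaf is flattened, hence
  tangency is claimed at points with \<open>\<Phi> y\<close> in \<open>S\<close>. The hypothesis
  \<open>range\<close> supplies constant rank: near \<open>x0\<close> the rank cannot drop, and
  \<open>range\<close> keeps it from rising.\<close>

theorem frobenius_leaf:
  fixes \<theta> :: "'a::euclidean_space \<Rightarrow> 'a \<Rightarrow> 'g::euclidean_space"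
  assumes U: "open U" "x0 \<in> U"
    and lin: "\<And>y. y \<in> U \<Longrightarrow> linear (\<theta> y)" and sm: "\<And>v. smooth_on U (\<lambda>y. \<theta> y v)"
    and range: "\<And>y v. y \<in> U \<Longrightarrow> \<theta> y v \<in> range (\<theta> x0)"
    and involutive: "\<And>y v w. y \<in> U \<Longrightarrow> \<theta> y v = 0 \<Longrightarrow> \<theta> y w = 0 \<Longrightarrow> form_deriv \<theta> y v w = 0"
  obtains W S and \<Phi> \<Psi> :: "'a \<Rightarrow> 'a" where "open W" "x0 \<in> W" "W \<subseteq> U" "subspace S" "smooth_on W \<Phi>" "open (\<Phi> ` W)"
    "smooth_on (\<Phi> ` W) \<Psi>" "\<And>y. y \<in> W \<Longrightarrow> \<Psi> (\<Phi> y) = y" "\<Phi> x0 \<in> S"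
    "\<And>y v. y \<in> W \<Longrightarrow> \<Phi> y \<in> S \<Longrightarrow> frechet_derivative \<Phi> (at y) v \<in> S \<longleftrightarrow> \<theta> y v = 0"
proof -
  define S where "S = {v. \<theta> x0 v = 0}"
  have lin0: "linear (\<theta> x0)" by (rule lin[OF U(2)])
  have S: "subspace S" by (auto simp: S_def subspace_def linear_0 linear_add linear_cmul lin0)
  obtain P where P: "linear P" "\<And>x. P x \<in> S" "\<And>x. x \<in> S \<Longrightarrow> P x = x"
    using subspace_projection[OF S] by blast
  have PP: "P (P x) = P x" for x using P by blast
  have S_iff: "x \<in> S \<longleftrightarrow> P x = x" for x using P by metis
  have \<theta>P: "\<theta> x0 (P x) = 0" for x using P(2) by (auto simp: S_def)
  \<comment> \<open>A complement of the kernel \<open>S\<close>. On it \<open>\<theta> x0\<close> is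
    injective, and the left inverse \<open>J\<close> obtained from this satisfies
    \<open>J (\<theta> x0 v) = v - P v\<close>.\<close>
  define C where "C = {v. P v = 0}"
  have C: "subspace C" by (auto simp: C_def subspace_def linear_0 linear_add linear_cmul P(1))
  have "inj_on (\<theta> x0) C"
  proof (rule inj_onI)
    fix a b assume ab: "a \<in> C" "b \<in> C" "\<theta> x0 a = \<theta> x0 b"
    then have "a - b \<in> S" "P (a - b) = 0" by (auto simp: S_def C_def linear_diff lin0 P(1))
    then show "a = b" using P(3) by force
  qed
  then obtain J where J: "J ` UNIV \<subseteq> C" "linear J" "\<And>v. v \<in> C \<Longrightarrow> J (\<theta> x0 v) = v"
    using linear_exists_left_inverse_on[OF lin0 C] by blast
  have PJ: "P (J x) = 0" for x using J(1) by (auto simp: C_def)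
  have J\<theta>: "J (\<theta> x0 v) = v - P v" for v
  proof -
    have "v - P v \<in> C" by (simp add: C_def linear_diff P(1) PP)
    from J(3)[OF this] show ?thesis by (simp add: linear_diff lin0 \<theta>P)
  qed
  \<comment> \<open>By \<open>range\<close> all values of \<open>\<theta> y\<close> are values of
    \<open>\<theta> x0\<close>, and on those \<open>J\<close> is injective.\<close>
  have J_inj: "\<theta> y v = 0" if "y \<in> U" "J (\<theta> y v) = 0" for y v
  proof -
    have "\<theta> y v \<in> range (\<theta> x0)" by (rule range[OF that(1)])
    then obtain v' where v': "\<theta> y v = \<theta> x0 v'" by auto
    then have "v' = P v'" using that(2) J\<theta>[of v'] by simp
    then show ?thesis using v' \<theta>P[of v'] by simp
  qed
  \<comment> \<open>At \<open>x0\<close> this is the identity, so it stays invertible nearby. Where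
    \<open>\<theta> y v\<close> vanishes it agrees with \<open>P\<close>, which lets its inverse
    parametrise the kernel of \<open>\<theta> y\<close> by that of
    \<open>\<theta> x0\<close>.\<close>
  define L where "L y v = P v + J (\<theta> y v)" for y v
  have linL: "linear (L y)" if "y \<in> U" for y
    unfolding L_def by (intro linear_compose_add P(1) linear_compose[OF lin[OF that] J(2), unfolded o_def])
  have smL: "smooth_on U (\<lambda>y. L y v)" for v
    unfolding L_def by (intro smooth_on_add smooth_on_const smooth_on_linear[OF _ J(2)] U sm)
  have L0: "L x0 v = v" for v by (simp add: L_def J\<theta>)
  have PL: "P (L y v) = P v" for y v by (simp add: L_def linear_add P(1) PP PJ)
  \<comment> \<open>\<open>N y\<close> bounds the operator norm of \<open>L y\<close> minus the
    identity; below 1 it forces \<open>L y\<close> to be injective.\<close>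
  define N where "N y = (\<Sum>i\<in>Basis. norm (L y i - i))" for y
  define U1 where "U1 = {y \<in> U. N y \<in> {..<1}}"
  have "continuous_on U N"
    unfolding N_def by (intro continuous_intros smooth_on_continuous smL)
  then have U1: "open U1" "x0 \<in> U1" "U1 \<subseteq> U"
    using continuous_open_preimage[OF _ U(1), of N "{..<1}"] U(2) L0
    by (auto simp: U1_def N_def Int_def)
  define M where "M y = inv_into UNIV (L y)" for y
  have bijL: "bij (L y)" if "y \<in> U1" for y
  proof -
    have y: "y \<in> U" "N y < 1" using that by (auto simp: U1_def)
    have "v = 0" if "L y v = 0" for v
    proof (rule ccontr)
      assume "v \<noteq> 0"
      have "norm (L y v - v) \<le> norm v * N y"
        using linear_norm_le_Basis[OF linear_compose_sub[OF linL[OF y(1)] linear_id]] by (simp add: N_def)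
      also have "\<dots> < norm v" using y(2) \<open>v \<noteq> 0\<close> by simp
      finally show False using that by simp
    qed
    then have "inj (L y)" by (simp add: linear_injective_0[OF linL[OF y(1)]])
    then show ?thesis
      using linear_injective_imp_surjective[OF linL[OF y(1)]] by (simp add: bij_def)
  qed
  have L_M: "L y (M y v) = v" and M_L: "M y (L y v) = v" if "y \<in> U1" for y v
    using bijL[OF that] by (auto simp: M_def bij_def surj_f_inv_f)
  have linL1: "linear (L y)" if "y \<in> U1" for y using that U1(3) linL by blast
  have smL1: "smooth_on U1 (\<lambda>y. L y v)" for v using smL U1(3) by (rule smooth_on_open_subset)
  have linM: "linear (M y)" if "y \<in> U1" for y
    by (rule linear_inverse_family[OF U1(1) linL1 smL1 L_M M_L that])
  have smM: "smooth_on U1 (\<lambda>y. M y v)" for v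
    by (rule smooth_on_inverse_family[OF U1(1) linL1 smL1 L_M M_L])
  \<comment> \<open>\<open>\<Gamma> y\<close> has the kernel of \<open>\<theta> y\<close> as its
    range. Precomposition with \<open>P\<close> extends it from \<open>S\<close> to the whole space,
    so that the solution \<psi> can live on a ball of a Euclidean type; the flattening map evaluates
    \<psi> on \<open>S\<close>.\<close>
  define \<Gamma> where "\<Gamma> y v = M y (P v)" for y v
  have lin\<Gamma>: "linear (\<Gamma> y)" if "y \<in> U1" for y
    unfolding \<Gamma>_def by (rule linear_compose[OF P(1) linM[OF that], unfolded o_def])
  have sm\<Gamma>: "smooth_on U1 (\<lambda>y. \<Gamma> y v)" for v unfolding \<Gamma>_def by (rule smM)
  have L\<Gamma>: "L y (\<Gamma> y v) = P v" if "y \<in> U1" for y v by (simp add: \<Gamma>_def L_M that)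
  have P\<Gamma>: "P (\<Gamma> y v) = P v" if "y \<in> U1" for y v using PL[of y "\<Gamma> y v"] L\<Gamma>[OF that, of v] by (simp add: PP)
  have \<theta>\<Gamma>: "\<theta> y (\<Gamma> y v) = 0" if "y \<in> U1" for y v
    using J_inj[of y "\<Gamma> y v"] that U1(3) L\<Gamma>[OF that, of v] P\<Gamma>[OF that, of v] by (auto simp: L_def)
  have ker: "\<theta> y v = 0 \<longleftrightarrow> \<Gamma> y v = v" if "y \<in> U1" for y v
  proof
    assume "\<theta> y v = 0"
    then have "L y v = P v" by (simp add: L_def linear_0 J(2))
    then show "\<Gamma> y v = v" unfolding \<Gamma>_def using M_L[OF that, of v] by metis
  qed (use \<theta>\<Gamma>[OF that, of v] in simp)
  have ker0: "v = 0" if "y \<in> U1" "P v = 0" "\<theta> y v = 0" for y v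
    using ker[OF that(1), of v] that linear_0[OF linM[OF that(1)]] by (simp add: \<Gamma>_def)
  have ap: "blinfun_apply (Blinfun (\<Gamma> y)) = \<Gamma> y" if "y \<in> U1" for y
    using lin\<Gamma>[OF that] by (simp add: bounded_linear_Blinfun_apply linear_conv_bounded_linear)
  obtain G' where G': "\<And>y. y \<in> U1 \<Longrightarrow> ((\<lambda>y. Blinfun (\<Gamma> y)) has_derivative blinfun_apply (G' y)) (at y)"
    "continuous_on U1 G'"
    "\<And>y h v. y \<in> U1 \<Longrightarrow> G' y h v = frechet_derivative (\<lambda>y. \<Gamma> y v) (at y) h"
    using has_derivative_Blinfun_family[OF U1(1) lin\<Gamma> sm\<Gamma>] by blast
  define D where "D y h v = frechet_derivative (\<lambda>y. \<Gamma> y v) (at y) h" for y h v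
  have D: "((\<lambda>y. \<Gamma> y v) has_derivative (\<lambda>h. D y h v)) (at y)" if "y \<in> U1" for y v
    unfolding D_def by (rule smooth_on_has_derivative[OF sm\<Gamma> that])
  have PD: "P (D y h v) = 0" if y: "y \<in> U1" for y h v
  proof -
    have "((\<lambda>y. P v) has_derivative (\<lambda>h. P (D y h v))) (at y)"
      by (rule has_derivative_transform_within_open[OF bounded_linear.has_derivative[OF _ D[OF y, of v]] U1(1) y])
        (use P(1) P\<Gamma> in \<open>auto simp: linear_conv_bounded_linear\<close>)
    from has_derivative_unique[OF this has_derivative_const] show ?thesis by metis
  qed
  have \<theta>D: "frechet_derivative (\<lambda>y. \<theta> y (\<Gamma> y' v)) (at y') h + \<theta> y' (D y' h v) = 0" if y: "y' \<in> U1" for y' h v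
  proof -
    have "((\<lambda>y. \<theta> y (\<Gamma> y v)) has_derivative
        (\<lambda>h. frechet_derivative (\<lambda>y. \<theta> y (\<Gamma> y' v)) (at y') h + \<theta> y' (D y' h v))) (at y')"
      using y U1(3) by (intro has_derivative_apply[where F' = "\<lambda>u h. frechet_derivative (\<lambda>y. \<theta> y u) (at y') h", OF U1(1) y]
          smooth_on_has_derivative[OF sm] D lin) auto
    then have "((\<lambda>y. 0) has_derivative
        (\<lambda>h. frechet_derivative (\<lambda>y. \<theta> y (\<Gamma> y' v)) (at y') h + \<theta> y' (D y' h v))) (at y')"
      by (rule has_derivative_transform_within_open[OF _ U1(1) y]) (rule \<theta>\<Gamma>)
    from has_derivative_unique[OF this has_derivative_const] show ?thesis by metis
  qed
  \<comment> \<open>Involutivity compares derivatives of \<theta>; differentiating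
    \<open>\<theta> y (\<Gamma> y v) = 0\<close> turns this into a statement about \<Gamma>. The
    difference of the two sides is killed by \<open>\<theta> y\<close> and, since
    \<open>P (\<Gamma> y v)\<close> is constant in \<open>y\<close>, also by \<open>P\<close>; by
    \<open>ker0\<close> it is zero.\<close>
  have D_sym: "D y (\<Gamma> y w) z = D y (\<Gamma> y z) w" if y: "y \<in> U1" for y w z
  proof -
    have y': "y \<in> U" using y U1(3) by blast
    let ?A = "frechet_derivative (\<lambda>y'. \<theta> y' (\<Gamma> y z)) (at y) (\<Gamma> y w)"
    let ?B = "frechet_derivative (\<lambda>y'. \<theta> y' (\<Gamma> y w)) (at y) (\<Gamma> y z)"
    have "form_deriv \<theta> y (\<Gamma> y w) (\<Gamma> y z) = 0" by (rule involutive[OF y' \<theta>\<Gamma>[OF y] \<theta>\<Gamma>[OF y]])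
    then have "?A = ?B" unfolding form_deriv_def right_minus_eq .
    moreover have "?A + \<theta> y (D y (\<Gamma> y w) z) = ?B + \<theta> y (D y (\<Gamma> y z) w)"
      unfolding \<theta>D[OF y] ..
    ultimately have "\<theta> y (D y (\<Gamma> y w) z) = \<theta> y (D y (\<Gamma> y z) w)"
      by (simp only: add_left_cancel)
    then have "D y (\<Gamma> y w) z - D y (\<Gamma> y z) w = 0"
      by (intro ker0[OF y, of "D y (\<Gamma> y w) z - D y (\<Gamma> y z) w"]) (simp_all add: linear_diff[OF P(1)] linear_diff[OF lin[OF y']] PD[OF y])
    then show ?thesis by simp
  qed
  have G'_sym: "G' y (Blinfun (\<Gamma> y) w) z = G' y (Blinfun (\<Gamma> y) z) w" if "y \<in> U1" for y w z
    using D_sym[OF that, of w z] by (simp only: ap[OF that] G'(3)[OF that] D_def)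
  obtain r \<psi> where r: "r > 0" and \<psi>0: "\<psi> 0 = x0" and \<psi>U: "\<And>z. z \<in> ball 0 r \<Longrightarrow> \<psi> z \<in> U1"
    and \<psi>': "\<And>z. z \<in> ball 0 r \<Longrightarrow> (\<psi> has_derivative blinfun_apply (Blinfun (\<Gamma> (\<psi> z)))) (at z)"
    using total_differential_equation[OF U1(1,2) G'(1,2) G'_sym] by blast
  have \<psi>': "(\<psi> has_derivative \<Gamma> (\<psi> z)) (at z)" if "z \<in> ball 0 r" for z
    using \<psi>'[OF that] ap[OF \<psi>U[OF that]] by simp
  have sm\<psi>: "smooth_on (ball 0 r) \<psi>"
    unfolding smooth_on_def
  proof
    fix k show "Ck_on k (ball 0 r) \<psi>"
    proof (induction k)
      case 0
      show ?case using \<psi>' by (auto intro!: continuous_at_imp_continuous_on has_derivative_continuous)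
    next
      case (Suc k)
      show ?case
        by (rule Ck_on_Suc_I[OF open_ball \<psi>'])
          (use sm\<Gamma> in \<open>auto intro!: Ck_on_compose[OF open_ball U1(1) \<psi>U Suc] simp: smooth_on_def\<close>)
    qed
  qed
  have P\<psi>: "P (\<psi> z) = P x0 + P z" if z: "z \<in> ball 0 r" for z
  proof -
    have "\<exists>c. \<forall>z\<in>ball 0 r. P (\<psi> z) - P z = c"
    proof (rule has_derivative_zero_constant[OF convex_ball])
      fix z :: 'a assume z: "z \<in> ball 0 r"
      have bl: "bounded_linear P" using P(1) by (simp add: linear_conv_bounded_linear)
      have "((\<lambda>z. P (\<psi> z) - P z) has_derivative (\<lambda>h. P (\<Gamma> (\<psi> z) h) - P h)) (at z)"
        by (intro has_derivative_diff bounded_linear.has_derivative[OF bl] \<psi>'[OF z] has_derivative_ident)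
      then show "((\<lambda>z. P (\<psi> z) - P z) has_derivative (\<lambda>h. 0)) (at z within ball 0 r)"
        using P\<Gamma>[OF \<psi>U[OF z]] by (simp add: has_derivative_at_withinI)
    qed
    then have "P (\<psi> z) - P z = P (\<psi> 0) - P 0" using z r by (metis centre_in_ball)
    then show ?thesis by (simp add: \<psi>0 linear_0 P(1) algebra_simps)
  qed
  \<comment> \<open>The leaf is a graph over \<open>S\<close>, translated to \<open>x0\<close>, and
    \<open>h\<close> is its graph function: by \<open>Ph\<close> its values lie in
    \<open>C\<close>.\<close>
  define h where "h z = \<psi> z - x0 - P z" for z
  have Ph: "P (h z) = 0" if "z \<in> ball 0 r" for z
    by (simp add: h_def linear_diff P(1) P\<psi>[OF that] PP)
  have smh: "smooth_on (ball 0 r) h"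
    unfolding h_def by (intro smooth_on_diff sm\<psi> smooth_on_linear[OF _ P(1)] smooth_on_const smooth_on_ident open_ball)
  define W where "W = {y \<in> U1. P (y - x0) \<in> ball 0 r}"
  \<comment> \<open>Since \<open>P\<close> kills the values of \<open>h\<close>, this shear leaves
    the \<open>P\<close> part of \<open>y - x0\<close> untouched. It is undone by adding the same
    value of \<open>h\<close> back, which makes \<Psi> an explicit inverse.\<close>
  define \<Phi> where "\<Phi> y = y - x0 - h (P (y - x0))" for y
  define B where "B = {x. P x \<in> ball 0 r}"
  define \<Psi> where "\<Psi> x = x + x0 + h (P x)" for x
  have contP: "continuous_on UNIV P" using P(1) by (simp add: linear_continuous_on linear_conv_bounded_linear)
  have B: "open B"
    using open_vimage[OF open_ball contP, of 0 r] by (simp add: B_def vimage_def)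
  have "open ((\<lambda>y. P (y - x0)) -` ball 0 r)"
    by (rule open_vimage[OF open_ball continuous_on_compose2[OF contP
          continuous_on_diff[OF continuous_on_id continuous_on_const] subset_UNIV]])
  moreover have "W = U1 \<inter> (\<lambda>y. P (y - x0)) -` ball 0 r" by (auto simp: W_def)
  ultimately have W: "open W" "W \<subseteq> U1" using open_Int[OF U1(1)] by simp_all
  have smPh: "smooth_on B (\<lambda>x. h (P x))"
  proof (rule smooth_on_compose[OF B open_ball _ smooth_on_linear[OF B P(1) smooth_on_ident[OF B]] smh])
    show "P x \<in> ball 0 r" if "x \<in> B" for x using that unfolding B_def by (rule CollectD)
  qed
  have sm\<Psi>: "smooth_on B \<Psi>"
    unfolding \<Psi>_def
    by (rule smooth_on_add[OF B smooth_on_add[OF B smooth_on_ident[OF B] smooth_on_const[OF B]] smPh])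
  have sm\<Phi>: "smooth_on W \<Phi>"
    unfolding \<Phi>_def
  proof (rule smooth_on_diff[OF W(1)])
    show sm: "smooth_on W (\<lambda>y. y - x0)"
      by (rule smooth_on_diff[OF W(1) smooth_on_ident[OF W(1)] smooth_on_const[OF W(1)]])
    show "smooth_on W (\<lambda>y. h (P (y - x0)))"
      by (rule smooth_on_compose[OF W(1) B _ sm smPh]) (simp add: W_def B_def)
  qed
  have PW: "P (\<Phi> y) = P (y - x0)" if "y \<in> W" for y
    using Ph[of "P (y - x0)"] that by (simp add: W_def \<Phi>_def linear_diff P(1))
  have \<Psi>\<Phi>: "\<Psi> (\<Phi> y) = y" if "y \<in> W" for y
    unfolding \<Psi>_def PW[OF that] by (simp add: \<Phi>_def)
  have image: "\<Phi> ` W = B \<inter> \<Psi> -` U1"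
  proof (intro equalityI subsetI)
    fix x assume "x \<in> \<Phi> ` W"
    then show "x \<in> B \<inter> \<Psi> -` U1" using PW \<Psi>\<Phi> by (auto simp: B_def W_def)
  next
    fix x assume x: "x \<in> B \<inter> \<Psi> -` U1"
    have "P (\<Psi> x - x0) = P x" using Ph[of "P x"] x by (simp add: \<Psi>_def B_def linear_add P(1))
    then have "\<Phi> (\<Psi> x) = x" "\<Psi> x \<in> W" using x by (auto simp: \<Phi>_def W_def B_def) (simp add: \<Psi>_def)
    then show "x \<in> \<Phi> ` W" by (metis image_eqI)
  qed
  have openimg: "open (\<Phi> ` W)"
    unfolding image by (rule continuous_open_preimage[OF smooth_on_continuous[OF sm\<Psi>] B U1(1)])
  \<comment> \<open>A point with \<open>\<Phi> y\<close> in \<open>S\<close> lies on the leaf, where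
    the derivative of \<psi> is \<open>\<Gamma> y\<close>. So \<Phi> has derivative
    \<open>v - \<Gamma> y v + P v\<close>, which \<open>P\<close> sends to \<open>P v\<close>; it
    lies in \<open>S\<close> exactly if \<open>\<Gamma> y v = v\<close>.\<close>
  have tangent: "frechet_derivative \<Phi> (at y) v \<in> S \<longleftrightarrow> \<theta> y v = 0" if y: "y \<in> W" and yS: "\<Phi> y \<in> S" for y v
  proof -
    let ?z = "P (y - x0)"
    have z: "?z \<in> ball 0 r" using y by (simp add: W_def)
    have "y = \<psi> ?z" using yS PW[OF y] by (simp add: S_iff \<Phi>_def h_def PP algebra_simps)
    have bl: "bounded_linear P" using P(1) by (simp add: linear_conv_bounded_linear)
    have dz: "((\<lambda>y. P (y - x0)) has_derivative P) (at y)"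
      by (rule bounded_linear.has_derivative[OF bl, THEN has_derivative_eq_rhs]) (auto intro!: derivative_eq_intros)
    have "(h has_derivative (\<lambda>v. \<Gamma> (\<psi> ?z) v - 0 - P v)) (at ?z)"
      unfolding h_def by (intro has_derivative_diff \<psi>'[OF z] has_derivative_const bounded_linear.has_derivative[OF bl] has_derivative_ident)
    from has_derivative_compose[OF dz this]
    have "(\<Phi> has_derivative (\<lambda>v. v - 0 - (\<Gamma> (\<psi> ?z) (P v) - 0 - P (P v)))) (at y)"
      unfolding \<Phi>_def by (intro has_derivative_diff has_derivative_const has_derivative_ident)
    from frechet_derivativeI[OF this]
    have "frechet_derivative \<Phi> (at y) v = v - \<Gamma> y v + P v"
      using \<open>y = \<psi> ?z\<close> by (simp add: PP \<Gamma>_def)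
    then show ?thesis
      using y W(2) P\<Gamma>[of y v] by (auto simp: S_iff linear_add linear_diff P(1) PP ker)
  qed
  show thesis
  proof (rule that[of W S \<Phi> \<Psi>])
    show "x0 \<in> W" using U1(2) r by (simp add: W_def linear_0 P(1))
    show "\<Phi> x0 \<in> S" using S by (simp add: \<Phi>_def h_def \<psi>0 linear_0 P(1) subspace_0)
    show "smooth_on (\<Phi> ` W) \<Psi>" by (rule smooth_on_open_subset[OF sm\<Psi>]) (auto simp: image)
  qed (use W U1 S sm\<Phi> openimg \<Psi>\<Phi> tangent in auto)
qed

section \<open>Charts and smooth maps of manifolds\<close>

text \<open>The part of a smooth atlas that passes to product atlases chart by chart; composition
  and the chain rule are proved at this level so that they apply to products as well.\<close>

definition chart_cover :: "('m::topological_space, 'a::euclidean_space) chart set \<Rightarrow> bool" where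
  "chart_cover A \<longleftrightarrow> (\<forall>c\<in>A. is_chart c) \<and> (\<Union>c\<in>A. fst c) = UNIV"

text \<open>Adapted charts need not belong to the atlas, only to the maximal atlas.\<close>

definition max_chart :: "('m::topological_space, 'a::euclidean_space) chart set \<Rightarrow> ('m, 'a) chart \<Rightarrow> bool" where
  "max_chart A c \<longleftrightarrow> is_chart c \<and> (\<forall>d\<in>A. compatible c d)"

text \<open>Smoothness as a property of the germ, so that maps may be composed and modified near a
  point without tracking domains.\<close>

definition smooth_at ::
  "('m::topological_space, 'a::euclidean_space) chart set \<Rightarrow>
   ('n::topological_space, 'b::euclidean_space) chart set \<Rightarrow> ('m \<Rightarrow> 'n) \<Rightarrow> 'm \<Rightarrow> bool" where
  "smooth_at A B f x \<longleftrightarrow> (\<exists>W. x \<in> W \<and> smooth_map_open A B W f)"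

lemma smooth_atlas_cover: "smooth_atlas A \<Longrightarrow> chart_cover A"
  by (simp add: smooth_atlas_def chart_cover_def)

lemma smooth_atlas_max_chart: "smooth_atlas A \<Longrightarrow> c \<in> A \<Longrightarrow> max_chart A c"
  by (simp add: smooth_atlas_def max_chart_def)

lemma max_chart_is_chart: "max_chart A c \<Longrightarrow> is_chart c"
  by (simp add: max_chart_def)

lemma smooth_on_eq: "smooth_on S f \<Longrightarrow> open S \<Longrightarrow> (\<And>x. x \<in> S \<Longrightarrow> f x = g x) \<Longrightarrow> smooth_on S g"
  using smooth_on_cong by blast

lemma chart_cover_is_chart: "chart_cover A \<Longrightarrow> c \<in> A \<Longrightarrow> is_chart c"
  by (simp add: chart_cover_def)

lemma chart_at: "chart_cover A \<Longrightarrow> chart_at A x \<in> A \<and> x \<in> fst (chart_at A x)"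
  unfolding chart_at_def chart_cover_def by (rule someI_ex) blast

lemma is_chart_open: "is_chart c \<Longrightarrow> open (fst c)" "is_chart c \<Longrightarrow> open (snd c ` fst c)"
  by (simp_all add: is_chart_def)

lemma chart_inv_left: "is_chart c \<Longrightarrow> x \<in> fst c \<Longrightarrow> chart_inv c (snd c x) = x"
  by (auto simp: is_chart_def homeomorphism_def)

lemma chart_inv_right: "is_chart c \<Longrightarrow> y \<in> snd c ` fst c \<Longrightarrow> snd c (chart_inv c y) = y"
  by (auto simp: is_chart_def homeomorphism_def)

lemma chart_inv_in: "is_chart c \<Longrightarrow> y \<in> snd c ` fst c \<Longrightarrow> chart_inv c y \<in> fst c"
  by (auto simp: is_chart_def homeomorphism_def)

lemma continuous_on_chart: "is_chart c \<Longrightarrow> continuous_on (fst c) (snd c)"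
  by (auto simp: is_chart_def homeomorphism_def)

lemma continuous_on_chart_inv: "is_chart c \<Longrightarrow> continuous_on (snd c ` fst c) (chart_inv c)"
  by (auto simp: is_chart_def homeomorphism_def)

lemma open_chart_image:
  assumes "is_chart c" "open W"
  shows "open (snd c ` (W \<inter> fst c))"
proof -
  have "snd c ` (W \<inter> fst c) = snd c ` fst c \<inter> chart_inv c -` W"
    using assms(1) by (auto simp: chart_inv_left)
  then show ?thesis
    using continuous_open_preimage[OF continuous_on_chart_inv is_chart_open(2) assms(2)] assms(1) by simp
qed

lemma open_chart_preimage:
  assumes "is_chart c" "open S"
  shows "open (fst c \<inter> snd c -` S)"
  by (rule continuous_open_preimage[OF continuous_on_chart[OF assms(1)] is_chart_open(1)[OF assms(1)] assms(2)])

lemma smooth_map_open_dom: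
  assumes "smooth_map_open A B W f" "is_chart d"
  shows "open {x \<in> W. f x \<in> fst d}"
proof -
  have "open (W \<inter> f -` fst d)"
    using continuous_open_preimage[of W f "fst d"] is_chart_open(1)[OF assms(2)] assms(1)
    by (simp add: smooth_map_open_def)
  then show ?thesis by (simp add: Int_def vimage_def)
qed

lemma smooth_map_open_subset:
  assumes "smooth_map_open A B W f" "open V" "V \<subseteq> W"
  shows "smooth_map_open A B V f"
  unfolding smooth_map_open_def
proof (intro conjI ballI)
  show "continuous_on V f" using assms continuous_on_subset by (auto simp: smooth_map_open_def)
  fix c d assume "c \<in> A" "d \<in> B"
  then have "smooth_on (snd c ` {x \<in> W \<inter> fst c. f x \<in> fst d}) (snd d \<circ> f \<circ> chart_inv c)"
    using assms(1) by (simp add: smooth_map_open_def)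
  then show "smooth_on (snd c ` {x \<in> V \<inter> fst c. f x \<in> fst d}) (snd d \<circ> f \<circ> chart_inv c)"
    by (rule smooth_on_open_subset) (use assms(3) in blast)
qed (rule assms(2))

lemma open_smooth_dom:
  assumes "smooth_map_open A B W f" "is_chart c" "is_chart d"
  shows "open (snd c ` {x \<in> W \<inter> fst c. f x \<in> fst d})"
proof -
  have "{x \<in> W \<inter> fst c. f x \<in> fst d} = {x \<in> W. f x \<in> fst d} \<inter> fst c" by auto
  then show ?thesis using open_chart_image[OF assms(2) smooth_map_open_dom[OF assms(1,3)]] by simp
qed

lemma smooth_map_open_cong:
  assumes "chart_cover A" "chart_cover B" "smooth_map_open A B W f" "\<And>x. x \<in> W \<Longrightarrow> f x = g x"
  shows "smooth_map_open A B W g"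
  unfolding smooth_map_open_def
proof (intro conjI ballI)
  show "open W" using assms(3) by (simp add: smooth_map_open_def)
  show "continuous_on W g" using assms(3,4) by (simp add: smooth_map_open_def cong: continuous_on_cong)
  fix c d assume cd: "c \<in> A" "d \<in> B"
  let ?S = "snd c ` {x \<in> W \<inter> fst c. f x \<in> fst d}"
  have "smooth_on ?S (snd d \<circ> f \<circ> chart_inv c)"
    using assms(3) cd by (simp add: smooth_map_open_def)
  moreover have "open ?S"
    using assms cd by (intro open_smooth_dom[OF assms(3)]) (auto simp: chart_cover_def)
  ultimately have "smooth_on ?S (snd d \<circ> g \<circ> chart_inv c)"
    by (rule smooth_on_eq) (auto simp: assms(4) chart_inv_left[OF chart_cover_is_chart[OF assms(1) cd(1)]])
  moreover have "?S = snd c ` {x \<in> W \<inter> fst c. g x \<in> fst d}" using assms(4) by (intro arg_cong[where f = "image (snd c)"]) auto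
  ultimately show "smooth_on (snd c ` {x \<in> W \<inter> fst c. g x \<in> fst d}) (snd d \<circ> g \<circ> chart_inv c)" by simp
qed

lemma smooth_at_nbhd:
  assumes "smooth_at A B f x"
  obtains W where "open W" "x \<in> W" "continuous_on W f" "\<And>y. y \<in> W \<Longrightarrow> smooth_at A B f y"
  using assms unfolding smooth_at_def smooth_map_open_def by blast

lemma smooth_at_cong:
  assumes "chart_cover A" "chart_cover B" "smooth_at A B f x" "open V" "x \<in> V" "\<And>y. y \<in> V \<Longrightarrow> f y = g y"
  shows "smooth_at A B g x"
proof -
  obtain W where W: "x \<in> W" "smooth_map_open A B W f" using assms(3) by (auto simp: smooth_at_def)
  have "smooth_map_open A B (W \<inter> V) f"
    using W assms(4) by (intro smooth_map_open_subset[OF W(2)]) (auto simp: smooth_map_open_def)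
  then have "smooth_map_open A B (W \<inter> V) g"
    by (rule smooth_map_open_cong[OF assms(1,2)]) (use assms(6) in auto)
  then show ?thesis using W(1) assms(5) by (auto simp: smooth_at_def)
qed

lemma smooth_map_on_UNIV_smooth_at:
  assumes "chart_cover A" "chart_cover B" "smooth_map_on A B UNIV f"
  shows "smooth_at A B f x"
proof -
  have "\<exists>W g. x \<in> W \<and> smooth_map_open A B W g \<and> (\<forall>y\<in>W. g y = f y)"
    using assms(3) by (simp add: smooth_map_on_def)
  then obtain W g where "x \<in> W" "smooth_map_open A B W g" "\<forall>y\<in>W. g y = f y" by blast
  then show ?thesis using smooth_map_open_cong[OF assms(1,2), of W g f] by (auto simp: smooth_at_def)
qed

lemma smooth_at_chartsE:
  assumes "chart_cover A" "chart_cover B" "smooth_at A B f x" "c \<in> A" "d \<in> B" "x \<in> fst c" "f x \<in> fst d"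
  obtains S where "open S" "snd c x \<in> S" "S \<subseteq> snd c ` fst c" "\<And>y. y \<in> S \<Longrightarrow> f (chart_inv c y) \<in> fst d"
    "\<And>y. y \<in> S \<Longrightarrow> smooth_at A B f (chart_inv c y)" "smooth_on S (snd d \<circ> f \<circ> chart_inv c)"
proof -
  obtain W where W: "x \<in> W" "smooth_map_open A B W f" using assms(3) by (auto simp: smooth_at_def)
  have cd: "is_chart c" "is_chart d" using assms by (auto simp: chart_cover_def)
  let ?S = "snd c ` {x \<in> W \<inter> fst c. f x \<in> fst d}"
  show thesis
  proof (rule that[of ?S])
    show "open ?S" by (rule open_smooth_dom[OF W(2) cd])
    show "snd c x \<in> ?S" using W assms by blast
    show "smooth_on ?S (snd d \<circ> f \<circ> chart_inv c)" using W(2) assms(4,5) by (simp add: smooth_map_open_def)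
    show "smooth_at A B f (chart_inv c y)" if "y \<in> ?S" for y
      using that W(2) chart_inv_left[OF cd(1)] unfolding smooth_at_def by auto
  qed (auto simp: chart_inv_left[OF cd(1)])
qed

text \<open>The coordinate expression factors through a chart of the middle manifold around the
  image point. This chart varies with the point, hence the reduction by
  \<open>smooth_on_local\<close>.\<close>

lemma smooth_at_compose:
  assumes A: "chart_cover A" and B: "chart_cover B" and C: "chart_cover C"
    and f: "smooth_at A B f x" and g: "smooth_at B C g (f x)"
  shows "smooth_at A C (\<lambda>x. g (f x)) x"
proof -
  obtain W where W: "x \<in> W" "smooth_map_open A B W f" using f by (auto simp: smooth_at_def)
  obtain V where V: "f x \<in> V" "smooth_map_open B C V g" using g by (auto simp: smooth_at_def)
  have cont: "continuous_on W f" "open W" "continuous_on V g" "open V"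
    using W V by (auto simp: smooth_map_open_def)
  let ?W = "W \<inter> f -` V"
  have "smooth_map_open A C ?W (\<lambda>x. g (f x))"
    unfolding smooth_map_open_def
  proof (intro conjI ballI)
    show oW: "open ?W" using cont continuous_open_preimage by blast
    show "continuous_on ?W (\<lambda>x. g (f x))"
      by (rule continuous_on_compose2[OF cont(3) continuous_on_subset[OF cont(1)]]) auto
    fix c d assume cd: "c \<in> A" "d \<in> C"
    have ch: "is_chart c" "is_chart d" using A C cd by (auto simp: chart_cover_def)
    show "smooth_on (snd c ` {x \<in> ?W \<inter> fst c. g (f x) \<in> fst d}) (snd d \<circ> (\<lambda>x. g (f x)) \<circ> chart_inv c)"
    proof (rule smooth_on_local)
      fix y assume "y \<in> snd c ` {x \<in> ?W \<inter> fst c. g (f x) \<in> fst d}"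
      then obtain z where z: "y = snd c z" "z \<in> W" "f z \<in> V" "z \<in> fst c" "g (f z) \<in> fst d" by auto
      obtain e where e: "e \<in> B" "f z \<in> fst e" using chart_at[OF B] by blast
      have che: "is_chart e" using B e by (auto simp: chart_cover_def)
      let ?T2 = "snd e ` {x \<in> V \<inter> fst e. g x \<in> fst d}"
      let ?T = "snd c ` {x \<in> ?W \<inter> fst c. f x \<in> fst e \<and> g (f x) \<in> fst d}"
      have T2: "open ?T2" by (rule open_smooth_dom[OF V(2) che ch(2)])
      have "open {x \<in> V \<inter> fst e. g x \<in> fst d}"
        using open_Int[OF smooth_map_open_dom[OF V(2) ch(2)] is_chart_open(1)[OF che]] by (simp add: Int_def conj_ac)
      then have "open (W \<inter> f -` {x \<in> V \<inter> fst e. g x \<in> fst d})"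
        by (rule continuous_open_preimage[OF cont(1,2)])
      moreover have "?T = snd c ` ((W \<inter> f -` {x \<in> V \<inter> fst e. g x \<in> fst d}) \<inter> fst c)" by auto
      ultimately have T: "open ?T" using open_chart_image[OF ch(1)] by presburger
      have "smooth_on ?T (\<lambda>y. (snd d \<circ> g \<circ> chart_inv e) ((snd e \<circ> f \<circ> chart_inv c) y))"
      proof (rule smooth_on_compose[OF T T2])
        show "(snd e \<circ> f \<circ> chart_inv c) y \<in> ?T2" if "y \<in> ?T" for y
          using that chart_inv_left[OF ch(1)] by auto
        show "smooth_on ?T (snd e \<circ> f \<circ> chart_inv c)"
          using W(2) cd(1) e(1) by (auto simp: smooth_map_open_def intro: smooth_on_open_subset)
        show "smooth_on ?T2 (snd d \<circ> g \<circ> chart_inv e)"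
          using V(2) cd(2) e(1) by (auto simp: smooth_map_open_def)
      qed
      then have "smooth_on ?T (snd d \<circ> (\<lambda>x. g (f x)) \<circ> chart_inv c)"
        by (rule smooth_on_eq[OF _ T]) (auto simp: chart_inv_left[OF ch(1)] chart_inv_left[OF che])
      moreover have "y \<in> ?T" using z e by blast
      ultimately show "\<exists>T. open T \<and> y \<in> T \<and> smooth_on T (snd d \<circ> (\<lambda>x. g (f x)) \<circ> chart_inv c)"
        using T by blast
    qed
  qed
  then show ?thesis unfolding smooth_at_def using W(1) V(1) by (intro exI[of _ ?W] conjI) auto
qed

lemma smooth_at_ident: "smooth_atlas A \<Longrightarrow> smooth_at A A (\<lambda>x. x) x"
  unfolding smooth_at_def smooth_map_open_def
  by (rule exI[of _ UNIV]) (simp add: smooth_atlas_def compatible_def o_def flip: Int_def)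

lemma smooth_at_const:
  assumes "chart_cover A" shows "smooth_at A B (\<lambda>x. b) x"
proof -
  have "smooth_on (snd c ` {x \<in> UNIV \<inter> fst c. b \<in> fst d}) (\<lambda>x. snd d b)" if "c \<in> A" "d \<in> B" for c d
    by (rule smooth_on_open_subset[OF smooth_on_const[OF is_chart_open(2)[OF chart_cover_is_chart[OF assms that(1)]]]]) blast
  then have "smooth_map_open A B UNIV (\<lambda>x. b)" by (simp add: smooth_map_open_def o_def)
  then show ?thesis unfolding smooth_at_def by blast
qed

lemma smooth_at_Pair:
  assumes A: "chart_cover A" and B: "chart_cover B" and C: "chart_cover C"
    and f: "smooth_at A B f x" and g: "smooth_at A C g x"
  shows "smooth_at A (prod_atlas B C) (\<lambda>x. (f x, g x)) x"
proof -
  obtain W where W: "x \<in> W" "smooth_map_open A B W f" using f by (auto simp: smooth_at_def)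
  obtain V where V: "x \<in> V" "smooth_map_open A C V g" using g by (auto simp: smooth_at_def)
  have cont: "continuous_on W f" "open W" "continuous_on V g" "open V"
    using W V by (auto simp: smooth_map_open_def)
  have "smooth_map_open A (prod_atlas B C) (W \<inter> V) (\<lambda>x. (f x, g x))"
    unfolding smooth_map_open_def
  proof (intro conjI ballI)
    show "open (W \<inter> V)" using cont by blast
    show "continuous_on (W \<inter> V) (\<lambda>x. (f x, g x))"
      using cont by (intro continuous_on_Pair) (auto intro: continuous_on_subset)
    fix c p assume c: "c \<in> A" and "p \<in> prod_atlas B C"
    then obtain d e where de: "p = (fst d \<times> fst e, map_prod (snd d) (snd e))" "d \<in> B" "e \<in> C"
      by (auto simp: prod_atlas_def)
    have ch: "is_chart c" "is_chart d" "is_chart e" using A B C c de by (auto simp: chart_cover_def)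
    let ?S = "snd c ` {x \<in> (W \<inter> V) \<inter> fst c. (f x, g x) \<in> fst p}"
    have "?S = snd c ` (({x \<in> W. f x \<in> fst d} \<inter> {x \<in> V. g x \<in> fst e}) \<inter> fst c)" by (auto simp: de)
    then have S: "open ?S"
      using open_chart_image[OF ch(1) open_Int[OF smooth_map_open_dom[OF W(2) ch(2)] smooth_map_open_dom[OF V(2) ch(3)]]]
      by simp
    have "smooth_on ?S (snd d \<circ> f \<circ> chart_inv c)"
      by (rule smooth_on_open_subset[where S = "snd c ` {x \<in> W \<inter> fst c. f x \<in> fst d}"])
        (use W(2) c de in \<open>auto simp: smooth_map_open_def\<close>)
    moreover have "smooth_on ?S (snd e \<circ> g \<circ> chart_inv c)"
      by (rule smooth_on_open_subset[where S = "snd c ` {x \<in> V \<inter> fst c. g x \<in> fst e}"])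
        (use V(2) c de in \<open>auto simp: smooth_map_open_def\<close>)
    ultimately have "smooth_on ?S (\<lambda>y. ((snd d \<circ> f \<circ> chart_inv c) y, (snd e \<circ> g \<circ> chart_inv c) y))"
      by (rule smooth_on_Pair[OF S])
    then show "smooth_on ?S (snd p \<circ> (\<lambda>x. (f x, g x)) \<circ> chart_inv c)"
      by (simp add: de o_def)
  qed
  then show ?thesis unfolding smooth_at_def using W(1) V(1) by (intro exI[of _ "W \<inter> V"] conjI) auto
qed

section \<open>Product manifolds\<close>

lemma prod_chart_inv:
  assumes "is_chart c" "is_chart d" "y \<in> snd c ` fst c" "z \<in> snd d ` fst d"
  shows "chart_inv (fst c \<times> fst d, map_prod (snd c) (snd d)) (y, z) = (chart_inv c y, chart_inv d z)"
proof -
  have inj: "inj_on (map_prod (snd c) (snd d)) (fst c \<times> fst d)"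
    using inj_on_inverseI[of "fst c" "chart_inv c" "snd c"] inj_on_inverseI[of "fst d" "chart_inv d" "snd d"]
    by (intro map_prod_inj_on) (auto simp: chart_inv_left assms)
  have eq: "map_prod (snd c) (snd d) (chart_inv c y, chart_inv d z) = (y, z)"
    using assms by (simp add: chart_inv_right)
  have "(chart_inv c y, chart_inv d z) \<in> fst c \<times> fst d"
    using assms by (simp add: chart_inv_in)
  from inv_into_f_f[OF inj this] show ?thesis
    unfolding chart_inv_def[of "(fst c \<times> fst d, map_prod (snd c) (snd d))"] fst_conv snd_conv eq .
qed

lemma is_chart_prod:
  assumes "is_chart c" "is_chart d"
  shows "is_chart (fst c \<times> fst d, map_prod (snd c) (snd d))"
proof -
  let ?p = "(fst c \<times> fst d, map_prod (snd c) (snd d))"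
  have im: "snd ?p ` fst ?p = (snd c ` fst c) \<times> (snd d ` fst d)" by (auto simp: map_prod_def image_iff)
  have "continuous_on (fst ?p) (\<lambda>x. (snd c (fst x), snd d (snd x)))"
    by (intro continuous_on_Pair continuous_on_compose2[OF continuous_on_chart[OF assms(1)] continuous_on_fst[OF continuous_on_id]]
        continuous_on_compose2[OF continuous_on_chart[OF assms(2)] continuous_on_snd[OF continuous_on_id]]) auto
  then have 1: "continuous_on (fst ?p) (snd ?p)" by (simp add: map_prod_def case_prod_unfold)
  have "continuous_on (snd ?p ` fst ?p) (\<lambda>x. (chart_inv c (fst x), chart_inv d (snd x)))"
    unfolding im
    by (intro continuous_on_Pair continuous_on_compose2[OF continuous_on_chart_inv[OF assms(1)] continuous_on_fst[OF continuous_on_id]]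
        continuous_on_compose2[OF continuous_on_chart_inv[OF assms(2)] continuous_on_snd[OF continuous_on_id]]) auto
  then have 2: "continuous_on (snd ?p ` fst ?p) (chart_inv ?p)"
    by (rule continuous_on_cong[OF refl, THEN iffD1, rotated]) (auto simp: im prod_chart_inv[OF assms])
  have "homeomorphism (fst ?p) (snd ?p ` fst ?p) (snd ?p) (chart_inv ?p)"
  proof (rule homeomorphismI[OF 1 2])
    show "chart_inv ?p ` (snd ?p ` fst ?p) \<subseteq> fst ?p"
      by (auto simp: prod_chart_inv[OF assms] chart_inv_left assms)
  qed (auto simp: prod_chart_inv[OF assms] chart_inv_left assms)
  moreover have "open (snd ?p ` fst ?p)" "open (fst ?p)"
    unfolding im using assms by (auto intro!: open_Times simp: is_chart_open)
  ultimately show ?thesis by (simp add: is_chart_def)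
qed

lemma chart_cover_prod: "chart_cover A \<Longrightarrow> chart_cover B \<Longrightarrow> chart_cover (prod_atlas A B)"
  unfolding chart_cover_def
proof (intro conjI ballI)
  assume AB: "(\<forall>c\<in>A. is_chart c) \<and> (\<Union>c\<in>A. fst c) = UNIV" "(\<forall>c\<in>B. is_chart c) \<and> (\<Union>c\<in>B. fst c) = UNIV"
  fix p assume "p \<in> prod_atlas A B"
  then obtain c d where "p = (fst c \<times> fst d, map_prod (snd c) (snd d))" "c \<in> A" "d \<in> B"
    unfolding prod_atlas_def by blast
  then show "is_chart p" using AB is_chart_prod by blast
next
  assume AB: "(\<forall>c\<in>A. is_chart c) \<and> (\<Union>c\<in>A. fst c) = UNIV" "(\<forall>c\<in>B. is_chart c) \<and> (\<Union>c\<in>B. fst c) = UNIV"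
  have "x \<in> (\<Union>c\<in>prod_atlas A B. fst c)" for x
  proof -
    obtain c d where "c \<in> A" "d \<in> B" "fst x \<in> fst c" "snd x \<in> fst d" using AB by blast
    moreover from this have "(fst c \<times> fst d, map_prod (snd c) (snd d)) \<in> prod_atlas A B"
      unfolding prod_atlas_def by blast
    ultimately show ?thesis by (intro UN_I) (auto simp: mem_Times_iff)
  qed
  then show "(\<Union>c\<in>prod_atlas A B. fst c) = UNIV" by blast
qed

lemma smooth_at_fst:
  assumes A: "smooth_atlas A" and B: "chart_cover B"
  shows "smooth_at (prod_atlas A B) A fst x"
proof -
  have "smooth_map_open (prod_atlas A B) A UNIV fst"
    unfolding smooth_map_open_def
  proof (intro conjI ballI)
    fix p d assume "p \<in> prod_atlas A B" and d: "d \<in> A"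
    then obtain c e where ce: "p = (fst c \<times> fst e, map_prod (snd c) (snd e))" "c \<in> A" "e \<in> B"
      by (auto simp: prod_atlas_def)
    have ch: "is_chart c" "is_chart d" "is_chart e" using A B ce d by (auto simp: chart_cover_def smooth_atlas_def)
    let ?S = "snd p ` {x \<in> UNIV \<inter> fst p. fst x \<in> fst d}"
    let ?T = "snd c ` (fst c \<inter> fst d)"
    have S: "?S = ?T \<times> (snd e ` fst e)" by (auto simp: ce image_iff)
    have T: "open ?T" using open_chart_image[OF ch(1) is_chart_open(1)[OF ch(2)]] by (simp add: Int_commute)
    have oS: "open ?S" unfolding S by (intro open_Times T is_chart_open ch)
    have "smooth_on ?S (\<lambda>y. (snd d \<circ> chart_inv c) (fst y))"
    proof (rule smooth_on_compose[OF oS T, where f = fst and g = "snd d \<circ> chart_inv c"])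
      show "smooth_on ?T (snd d \<circ> chart_inv c)" using A ce d by (auto simp: smooth_atlas_def compatible_def)
      show "smooth_on ?S fst" by (rule smooth_on_fst[OF oS smooth_on_ident[OF oS]])
      show "fst y \<in> ?T" if "y \<in> ?S" for y using that unfolding S by auto
    qed
    then show "smooth_on ?S (snd d \<circ> fst \<circ> chart_inv p)"
      by (rule smooth_on_eq[OF _ oS]) (auto simp: ce prod_chart_inv ch chart_inv_left)
  qed (auto intro: continuous_on_fst[OF continuous_on_id])
  then show ?thesis by (auto simp: smooth_at_def)
qed

lemma smooth_at_snd:
  assumes A: "chart_cover A" and B: "smooth_atlas B"
  shows "smooth_at (prod_atlas A B) B snd x"
proof -
  have "smooth_map_open (prod_atlas A B) B UNIV snd"
    unfolding smooth_map_open_def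
  proof (intro conjI ballI)
    fix p d assume "p \<in> prod_atlas A B" and d: "d \<in> B"
    then obtain c e where ce: "p = (fst c \<times> fst e, map_prod (snd c) (snd e))" "c \<in> A" "e \<in> B"
      by (auto simp: prod_atlas_def)
    have ch: "is_chart c" "is_chart d" "is_chart e" using A B ce d by (auto simp: chart_cover_def smooth_atlas_def)
    let ?S = "snd p ` {x \<in> UNIV \<inter> fst p. snd x \<in> fst d}"
    let ?T = "snd e ` (fst e \<inter> fst d)"
    have S: "?S = (snd c ` fst c) \<times> ?T" by (auto simp: ce image_iff)
    have T: "open ?T" using open_chart_image[OF ch(3) is_chart_open(1)[OF ch(2)]] by (simp add: Int_commute)
    have oS: "open ?S" unfolding S by (intro open_Times T is_chart_open ch)
    have "smooth_on ?S (\<lambda>y. (snd d \<circ> chart_inv e) (snd y))"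
    proof (rule smooth_on_compose[OF oS T, where f = snd and g = "snd d \<circ> chart_inv e"])
      show "smooth_on ?T (snd d \<circ> chart_inv e)" using B ce d by (auto simp: smooth_atlas_def compatible_def)
      show "smooth_on ?S snd" by (rule smooth_on_snd[OF oS smooth_on_ident[OF oS]])
      show "snd y \<in> ?T" if "y \<in> ?S" for y using that unfolding S by auto
    qed
    then show "smooth_on ?S (snd d \<circ> snd \<circ> chart_inv p)"
      by (rule smooth_on_eq[OF _ oS]) (auto simp: ce prod_chart_inv ch chart_inv_left)
  qed (auto intro: continuous_on_snd[OF continuous_on_id])
  then show ?thesis by (auto simp: smooth_at_def)
qed

section \<open>Euclidean spaces as manifolds\<close>

lemma chart_inv_std [simp]: "chart_inv (UNIV, \<lambda>x. x) = (\<lambda>x. x)"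
  by (rule ext) (simp add: chart_inv_def inv_into_f_f[of "\<lambda>x. x" UNIV, unfolded inj_def, simplified])

lemma smooth_atlas_std: "smooth_atlas std_atlas"
  by (auto simp: smooth_atlas_def std_atlas_def is_chart_def homeomorphism_def compatible_def o_def)

lemma chart_cover_std: "chart_cover std_atlas"
  by (rule smooth_atlas_cover[OF smooth_atlas_std])

lemma chart_at_std [simp]: "chart_at std_atlas (x::'a::euclidean_space) = (UNIV, \<lambda>x. x)"
  using chart_at[OF chart_cover_std, of x] by (auto simp: std_atlas_def)

lemma smooth_at_std_iff: "smooth_at std_atlas std_atlas f x \<longleftrightarrow> (\<exists>S. open S \<and> x \<in> S \<and> smooth_on S f)"
  by (auto simp: smooth_at_def smooth_map_open_def std_atlas_def o_def dest: smooth_on_continuous)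

lemma smooth_at_chart:
  assumes "max_chart A c" "x \<in> fst c"
  shows "smooth_at A std_atlas (snd c) x"
proof -
  have c: "is_chart c" using assms(1) by (simp add: max_chart_def)
  have "smooth_on (snd d ` {x \<in> fst c. x \<in> fst d}) (snd c \<circ> chart_inv d)" if "d \<in> A" for d
    using assms(1) that by (simp add: max_chart_def compatible_def flip: Int_def)
  then have "smooth_map_open A std_atlas (fst c) (snd c)"
    by (simp add: smooth_map_open_def std_atlas_def is_chart_open(1)[OF c] continuous_on_chart[OF c] o_def)
  then show ?thesis using assms(2) unfolding smooth_at_def by blast
qed

lemma smooth_at_chart_inv:
  assumes "max_chart A c" "y \<in> snd c ` fst c"
  shows "smooth_at std_atlas A (chart_inv c) y"
proof -
  have c: "is_chart c" using assms by (simp add: max_chart_def)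
  have "smooth_on {y \<in> snd c ` fst c. chart_inv c y \<in> fst d} (snd d \<circ> chart_inv c)" if "d \<in> A" for d
  proof -
    have "{y \<in> snd c ` fst c. chart_inv c y \<in> fst d} = snd c ` (fst c \<inter> fst d)"
      using c by (auto simp: chart_inv_left)
    then show ?thesis using assms(1) that by (simp add: max_chart_def compatible_def)
  qed
  then have "smooth_map_open std_atlas A (snd c ` fst c) (chart_inv c)"
    by (simp add: smooth_map_open_def std_atlas_def is_chart_open(2)[OF c] continuous_on_chart_inv[OF c] o_def)
  then show ?thesis using assms(2) unfolding smooth_at_def by blast
qed

section \<open>Tangent maps\<close>

lemma tangent_map_has_derivative:
  assumes "chart_cover A" "chart_cover B" "smooth_at A B f x"
  shows "((snd (chart_at B (f x)) \<circ> f \<circ> chart_inv (chart_at A x)) has_derivative tangent_map A B f x)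
    (at (snd (chart_at A x) x))"
proof -
  obtain S where "snd (chart_at A x) x \<in> S"
    "smooth_on S (snd (chart_at B (f x)) \<circ> f \<circ> chart_inv (chart_at A x))"
    using smooth_at_chartsE[OF assms] chart_at[OF assms(1)] chart_at[OF assms(2)] by metis
  then show ?thesis unfolding tangent_map_def by (intro smooth_on_has_derivative)
qed

lemma linear_tangent_map:
  "chart_cover A \<Longrightarrow> chart_cover B \<Longrightarrow> smooth_at A B f x \<Longrightarrow> linear (tangent_map A B f x)"
  by (rule has_derivative_linear[OF tangent_map_has_derivative])

lemma tangent_map_cong:
  assumes "chart_cover A" "chart_cover B" "smooth_at A B f x" "open V" "x \<in> V" "\<And>y. y \<in> V \<Longrightarrow> f y = g y"
  shows "tangent_map A B g x = tangent_map A B f x"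
proof -
  let ?c = "chart_at A x" and ?d = "chart_at B (f x)"
  have c: "is_chart ?c" "x \<in> fst ?c" using chart_at[OF assms(1)] assms(1) by (auto simp: chart_cover_def)
  have "((snd ?d \<circ> g \<circ> chart_inv ?c) has_derivative tangent_map A B f x) (at (snd ?c x))"
    by (rule has_derivative_transform_within_open[OF tangent_map_has_derivative[OF assms(1-3)] open_chart_image[OF c(1) assms(4)]])
      (use assms(5,6) c chart_inv_left[OF c(1)] in auto)
  from frechet_derivativeI[OF this] show ?thesis using assms(5,6) by (simp add: tangent_map_def)
qed

lemma tangent_map_compose:
  assumes A: "chart_cover A" and B: "chart_cover B" and C: "chart_cover C"
    and f: "smooth_at A B f x" and g: "smooth_at B C g (f x)"
  shows "tangent_map A C (\<lambda>x. g (f x)) x v = tangent_map B C g (f x) (tangent_map A B f x v)"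
proof -
  let ?c = "chart_at A x" and ?d = "chart_at B (f x)" and ?e = "chart_at C (g (f x))"
  have c: "is_chart ?c" "x \<in> fst ?c" using chart_at[OF A] A by (auto simp: chart_cover_def)
  have d: "is_chart ?d" "f x \<in> fst ?d" using chart_at[OF B] B by (auto simp: chart_cover_def)
  obtain W where W: "open W" "x \<in> W" "continuous_on W f" using smooth_at_nbhd[OF f] by metis
  let ?W = "W \<inter> f -` fst ?d"
  have oW: "open ?W" using continuous_open_preimage[OF W(3,1) is_chart_open(1)[OF d(1)]] .
  have fx: "(snd ?d \<circ> f \<circ> chart_inv ?c) (snd ?c x) = snd ?d (f x)" by (simp add: chart_inv_left[OF c])
  have "((\<lambda>y. (snd ?e \<circ> g \<circ> chart_inv ?d) ((snd ?d \<circ> f \<circ> chart_inv ?c) y)) has_derivative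
      (\<lambda>v. tangent_map B C g (f x) (tangent_map A B f x v))) (at (snd ?c x))"
    by (rule has_derivative_compose[OF tangent_map_has_derivative[OF A B f]])
      (unfold fx, rule tangent_map_has_derivative[OF B C g])
  then have "((snd ?e \<circ> (\<lambda>x. g (f x)) \<circ> chart_inv ?c) has_derivative
      (\<lambda>v. tangent_map B C g (f x) (tangent_map A B f x v))) (at (snd ?c x))"
    by (rule has_derivative_transform_within_open[OF _ open_chart_image[OF c(1) oW]])
      (use W c d in \<open>auto simp: chart_inv_left[OF c(1)] chart_inv_left[OF d(1)]\<close>)
  from frechet_derivativeI[OF this] show ?thesis by (simp add: tangent_map_def[of A C])
qed

lemma tangent_map_ident:
  assumes "chart_cover A" shows "tangent_map A A (\<lambda>x. x) x = (\<lambda>v. v)"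
proof -
  let ?c = "chart_at A x"
  have c: "is_chart ?c" "x \<in> fst ?c" using chart_at[OF assms] assms by (auto simp: chart_cover_def)
  have "((snd ?c \<circ> (\<lambda>x. x) \<circ> chart_inv ?c) has_derivative (\<lambda>v. v)) (at (snd ?c x))"
    by (rule has_derivative_transform_within_open[OF has_derivative_ident is_chart_open(2)[OF c(1)]])
      (use c chart_inv_left[OF c(1)] in auto)
  from frechet_derivativeI[OF this] show ?thesis by (simp add: tangent_map_def)
qed

lemma tangent_map_const: "tangent_map A B (\<lambda>x. b) x v = 0"
  by (simp add: tangent_map_def o_def)

lemma tangent_map_std: "tangent_map std_atlas std_atlas f x = frechet_derivative f (at x)"
  by (simp add: tangent_map_def o_def)

text \<open>Passing to the coordinates of a chart is itself a tangent map, that of the chart as a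
  map into Euclidean space; every change of coordinates thus becomes an instance of the chain
  rule.\<close>

lemma in_chart_eq: "in_chart A c x = tangent_map A std_atlas (snd c) x"
  by (simp add: tangent_map_def in_chart_def o_def)

lemma of_chart_eq: "is_chart c \<Longrightarrow> x \<in> fst c \<Longrightarrow> of_chart A c x = tangent_map std_atlas A (chart_inv c) (snd c x)"
  by (simp add: tangent_map_def of_chart_def o_def chart_inv_left)

lemma of_chart_in_chart:
  assumes "chart_cover A" "max_chart A c" "x \<in> fst c" "smooth_atlas A"
  shows "of_chart A c x (in_chart A c x v) = v"
proof -
  have c: "is_chart c" by (rule max_chart_is_chart[OF assms(2)])
  have y: "snd c x \<in> snd c ` fst c" using assms(3) by blast
  have "tangent_map A A (\<lambda>y. chart_inv c (snd c y)) x v = of_chart A c x (in_chart A c x v)"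
    using tangent_map_compose[OF assms(1) chart_cover_std assms(1) smooth_at_chart[OF assms(2,3)] smooth_at_chart_inv[OF assms(2) y], of v]
    by (simp add: in_chart_eq of_chart_eq[OF c assms(3)])
  moreover have "tangent_map A A (\<lambda>y. chart_inv c (snd c y)) x = tangent_map A A (\<lambda>y. y) x"
    by (rule tangent_map_cong[OF assms(1,1) smooth_at_ident[OF assms(4)] is_chart_open(1)[OF c] assms(3)])
      (simp add: chart_inv_left[OF c])
  ultimately show ?thesis by (simp add: tangent_map_ident[OF assms(1)])
qed

lemma linear_of_chart:
  "chart_cover A \<Longrightarrow> max_chart A c \<Longrightarrow> x \<in> fst c \<Longrightarrow> linear (of_chart A c x)"
  by (simp add: of_chart_eq[OF max_chart_is_chart]) 
    (intro linear_tangent_map chart_cover_std smooth_at_chart_inv, auto)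

text \<open>The bridge from preferred charts to arbitrary charts of the maximal atlas: the chain
  rule applied to inverse chart, map and chart.\<close>

lemma in_chart_tangent_map:
  assumes "chart_cover A" "chart_cover B" "smooth_at A B f x" "max_chart A c" "max_chart B d" "x \<in> fst c" "f x \<in> fst d"
  shows "smooth_at std_atlas std_atlas (\<lambda>y. snd d (f (chart_inv c y))) (snd c x)"
    and "in_chart B d (f x) (tangent_map A B f x (of_chart A c x v)) =
      frechet_derivative (\<lambda>y. snd d (f (chart_inv c y))) (at (snd c x)) v"
proof -
  have c: "is_chart c" by (rule max_chart_is_chart[OF assms(4)])
  have y: "snd c x \<in> snd c ` fst c" using assms(6) by blast
  have inv: "chart_inv c (snd c x) = x" by (rule chart_inv_left[OF c assms(6)])
  have s1: "smooth_at std_atlas A (chart_inv c) (snd c x)" by (rule smooth_at_chart_inv[OF assms(4) y])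
  have s3: "smooth_at B std_atlas (snd d) (f x)" by (rule smooth_at_chart[OF assms(5,7)])
  have s2: "smooth_at A std_atlas (\<lambda>x. snd d (f x)) x"
    by (rule smooth_at_compose[OF assms(1,2) chart_cover_std assms(3) s3])
  show "smooth_at std_atlas std_atlas (\<lambda>y. snd d (f (chart_inv c y))) (snd c x)"
    by (rule smooth_at_compose[OF chart_cover_std assms(1) chart_cover_std s1]) (simp add: inv s2)
  have "tangent_map std_atlas std_atlas (\<lambda>y. snd d (f (chart_inv c y))) (snd c x) v =
      tangent_map A std_atlas (\<lambda>x. snd d (f x)) x (of_chart A c x v)"
    using tangent_map_compose[OF chart_cover_std assms(1) chart_cover_std s1, of "\<lambda>x. snd d (f x)" v] s2
    by (simp add: inv of_chart_eq[OF c assms(6)])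
  also have "\<dots> = in_chart B d (f x) (tangent_map A B f x (of_chart A c x v))"
    using tangent_map_compose[OF assms(1,2) chart_cover_std assms(3) s3] by (simp add: in_chart_eq)
  finally show "in_chart B d (f x) (tangent_map A B f x (of_chart A c x v)) =
      frechet_derivative (\<lambda>y. snd d (f (chart_inv c y))) (at (snd c x)) v"
    by (simp add: tangent_map_std)
qed

text \<open>The preferred chart of a product is some product chart whose factors need not be the
  preferred charts of the factors; \<open>in_chart\<close> accounts for the difference.\<close>

lemma tangent_map_Pair:
  assumes A: "chart_cover A" and B: "smooth_atlas B" and C: "smooth_atlas C"
    and f: "smooth_at A B f x" and g: "smooth_at A C g x"
    and de: "chart_at (prod_atlas B C) (f x, g x) = (fst d \<times> fst e, map_prod (snd d) (snd e))" "d \<in> B" "e \<in> C"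
  shows "tangent_map A (prod_atlas B C) (\<lambda>x. (f x, g x)) x v =
    (in_chart B d (f x) (tangent_map A B f x v), in_chart C e (g x) (tangent_map A C g x v))"
proof -
  let ?c = "chart_at A x"
  have cov: "chart_cover B" "chart_cover C" using B C smooth_atlas_cover by auto
  have dom: "f x \<in> fst d" "g x \<in> fst e" using chart_at[OF chart_cover_prod[OF cov], of "(f x, g x)"] by (auto simp: de)
  have "smooth_at A std_atlas (\<lambda>x. snd d (f x)) x" "smooth_at A std_atlas (\<lambda>x. snd e (g x)) x"
    using smooth_at_compose[OF A cov(1) chart_cover_std f smooth_at_chart[OF smooth_atlas_max_chart[OF B de(2)] dom(1)]]
      smooth_at_compose[OF A cov(2) chart_cover_std g smooth_at_chart[OF smooth_atlas_max_chart[OF C de(3)] dom(2)]] by auto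
  from this[THEN tangent_map_has_derivative[OF A chart_cover_std]]
  have "((\<lambda>y. (snd d (f (chart_inv ?c y)), snd e (g (chart_inv ?c y)))) has_derivative
     (\<lambda>v. (tangent_map A std_atlas (\<lambda>x. snd d (f x)) x v, tangent_map A std_atlas (\<lambda>x. snd e (g x)) x v))) (at (snd ?c x))"
    by (intro has_derivative_Pair) (simp_all add: o_def)
  then have "tangent_map A (prod_atlas B C) (\<lambda>x. (f x, g x)) x v =
      (tangent_map A std_atlas (\<lambda>x. snd d (f x)) x v, tangent_map A std_atlas (\<lambda>x. snd e (g x)) x v)"
    by (simp add: tangent_map_def[of A "prod_atlas B C"] de o_def frechet_derivativeI)
  then show ?thesis
    using tangent_map_compose[OF A cov(1) chart_cover_std f smooth_at_chart[OF smooth_atlas_max_chart[OF B de(2)] dom(1)]]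
      tangent_map_compose[OF A cov(2) chart_cover_std g smooth_at_chart[OF smooth_atlas_max_chart[OF C de(3)] dom(2)]]
    by (simp add: in_chart_eq)
qed

text \<open>Both sides are read in the preferred chart at the common image point, so first-order
  data of a pair depend only on those of its components, whichever chart that is.\<close>

lemma tangent_map_Pair_eq:
  assumes A: "chart_cover A" "chart_cover A'" and B: "smooth_atlas B" and C: "smooth_atlas C"
    and f: "smooth_at A B f x" and g: "smooth_at A C g x"
    and f': "smooth_at A' B f' x'" and g': "smooth_at A' C g' x'" and eq: "f x = f' x'" "g x = g' x'"
    and T: "tangent_map A B f x v = tangent_map A' B f' x' v'" "tangent_map A C g x v = tangent_map A' C g' x' v'"
  shows "tangent_map A (prod_atlas B C) (\<lambda>x. (f x, g x)) x v =
    tangent_map A' (prod_atlas B C) (\<lambda>x. (f' x, g' x)) x' v'"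
proof -
  have "chart_at (prod_atlas B C) (f x, g x) \<in> prod_atlas B C"
    using chart_at[OF chart_cover_prod[OF smooth_atlas_cover[OF B] smooth_atlas_cover[OF C]]] by blast
  then obtain d e where "chart_at (prod_atlas B C) (f x, g x) = (fst d \<times> fst e, map_prod (snd d) (snd e))" "d \<in> B" "e \<in> C"
    unfolding prod_atlas_def by blast
  then show ?thesis
    using tangent_map_Pair[OF A(1) B C f g, of d e v] tangent_map_Pair[OF A(2) B C f' g', of d e v'] eq T by simp
qed

section \<open>Submanifolds\<close>

text \<open>Near \<open>x\<close> the map equals its composition with a projection onto
  \<open>V\<close>, and derivatives are unique.\<close>

lemma has_derivative_in_subspace:
  assumes "(f has_derivative f') (at x)" "open S" "x \<in> S" "\<And>y. y \<in> S \<Longrightarrow> f y \<in> V" "subspace (V :: 'b::euclidean_space set)"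
  shows "f' v \<in> V"
proof -
  obtain P where P: "linear P" "\<And>x. P x \<in> V" "\<And>x. x \<in> V \<Longrightarrow> P x = x" using subspace_projection[OF assms(5)] by blast
  have "((\<lambda>y. P (f y)) has_derivative (\<lambda>v. P (f' v))) (at x)"
    using bounded_linear.has_derivative[OF _ assms(1)] P(1) by (auto simp: linear_conv_bounded_linear)
  then have "(f has_derivative (\<lambda>v. P (f' v))) (at x)"
    by (rule has_derivative_transform_within_open[OF _ assms(2,3)]) (use P(3) assms(4) in auto)
  from has_derivative_unique[OF this assms(1)] show ?thesis using P(2) by metis
qed

lemma smooth_at_std_has_derivative:
  "smooth_at std_atlas std_atlas f x \<Longrightarrow> (f has_derivative frechet_derivative f (at x)) (at x)"
  unfolding smooth_at_std_iff using smooth_on_has_derivative by blast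

lemma adapted_chartD:
  assumes "adapted_chart A N x c V"
  shows "max_chart A c" "x \<in> fst c" "subspace V" "\<And>y. y \<in> fst c \<Longrightarrow> y \<in> N \<longleftrightarrow> snd c y \<in> V"
proof -
  show c: "max_chart A c" "x \<in> fst c" "subspace V" using assms by (auto simp: adapted_chart_def max_chart_def)
  have im: "snd c ` (fst c \<inter> N) = snd c ` fst c \<inter> V" using assms by (simp add: adapted_chart_def)
  show "y \<in> N \<longleftrightarrow> snd c y \<in> V" if "y \<in> fst c" for y
  proof
    assume "y \<in> N"
    then have "snd c y \<in> snd c ` (fst c \<inter> N)" using that by blast
    then show "snd c y \<in> V" unfolding im by blast
  next
    assume "snd c y \<in> V"
    then have "snd c y \<in> snd c ` (fst c \<inter> N)" using that unfolding im by blast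
    then obtain z where "z \<in> fst c" "z \<in> N" "snd c y = snd c z" by auto
    then show "y \<in> N" using chart_inv_left[OF max_chart_is_chart[OF c(1)]] that by metis
  qed
qed

text \<open>The transition map sends only points of \<open>V\<close> into \<open>V'\<close>.
  Precomposed with a projection onto \<open>V\<close> it takes values in \<open>V'\<close> on an
  open set, so \<open>has_derivative_in_subspace\<close> applies.\<close>

lemma adapted_chart_tangent_subset:
  assumes A: "smooth_atlas A" and c: "adapted_chart A N x c V" and d: "adapted_chart A N x d V'"
    and x: "x \<in> N" and v: "in_chart A c x v \<in> V"
  shows "in_chart A d x v \<in> V'"
proof -
  note c = adapted_chartD[OF c] and d = adapted_chartD[OF d]
  have cov: "chart_cover A" by (rule smooth_atlas_cover[OF A])
  obtain P where P: "linear P" "\<And>x. P x \<in> V" "\<And>x. x \<in> V \<Longrightarrow> P x = x" using subspace_projection[OF c(3)] by blast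
  have ic: "is_chart c" "is_chart d" using max_chart_is_chart[OF c(1)] max_chart_is_chart[OF d(1)] by simp_all
  let ?t = "\<lambda>y. snd d (chart_inv c y)" and ?y = "snd c x"
  let ?O = "snd c ` (fst d \<inter> fst c)"
  have oO: "open ?O" by (rule open_chart_image[OF ic(1) is_chart_open(1)[OF ic(2)]])
  have y: "?y \<in> V" "P ?y = ?y" "?y \<in> ?O" using x c(2,4) d(2) P(3) by auto
  have bl: "bounded_linear P" using P(1) by (simp add: linear_conv_bounded_linear)
  have contP: "continuous_on UNIV P" using bl by (rule linear_continuous_on)
  have t: "(?t has_derivative frechet_derivative ?t (at ?y)) (at ?y)"
    using in_chart_tangent_map(1)[OF cov cov smooth_at_ident[OF A] c(1) d(1) c(2) d(2)]
    by (rule smooth_at_std_has_derivative)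
  then have "((\<lambda>z. ?t (P z)) has_derivative (\<lambda>v. frechet_derivative ?t (at ?y) (P v))) (at ?y)"
    by (intro has_derivative_compose[OF bounded_linear.has_derivative[OF bl has_derivative_ident]]) (simp add: y)
  then have "frechet_derivative ?t (at ?y) (P (in_chart A c x v)) \<in> V'"
  proof (rule has_derivative_in_subspace[OF _ _ _ _ d(3)])
    show "open (P -` ?O)" by (rule open_vimage[OF oO contP])
    show "?y \<in> P -` ?O" using y by simp
    fix z assume z: "z \<in> P -` ?O"
    then have "snd c (chart_inv c (P z)) = P z" "chart_inv c (P z) \<in> fst c \<inter> fst d"
      using chart_inv_left[OF ic(1)] by auto
    then have "chart_inv c (P z) \<in> N" using c(4)[of "chart_inv c (P z)"] P(2)[of z] by auto
    then show "?t (P z) \<in> V'" using d(4) \<open>chart_inv c (P z) \<in> fst c \<inter> fst d\<close> by blast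
  qed
  moreover have "frechet_derivative ?t (at ?y) (in_chart A c x v) = in_chart A d x v"
    using in_chart_tangent_map(2)[OF cov cov smooth_at_ident[OF A] c(1) d(1) c(2) d(2), of "in_chart A c x v"]
    by (simp add: tangent_map_ident[OF cov] of_chart_in_chart[OF cov c(1,2) A])
  ultimately show ?thesis using v P(3) by simp
qed

lemma submanifold_tangent_eq:
  assumes "smooth_atlas A" "adapted_chart A N x c V" "x \<in> N"
  shows "submanifold_tangent A N x = {v. in_chart A c x v \<in> V}"
  using adapted_chart_tangent_subset[OF assms(1) _ assms(2,3)] assms(2) unfolding submanifold_tangent_def by blast

section \<open>One-forms\<close>

lemma form_rep_apply:
  assumes "smooth_atlas A" "c \<in> A" "x \<in> fst c"
  shows "form_rep A c \<omega> (snd c x) (in_chart A c x v) = \<omega> x v"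
  using of_chart_in_chart[OF smooth_atlas_cover[OF assms(1)] smooth_atlas_max_chart[OF assms(1,2)] assms(3,1)]
    chart_inv_left[OF max_chart_is_chart[OF smooth_atlas_max_chart[OF assms(1,2)]] assms(3)]
  by (simp add: form_rep_def)

lemma linear_form_rep:
  assumes "smooth_atlas A" "c \<in> A" "smooth_one_form A \<omega>" "y \<in> snd c ` fst c"
  shows "linear (form_rep A c \<omega> y)"
proof -
  have c: "max_chart A c" by (rule smooth_atlas_max_chart[OF assms(1,2)])
  have "linear (of_chart A c (chart_inv c y))"
    by (rule linear_of_chart[OF smooth_atlas_cover[OF assms(1)] c chart_inv_in[OF max_chart_is_chart[OF c] assms(4)]])
  moreover have "linear (\<omega> (chart_inv c y))" using assms(3) by (simp add: smooth_one_form_def)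
  ultimately show ?thesis unfolding form_rep_def by (rule linear_compose[unfolded o_def])
qed

lemma smooth_form_rep:
  "c \<in> A \<Longrightarrow> smooth_one_form A \<omega> \<Longrightarrow> smooth_on (snd c ` fst c) (\<lambda>y. form_rep A c \<omega> y w)"
  by (simp add: smooth_one_form_def)

lemma form_rep_pullback:
  assumes A: "smooth_atlas A" and B: "smooth_atlas B" and f: "smooth_at B A f x"
    and c: "c \<in> A" "f x \<in> fst c" and d: "d \<in> B" "x \<in> fst d"
  shows "form_rep A c \<omega> (snd c (f x)) (frechet_derivative (\<lambda>y. snd c (f (chart_inv d y))) (at (snd d x)) w) =
    \<omega> (f x) (tangent_map B A f x (of_chart B d x w))"
  unfolding in_chart_tangent_map(2)[OF smooth_atlas_cover[OF B] smooth_atlas_cover[OF A] f smooth_atlas_max_chart[OF B d(1)]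
      smooth_atlas_max_chart[OF A c(1)] d(2) c(2), symmetric]
  by (rule form_rep_apply[OF A c])

lemma ext_deriv_eq: "ext_deriv A \<omega> x v w = form_deriv (form_rep A (chart_at A x) \<omega>) (snd (chart_at A x) x) v w"
  by (simp add: ext_deriv_def form_deriv_def Let_def)

text \<open>In the chart \<open>d\<close> the pulled back form is the coordinate pullback of the
  form written in the preferred chart at \<open>f x\<close>, so \<open>form_deriv_pullback\<close>
  gives naturality. The chart \<open>d\<close> is left free so that a single one can serve at all
  nearby points.\<close>

lemma ext_deriv_pullback:
  fixes f :: "'n::{t2_space, second_countable_topology} \<Rightarrow> 'm::{t2_space, second_countable_topology}"
    and A :: "('m, 'a::euclidean_space) chart set" and B :: "('n, 'b::euclidean_space) chart set"
    and \<omega> :: "'m \<Rightarrow> 'a \<Rightarrow> 'g::euclidean_space"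
  assumes A: "smooth_atlas A" and B: "smooth_atlas B" and f: "smooth_at B A f x"
    and d: "d \<in> B" "x \<in> fst d" and \<omega>: "smooth_one_form A \<omega>"
  obtains S where "open S" "snd d x \<in> S" "S \<subseteq> snd d ` fst d" "\<And>y. y \<in> S \<Longrightarrow> smooth_at B A f (chart_inv d y)"
    "\<And>w. smooth_on S (\<lambda>y. \<omega> (f (chart_inv d y)) (tangent_map B A f (chart_inv d y) (of_chart B d (chart_inv d y) w)))"
    "\<And>v w. form_deriv (\<lambda>y w. \<omega> (f (chart_inv d y)) (tangent_map B A f (chart_inv d y) (of_chart B d (chart_inv d y) w))) (snd d x) v w =
       ext_deriv A \<omega> (f x) (tangent_map B A f x (of_chart B d x v)) (tangent_map B A f x (of_chart B d x w))"
proof -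
  let ?c = "chart_at A (f x)"
  have covA: "chart_cover A" and covB: "chart_cover B" using A B smooth_atlas_cover by auto
  have c: "?c \<in> A" "f x \<in> fst ?c" using chart_at[OF covA] by auto
  have ic: "is_chart ?c" "is_chart d" using chart_cover_is_chart[OF covA c(1)] chart_cover_is_chart[OF covB d(1)] by simp_all
  obtain S where S: "open S" "snd d x \<in> S" "S \<subseteq> snd d ` fst d" "\<And>y. y \<in> S \<Longrightarrow> f (chart_inv d y) \<in> fst ?c"
    "\<And>y. y \<in> S \<Longrightarrow> smooth_at B A f (chart_inv d y)" and sm: "smooth_on S (snd ?c \<circ> f \<circ> chart_inv d)"
    using smooth_at_chartsE[OF covB covA f d(1) c(1) d(2) c(2)] by metis
  define F where "F y = snd ?c (f (chart_inv d y))" for y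
  have F: "smooth_on S F" using sm by (simp add: F_def[abs_def] o_def)
  define \<Theta> where "\<Theta> y w = \<omega> (f (chart_inv d y)) (tangent_map B A f (chart_inv d y) (of_chart B d (chart_inv d y) w))" for y w
  have eq: "form_rep A ?c \<omega> (F y) (frechet_derivative F (at y) w) = \<Theta> y w" if y: "y \<in> S" for y w
  proof -
    have "chart_inv d y \<in> fst d" "snd d (chart_inv d y) = y"
      using y S(3) ic(2) chart_inv_in chart_inv_right by blast+
    then show ?thesis
      using form_rep_pullback[OF A B S(5)[OF y] c(1) S(4)[OF y] d(1), of \<omega> w] by (simp add: F_def[abs_def] \<Theta>_def)
  qed
  have Fim: "F y \<in> snd ?c ` fst ?c" if "y \<in> S" for y using S(4)[OF that] by (simp add: F_def)
  have lin: "linear (form_rep A ?c \<omega> y)" if "y \<in> snd ?c ` fst ?c" for y by (rule linear_form_rep[OF A c(1) \<omega> that])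
  have smr: "smooth_on (snd ?c ` fst ?c) (\<lambda>y. form_rep A ?c \<omega> y w)" for w by (rule smooth_form_rep[OF c(1) \<omega>])
  have smF: "smooth_on S (\<lambda>y. form_rep A ?c \<omega> (F y) (frechet_derivative F (at y) w))" for w
    using smooth_on_apply[of S "\<lambda>y. form_rep A ?c \<omega> (F y)" "\<lambda>y. frechet_derivative F (at y) w", OF S(1) lin[OF Fim]
        smooth_on_compose[OF S(1) is_chart_open(2)[OF ic(1)] Fim F smr] smooth_on_derivative[OF F]] .
  show thesis
  proof (rule that[OF S(1,2,3,5)], unfold \<Theta>_def[symmetric])
    show sm\<Theta>: "smooth_on S (\<lambda>y. \<Theta> y w)" for w by (rule smooth_on_eq[OF smF S(1) eq])
    fix v w
    have "form_deriv \<Theta> (snd d x) v w = form_deriv (\<lambda>y w. form_rep A ?c \<omega> (F y) (frechet_derivative F (at y) w)) (snd d x) v w"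
      using smooth_on_has_derivative[OF sm\<Theta> S(2)] eq
      by (intro form_deriv_cong[OF S(1,2)]) (auto simp: differentiable_def)
    also have "\<dots> = form_deriv (form_rep A ?c \<omega>) (F (snd d x)) (frechet_derivative F (at (snd d x)) v) (frechet_derivative F (at (snd d x)) w)"
      by (rule form_deriv_pullback[OF S(1) F Fim lin smr S(2)])
    also have "F (snd d x) = snd ?c (f x)" by (simp add: F_def chart_inv_left[OF ic(2) d(2)])
    also have "frechet_derivative F (at (snd d x)) = (\<lambda>v. tangent_map B A f x (of_chart B d x v))"
    proof
      fix v
      have "in_chart A ?c (f x) u = u" for u
        using tangent_map_ident[OF covA, of "f x"] by (simp add: in_chart_def tangent_map_def o_def)
      then show "frechet_derivative F (at (snd d x)) v = tangent_map B A f x (of_chart B d x v)"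
        using in_chart_tangent_map(2)[OF covB covA f smooth_atlas_max_chart[OF B d(1)] smooth_atlas_max_chart[OF A c(1)] d(2) c(2), of v]
        by (simp add: F_def[abs_def])
    qed
    finally show "form_deriv \<Theta> (snd d x) v w = ext_deriv A \<omega> (f x) (tangent_map B A f x (of_chart B d x v)) (tangent_map B A f x (of_chart B d x w))"
      by (simp add: ext_deriv_eq)
  qed
qed

text \<open>Naturality identifies the left side with the exterior derivative of the zero form. The
  intended \<rho> is a retraction whose tangent map fixes the vectors of interest.\<close>

lemma ext_deriv_zero_if_pullback_zero:
  fixes \<rho> :: "'m::{t2_space, second_countable_topology} \<Rightarrow> 'm" and A :: "('m, 'a::euclidean_space) chart set"
    and \<omega> :: "'m \<Rightarrow> 'a \<Rightarrow> 'g::euclidean_space"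
  assumes A: "smooth_atlas A" and \<omega>: "smooth_one_form A \<omega>" and \<rho>: "smooth_at A A \<rho> x" and W: "open W" "x \<in> W"
    and zero: "\<And>y v. y \<in> W \<Longrightarrow> \<omega> (\<rho> y) (tangent_map A A \<rho> y v) = 0"
  shows "ext_deriv A \<omega> (\<rho> x) (tangent_map A A \<rho> x v) (tangent_map A A \<rho> x w) = 0"
proof -
  let ?d = "chart_at A x"
  have cov: "chart_cover A" using A smooth_atlas_cover by auto
  have d: "?d \<in> A" "x \<in> fst ?d" using chart_at[OF cov] by auto
  have id: "is_chart ?d" by (rule chart_cover_is_chart[OF cov d(1)])
  have of_chart: "of_chart A ?d x u = u" for u
    using tangent_map_ident[OF cov, of x] by (simp add: of_chart_def tangent_map_def o_def)
  let ?\<Theta> = "\<lambda>y w. \<omega> (\<rho> (chart_inv ?d y)) (tangent_map A A \<rho> (chart_inv ?d y) (of_chart A ?d (chart_inv ?d y) w))"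
  obtain S where S: "open S" "snd ?d x \<in> S" "S \<subseteq> snd ?d ` fst ?d" and sm: "\<And>w. smooth_on S (\<lambda>y. ?\<Theta> y w)"
    and eq: "form_deriv ?\<Theta> (snd ?d x) v w =
       ext_deriv A \<omega> (\<rho> x) (tangent_map A A \<rho> x (of_chart A ?d x v)) (tangent_map A A \<rho> x (of_chart A ?d x w))"
    by (rule ext_deriv_pullback[OF A A \<rho> d \<omega>]) (rule that)
  let ?O = "S \<inter> snd ?d ` (W \<inter> fst ?d)"
  have "form_deriv ?\<Theta> (snd ?d x) v w = form_deriv (\<lambda>y w. 0) (snd ?d x) v w"
  proof (rule form_deriv_cong)
    show "open ?O" by (intro open_Int S open_chart_image[OF id W(1)])
    show "snd ?d x \<in> ?O" using S(2) W(2) d(2) by blast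
    show "?\<Theta> y u = 0" if "y \<in> ?O" for y u using that zero chart_inv_left[OF id] by auto
    show "(\<lambda>y. ?\<Theta> y u) differentiable at (snd ?d x)" for u
      using smooth_on_has_derivative[OF sm S(2)] by (auto simp: differentiable_def)
  qed
  then show ?thesis using eq by (simp add: form_deriv_def of_chart)
qed

lemma smooth_one_form_linear:
  assumes "smooth_atlas A" "smooth_one_form A \<omega>" "linear L"
  shows "smooth_one_form A (\<lambda>x v. L (\<omega> x v))"
  unfolding smooth_one_form_def
proof (intro conjI allI ballI)
  show "linear (\<lambda>v. L (\<omega> x v))" for x
    using linear_compose[OF _ assms(3), of "\<omega> x"] assms(2) by (simp add: smooth_one_form_def o_def)
  fix c w assume c: "c \<in> A"
  have "smooth_on (snd c ` fst c) (\<lambda>y. L (form_rep A c \<omega> y w))"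
    by (rule smooth_on_linear[OF is_chart_open(2)[OF chart_cover_is_chart[OF smooth_atlas_cover[OF assms(1)] c]]
          assms(3) smooth_form_rep[OF c assms(2)]])
  then show "smooth_on (snd c ` fst c) (\<lambda>y. form_rep A c (\<lambda>x v. L (\<omega> x v)) y w)" by (simp add: form_rep_def)
qed

lemma ext_deriv_linear:
  assumes "smooth_atlas A" "smooth_one_form A \<omega>" "linear L"
  shows "ext_deriv A (\<lambda>x v. L (\<omega> x v)) x v w = L (ext_deriv A \<omega> x v w)"
proof -
  let ?c = "chart_at A x"
  have c: "?c \<in> A" "x \<in> fst ?c" using chart_at[OF smooth_atlas_cover[OF assms(1)]] by auto
  have bl: "bounded_linear L" using assms(3) by (simp add: linear_conv_bounded_linear)
  have "frechet_derivative (\<lambda>y. L (form_rep A ?c \<omega> y u)) (at (snd ?c x)) =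
      (\<lambda>h. L (frechet_derivative (\<lambda>y. form_rep A ?c \<omega> y u) (at (snd ?c x)) h))" for u
    using c(2) by (intro frechet_derivativeI bounded_linear.has_derivative[OF bl]
        smooth_on_has_derivative[OF smooth_form_rep[OF c(1) assms(2)]]) simp
  then show ?thesis
    by (simp add: ext_deriv_def Let_def form_rep_def linear_diff[OF assms(3)])
qed

section \<open>Parabolic subalgebras\<close>

lemma sc_subspace_imp_subspace:
  fixes br :: "'g::euclidean_space \<Rightarrow> 'g \<Rightarrow> 'g"
  assumes "lie_algebra sc br" "module.subspace sc V"
  shows "subspace V"
proof -
  interpret vector_space sc using assms(1) by (simp add: lie_algebra_def)
  have "sc (of_real t) x = t *\<^sub>R x" for t x using assms(1) by (simp add: lie_algebra_def)
  then show ?thesis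
    using subspace_0[OF assms(2)] subspace_add[OF assms(2)] subspace_scale[OF assms(2)]
    by (metis Real_Vector_Spaces.real_vector.subspace_def)
qed

lemma subspace_filtration:
  fixes br :: "'g::euclidean_space \<Rightarrow> 'g \<Rightarrow> 'g"
  assumes "lie_algebra sc br" shows "subspace (filtration sc gr i)"
proof -
  interpret vector_space sc using assms by (simp add: lie_algebra_def)
  show ?thesis
    using sc_subspace_imp_subspace[OF assms] subspace_span by (simp add: filtration_def)
qed

context
  fixes sc :: "'k::real_normed_field \<Rightarrow> 'g::euclidean_space \<Rightarrow> 'g" and br :: "'g \<Rightarrow> 'g \<Rightarrow> 'g" and m gr
  assumes lie: "lie_algebra sc br" and grading: "parabolic_grading sc br m gr"
begin

interpretation S: vector_space sc using lie by (simp add: lie_algebra_def)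

lemma br_linear_right: "Vector_Spaces.linear sc sc (br x)"
  using lie by (simp add: lie_algebra_def)

lemma br_linear_left: "Vector_Spaces.linear sc sc (\<lambda>x. br x y)"
  using lie by (simp add: lie_algebra_def)

lemma br_self: "br x x = 0"
  using lie by (simp add: lie_algebra_def)

lemma br_add: "br (x + x') y = br x y + br x' y" "br y (x + x') = br y x + br y x'"
  using br_linear_left[of y] br_linear_right[of y] by (simp_all add: Vector_Spaces.linear_iff)

lemma br_scale: "br (sc a x) y = sc a (br x y)" "br y (sc a x) = sc a (br y x)"
  using br_linear_left[of y] br_linear_right[of y] by (simp_all add: Vector_Spaces.linear_iff)

lemma br_zero: "br 0 y = 0" "br y 0 = 0"
  using br_add(1)[of 0 0 y] br_add(2)[of y 0 0] by simp_all

lemma br_sum: "br (\<Sum>i\<in>I. f i) y = (\<Sum>i\<in>I. br (f i) y)" "br y (\<Sum>i\<in>I. f i) = (\<Sum>i\<in>I. br y (f i))"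
  by (induction I rule: infinite_finite_induct) (simp_all add: br_add br_zero)

lemma br_antisym: "br x y = - br y x"
  using br_self[of "x + y"] br_self[of x] br_self[of y] by (simp add: br_add eq_neg_iff_add_eq_0 add.commute)

lemma gr_subspace: "S.subspace (gr i)"
  using grading by (simp add: parabolic_grading_def)

lemma gr_outside: "\<bar>i\<bar> > int m \<Longrightarrow> gr i = {0}"
  using grading by (simp add: parabolic_grading_def)

lemma gr_bracket: "x \<in> gr i \<Longrightarrow> y \<in> gr j \<Longrightarrow> br x y \<in> gr (i + j)"
  using grading by (simp add: parabolic_grading_def)

section \<open>Homogeneous components of a graded Lie algebra\<close>

definition component :: "'g \<Rightarrow> int \<Rightarrow> 'g" where
  "component x = (THE f. (\<forall>i. f i \<in> gr i) \<and> x = (\<Sum>i = - int m..int m. f i))"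

lemma component_unique: "\<exists>!f. (\<forall>i. f i \<in> gr i) \<and> x = (\<Sum>i = - int m..int m. f i)"
  using grading by (simp add: parabolic_grading_def)

lemma component_in: "component x i \<in> gr i" and component_sum: "x = (\<Sum>i = - int m..int m. component x i)"
  using theI'[OF component_unique[of x]] by (auto simp: component_def)

lemma component_eq: "(\<And>i. f i \<in> gr i) \<Longrightarrow> x = (\<Sum>i = - int m..int m. f i) \<Longrightarrow> component x = f"
  unfolding component_def by (rule the1_equality[OF component_unique]) blast

lemma component_zero_outside: "\<bar>i\<bar> > int m \<Longrightarrow> component x i = 0"
  using component_in[of x i] gr_outside by blast

lemma component_add: "component (x + y) = (\<lambda>i. component x i + component y i)"
  by (rule component_eq) (auto intro: S.subspace_add gr_subspace component_in simp: sum.distrib simp flip: component_sum)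

lemma component_scale: "component (sc a x) = (\<lambda>i. sc a (component x i))"
  by (rule component_eq)
    (auto intro: S.subspace_scale gr_subspace component_in simp flip: S.scale_sum_right component_sum)

lemma component_zero: "component 0 = (\<lambda>i. 0)"
  by (rule component_eq) (auto intro: S.subspace_0 gr_subspace)

lemma component_homogeneous:
  assumes "x \<in> gr l" shows "component x = (\<lambda>i. if i = l then x else 0)"
proof (rule component_eq)
  show "(if i = l then x else 0) \<in> gr i" for i using assms S.subspace_0[OF gr_subspace] by auto
  show "x = (\<Sum>i = - int m..int m. if i = l then x else 0)"
    using gr_outside[of l] assms by (cases "\<bar>l\<bar> > int m") auto
qed

lemma filtration_component:
  assumes "x \<in> filtration sc gr j" "i < j" shows "component x i = 0"
proof -
  have "S.subspace {x. \<forall>i<j. component x i = 0}"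
    by (rule S.subspaceI) (auto simp: component_add component_scale component_zero)
  moreover have "(\<Union>l\<in>{j..}. gr l) \<subseteq> {x. \<forall>i<j. component x i = 0}"
    by (auto simp: component_homogeneous)
  ultimately have "filtration sc gr j \<subseteq> {x. \<forall>i<j. component x i = 0}"
    unfolding filtration_def by (intro S.span_minimal)
  then show ?thesis using assms by blast
qed

lemma filtration_bracket_zero:
  assumes "x \<in> filtration sc gr 0" "y \<in> filtration sc gr 0" shows "br x y \<in> filtration sc gr 0"
proof -
  let ?U = "\<Union>l\<in>{0..}. gr l"
  have base: "br x y \<in> S.span ?U" if "x \<in> ?U" "y \<in> ?U" for x y
    using that gr_bracket by (intro S.span_base) (fastforce intro: add_nonneg_nonneg)
  have "S.span ?U \<subseteq> {x. br x y \<in> S.span ?U}" if "y \<in> ?U" for y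
    using base that by (intro S.span_minimal S.subspaceI)
      (auto simp: br_zero br_add br_scale intro: S.span_zero S.span_add S.span_scale)
  then have 1: "br x y \<in> S.span ?U" if "x \<in> S.span ?U" "y \<in> ?U" for x y using that by blast
  have "S.span ?U \<subseteq> {y. br x y \<in> S.span ?U}" if "x \<in> S.span ?U" for x
    using 1 that by (intro S.span_minimal S.subspaceI)
      (auto simp: br_zero br_add br_scale intro: S.span_zero S.span_add S.span_scale)
  then show ?thesis using assms by (auto simp: filtration_def)
qed

lemma component_bracket:
  assumes "y \<in> gr j" shows "component (br x y) = (\<lambda>l. br (component x (l - j)) y)"
proof (rule component_eq)
  have mem: "br (component x (l - j)) y \<in> gr l" for l
    using gr_bracket[OF component_in assms, of x "l - j"] by simp
  then show "br (component x (l - j)) y \<in> gr l" for l .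
  \<comment> \<open>\<open>?B\<close> contains both the original and the shifted index range. The
    extra terms vanish, in one case because the component lies outside the grading, in the other
    because the bracket does.\<close>
  let ?g = "\<lambda>l. br (component x (l - j)) y" and ?B = "{- int m - \<bar>j\<bar>..int m + \<bar>j\<bar>}"
  have "br x y = (\<Sum>i = - int m..int m. br (component x i) y)"
    using component_sum[of x] br_sum(1) by metis
  also have "\<dots> = (\<Sum>l\<in>(\<lambda>i. i + j) ` {- int m..int m}. ?g l)"
    by (subst sum.reindex) (auto simp: inj_on_def)
  also have "\<dots> = (\<Sum>l\<in>?B. ?g l)"
  proof (rule sum.mono_neutral_left)
    show "\<forall>l\<in>?B - (\<lambda>i. i + j) ` {- int m..int m}. ?g l = 0"
    proof
      fix l assume "l \<in> ?B - (\<lambda>i. i + j) ` {- int m..int m}"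
      then have "l - j \<notin> {- int m..int m}" by (metis DiffD2 diff_add_cancel imageI)
      then have "\<bar>l - j\<bar> > int m" by auto
      then show "?g l = 0" by (simp add: component_zero_outside br_zero)
    qed
  qed auto
  also have "\<dots> = (\<Sum>l = - int m..int m. ?g l)"
  proof (rule sum.mono_neutral_right)
    show "\<forall>l\<in>?B - {- int m..int m}. ?g l = 0"
    proof
      fix l assume "l \<in> ?B - {- int m..int m}"
      then have "gr l = {0}" by (intro gr_outside) auto
      then show "?g l = 0" using mem[of l] by blast
    qed
  qed auto
  finally show "br x y = (\<Sum>l = - int m..int m. ?g l)" .
qed

lemma parabolic_self_normalizing:
  assumes semi: "semisimple sc br"
    and X: "\<And>j Y. Y \<in> filtration sc gr j \<Longrightarrow> br X Y \<in> filtration sc gr j"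
  shows "X \<in> filtration sc gr 0"
proof -
  \<comment> \<open>Components of \<open>X\<close> of negative degree are central.\<close>
  have zero: "component X k = 0" if "k < 0" for k
  proof -
    have "br (component X k) Y = 0" for Y
    proof -
      have *: "br (component X k) Y = 0" if Y: "Y \<in> gr j" for Y j
      proof -
        have "Y \<in> filtration sc gr j"
          unfolding filtration_def by (intro S.span_base) (use Y in auto)
        \<comment> \<open>\<open>Y\<close> lies in filtration degree \<open>j\<close>, hence so does
          the bracket with \<open>X\<close>; its component in the lower degree \<open>k + j\<close>
          is the bracket of \<open>component X k\<close> with \<open>Y\<close>.\<close>
        then have "component (br X Y) (k + j) = 0"
          by (intro filtration_component[OF X]) (use \<open>k < 0\<close> in auto)
        then show ?thesis by (simp add: component_bracket[OF Y])
      qed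
      have "br (component X k) Y = (\<Sum>i = - int m..int m. br (component X k) (component Y i))"
        using component_sum[of Y] br_sum(2) by metis
      also have "\<dots> = 0" using * component_in by (intro sum.neutral) blast
      finally show ?thesis .
    qed
    moreover
    \<comment> \<open>The centre is an abelian ideal, so its derived series vanishes after one step
      and semisimplicity makes it trivial.\<close>
    let ?Z = "{x. \<forall>y. br x y = 0}"
    have "S.subspace ?Z" by (rule S.subspaceI) (auto simp: br_zero br_add br_scale)
    moreover have "br x y \<in> ?Z" if "y \<in> ?Z" for x y using that br_antisym[of x y] br_zero(1) by simp
    ultimately have Z: "lie_ideal sc br ?Z" by (simp add: lie_ideal_def)
    have "{br x y |x y. x \<in> ?Z \<and> y \<in> ?Z} = {0}"
      by (auto simp: br_zero intro!: exI[of _ 0])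
    then have "derived_series sc br ?Z (Suc 0) = {0}" by (simp add: S.span_insert_0)
    then have "?Z = {0}" using semi Z unfolding semisimple_def by blast
    then show ?thesis using \<open>\<And>Y. br (component X k) Y = 0\<close> by blast
  qed
  have "component X i \<in> filtration sc gr 0" for i
  proof (cases "i < 0")
    case True
    then show ?thesis by (simp add: zero filtration_def S.span_zero)
  next
    case False
    then show ?thesis
      unfolding filtration_def by (intro S.span_base UN_I[of i]) (auto simp: component_in)
  qed
  then have "(\<Sum>i = - int m..int m. component X i) \<in> filtration sc gr 0"
    unfolding filtration_def by (intro S.span_sum)
  then show ?thesis using component_sum by metis
qed

end

section \<open>The adjoint representation\<close>

lemma prod_atlas_std: "prod_atlas std_atlas std_atlas = std_atlas"
  by (auto simp: prod_atlas_def std_atlas_def map_prod_def)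

context
  fixes GA :: "('h::{t2_space, second_countable_topology}, 'g::euclidean_space) chart set" and G :: "'h monoid" (structure)
  assumes lie: "lie_group GA G"
begin

interpretation G: group G using lie by (simp add: lie_group_def)

lemma lie_group_carrier: "x \<in> carrier G"
  using lie by (simp add: lie_group_def)

lemma lie_group_atlas: "smooth_atlas GA"
  using lie by (simp add: lie_group_def)

lemma lie_group_cover: "chart_cover GA"
  by (rule smooth_atlas_cover[OF lie_group_atlas])

lemma smooth_at_mult:
  assumes "chart_cover A" "smooth_at A GA f x" "smooth_at A GA g x"
  shows "smooth_at A GA (\<lambda>x. f x \<otimes> g x) x"
proof -
  have "smooth_at (prod_atlas GA GA) GA (\<lambda>(g, h). g \<otimes> h) (f x, g x)"
    using lie by (intro smooth_map_on_UNIV_smooth_at chart_cover_prod lie_group_cover) (simp add: lie_group_def)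
  from smooth_at_compose[OF assms(1) chart_cover_prod[OF lie_group_cover lie_group_cover] lie_group_cover
      smooth_at_Pair[OF assms(1) lie_group_cover lie_group_cover assms(2,3)] this]
  show ?thesis by simp
qed

lemma smooth_at_inv:
  assumes "chart_cover A" "smooth_at A GA f x"
  shows "smooth_at A GA (\<lambda>x. inv (f x)) x"
proof -
  have "smooth_at GA GA (\<lambda>g. inv g) (f x)"
    using lie by (intro smooth_map_on_UNIV_smooth_at lie_group_cover) (simp add: lie_group_def)
  from smooth_at_compose[OF assms(1) lie_group_cover lie_group_cover assms(2) this] show ?thesis .
qed

lemmas smooth_G = smooth_at_mult[OF lie_group_cover] smooth_at_inv[OF lie_group_cover]
  smooth_at_ident[OF lie_group_atlas] smooth_at_const[OF lie_group_cover]

lemma conj_one: "g \<otimes> \<one> \<otimes> inv g = \<one>"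
  using lie_group_carrier by simp

lemma linear_Ad: "linear (Ad GA G g)"
  unfolding Ad_def by (intro linear_tangent_map lie_group_cover smooth_G)

lemma Ad_mult: "Ad GA G (g \<otimes> h) v = Ad GA G g (Ad GA G h v)"
proof -
  have "(\<lambda>x. g \<otimes> h \<otimes> x \<otimes> inv (g \<otimes> h)) =
      (\<lambda>x. g \<otimes> (h \<otimes> x \<otimes> inv h) \<otimes> inv g)"
    using lie_group_carrier by (simp add: G.inv_mult_group G.m_assoc)
  moreover have "smooth_at GA GA (\<lambda>x. g \<otimes> x \<otimes> inv g) (h \<otimes> \<one> \<otimes> inv h)"
    by (intro smooth_G)
  moreover have "smooth_at GA GA (\<lambda>x. h \<otimes> x \<otimes> inv h) \<one>"
    by (intro smooth_G)
  ultimately show ?thesis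
    using tangent_map_compose[OF lie_group_cover lie_group_cover lie_group_cover, of "\<lambda>x. h \<otimes> x \<otimes> inv h" "\<one>"
        "\<lambda>x. g \<otimes> x \<otimes> inv g" v]
    by (simp add: Ad_def conj_one)
qed

lemma Ad_one: "Ad GA G \<one> v = v"
proof -
  have "(\<lambda>x. \<one> \<otimes> x \<otimes> inv \<one>) = (\<lambda>x. x)"
    using lie_group_carrier by simp
  then show ?thesis by (simp add: Ad_def tangent_map_ident[OF lie_group_cover])
qed

lemma Ad_inv: "Ad GA G (inv g) (Ad GA G g v) = v"
  using Ad_mult[of "inv g" g v] lie_group_carrier by (simp add: Ad_one)

text \<open>The definition only asks \<open>Ad\<close> to map each filtration piece into itself.
  Being linear and injective, it maps the finite-dimensional piece onto itself, which gives closure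
  under inverses.\<close>

lemma subgroup_parabolic_subgroup:
  assumes "lie_algebra sc br" shows "subgroup (parabolic_subgroup sc GA G gr) G"
proof (rule subgroup.intro)
  let ?Q = "parabolic_subgroup sc GA G gr"
  show "?Q \<subseteq> carrier G" by (auto simp: parabolic_subgroup_def)
  show "g \<otimes> h \<in> ?Q" if "g \<in> ?Q" "h \<in> ?Q" for g h
    using that lie_group_carrier by (auto simp: parabolic_subgroup_def Ad_mult image_subset_iff)
  show "\<one> \<in> ?Q" by (auto simp: parabolic_subgroup_def Ad_one)
  show "inv g \<in> ?Q" if "g \<in> ?Q" for g
  proof -
    have "Ad GA G (inv g) ` filtration sc gr i \<subseteq> filtration sc gr i" for i
    proof -
      let ?F = "filtration sc gr i"
      have F: "subspace ?F" by (rule subspace_filtration[OF assms])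
      have sub: "Ad GA G g ` ?F \<subseteq> ?F" using that by (auto simp: parabolic_subgroup_def)
      have "inj (Ad GA G g)" using Ad_inv by (metis injI)
      then have "dim (Ad GA G g ` ?F) = dim ?F"
        by (intro dim_image_eq linear_Ad) (auto intro: inj_on_subset)
      then have "Ad GA G g ` ?F = ?F"
        using subspace_dim_equal[OF linear_subspace_image[OF linear_Ad F] F sub] by simp
      then have "Ad GA G (inv g) ` ?F = Ad GA G (inv g) ` Ad GA G g ` ?F" by simp
      also have "\<dots> = ?F" by (simp add: image_image Ad_inv)
      finally show ?thesis by simp
    qed
    then show ?thesis using lie_group_carrier by (simp add: parabolic_subgroup_def)
  qed
qed

text \<open>The derivative of \<open>Ad GA G (\<gamma> t) Y\<close> at 0 is the bracket of the
  velocity with \<open>Y\<close>, and a curve in \<open>V\<close> has its derivative in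
  \<open>V\<close>. The work lies in matching this derivative with the bracket of left invariant
  fields, in the preferred chart at the unit.\<close>

lemma lie_bracket_if_Ad_invariant:
  fixes V :: "'g set"
  assumes \<gamma>: "smooth_at std_atlas GA \<gamma> 0" "\<gamma> 0 = \<one>" and V: "subspace V" "\<And>t. Ad GA G (\<gamma> t) Y \<in> V"
  shows "lie_bracket GA G (velocity GA \<gamma> 0) Y \<in> V"
proof -
  define e where "e = chart_at GA \<one>"
  define e0 where "e0 = snd e \<one>"
  define \<iota> where "\<iota> = chart_inv e"
  define U where "U = snd e ` fst e"
  have e: "e \<in> GA" "\<one> \<in> fst e" using chart_at[OF lie_group_cover] by (auto simp: e_def)
  have me: "max_chart GA e" by (rule smooth_atlas_max_chart[OF lie_group_atlas e(1)])
  have ie: "is_chart e" by (rule max_chart_is_chart[OF me])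
  have \<iota>0: "\<iota> e0 = \<one>" by (simp add: \<iota>_def e0_def chart_inv_left[OF ie e(2)])
  have U: "open U" "e0 \<in> U" using is_chart_open(2)[OF ie] e(2) by (auto simp: U_def e0_def)
  have \<iota>: "\<iota> x \<in> fst e" "snd e (\<iota> x) = x" if "x \<in> U" for x
    using that chart_inv_in[OF ie] chart_inv_right[OF ie] by (auto simp: U_def \<iota>_def)
  have sm\<iota>: "smooth_at std_atlas GA \<iota> x" if "x \<in> U" for x
    unfolding \<iota>_def by (rule smooth_at_chart_inv[OF me]) (use that in \<open>simp add: U_def\<close>)
  have of_chart: "of_chart GA e \<one> v = v" for v
    using tangent_map_ident[OF lie_group_cover, of "\<one>"] by (simp add: of_chart_def tangent_map_def o_def e_def)
  have sm2: "smooth_at std_atlas GA (\<lambda>z. \<iota> (fst z)) (e0, e0)" "smooth_at std_atlas GA (\<lambda>z. \<iota> (snd z)) (e0, e0)"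
    using smooth_at_compose[OF chart_cover_std chart_cover_std lie_group_cover
        smooth_at_fst[OF smooth_atlas_std chart_cover_std, unfolded prod_atlas_std, of "(e0, e0)"], of \<iota>]
      smooth_at_compose[OF chart_cover_std chart_cover_std lie_group_cover
        smooth_at_snd[OF chart_cover_std smooth_atlas_std, unfolded prod_atlas_std, of "(e0, e0)"], of \<iota>] sm\<iota>[OF U(2)]
    by auto
  \<comment> \<open>Multiplication in coordinates; the bracket is the antisymmetric part of its
    mixed second derivative \<open>?H\<close>.\<close>
  define \<mu> where "\<mu> z = snd e (\<iota> (fst z) \<otimes> \<iota> (snd z))" for z
  have "smooth_at std_atlas std_atlas \<mu> (e0, e0)"
    unfolding \<mu>_def
    by (rule smooth_at_compose[OF chart_cover_std lie_group_cover chart_cover_std smooth_at_mult[OF chart_cover_std sm2]])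
      (use lie_group_carrier in \<open>simp add: \<iota>0 smooth_at_chart[OF me e(2)]\<close>)
  then obtain S where S: "open S" "(e0, e0) \<in> S" "smooth_on S \<mu>" unfolding smooth_at_std_iff by blast
  \<comment> \<open>Conjugation in coordinates shows that \<open>a\<close> below is differentiable;
    the value of that derivative is then computed from \<mu> alone.\<close>
  define C where "C z = snd e (\<iota> (fst z) \<otimes> \<iota> (snd z) \<otimes> inv (\<iota> (fst z)))" for z
  have "smooth_at std_atlas std_atlas C (e0, e0)"
    unfolding C_def
    by (rule smooth_at_compose[OF chart_cover_std lie_group_cover chart_cover_std
          smooth_at_mult[OF chart_cover_std smooth_at_mult[OF chart_cover_std sm2] smooth_at_inv[OF chart_cover_std sm2(1)]]])
      (use lie_group_carrier in \<open>simp add: \<iota>0 smooth_at_chart[OF me e(2)]\<close>)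
  then obtain S' where S': "open S'" "(e0, e0) \<in> S'" "smooth_on S' C" unfolding smooth_at_std_iff by blast
  let ?D = "\<lambda>f z. frechet_derivative f (at z)"
  let ?H = "\<lambda>a b. frechet_derivative (\<lambda>z. ?D \<mu> z b) (at (e0, e0)) a"
  define X where "X = velocity GA \<gamma> 0"
  define W where "W = {x \<in> U. (x, e0) \<in> S \<and> (e0, x) \<in> S \<and> (x, e0) \<in> S'}"
  have "open ((\<lambda>x. (x, e0)) -` S)" "open ((\<lambda>x. (e0, x)) -` S)" "open ((\<lambda>x. (x, e0)) -` S')"
    by (intro open_vimage S S' continuous_intros)+
  moreover have "W = U \<inter> ((\<lambda>x. (x, e0)) -` S) \<inter> ((\<lambda>x. (e0, x)) -` S) \<inter> ((\<lambda>x. (x, e0)) -` S')"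
    by (auto simp: W_def)
  ultimately have W: "open W" "e0 \<in> W" using U S S' by auto
  have Dl: "((\<lambda>x. f (x, e0)) has_derivative (\<lambda>v. ?D f (x, e0) (v, 0))) (at x)"
    and Dr: "((\<lambda>y. f (x', y)) has_derivative (\<lambda>v. ?D f (x', y) (0, v))) (at y)"
    if "smooth_on O' f" "(x, e0) \<in> O'" "(x', y) \<in> O'" for f :: "'g \<times> 'g \<Rightarrow> 'g" and O' x x' y
    using has_derivative_compose[OF has_derivative_Pair[OF has_derivative_ident has_derivative_const] smooth_on_has_derivative[OF that(1,2)]]
      has_derivative_compose[OF has_derivative_Pair[OF has_derivative_const has_derivative_ident] smooth_on_has_derivative[OF that(1,3)]]
    by simp_all
  have Dl': "((\<lambda>y. f (y, x')) has_derivative (\<lambda>v. ?D f (y, x') (v, 0))) (at y)"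
    if "smooth_on O' f" "(y, x') \<in> O'" for f :: "'g \<times> 'g \<Rightarrow> 'g" and O' x' y
    using has_derivative_compose[OF has_derivative_Pair[OF has_derivative_ident has_derivative_const] smooth_on_has_derivative[OF that]]
    by simp
  have left_rep: "in_chart GA e (\<iota> x) (left_inv_field GA G Z (\<iota> x)) = ?D \<mu> (x, e0) (0, Z)" if x: "x \<in> W" for x Z
  proof -
    have xU: "x \<in> U" "(x, e0) \<in> S" using x by (auto simp: W_def)
    have sm: "smooth_at GA GA (\<lambda>h. \<iota> x \<otimes> h) \<one>" by (intro smooth_G)
    have "in_chart GA e (\<iota> x) (left_inv_field GA G Z (\<iota> x)) = ?D (\<lambda>y. snd e (\<iota> x \<otimes> \<iota> y)) e0 Z"
      using in_chart_tangent_map(2)[OF lie_group_cover lie_group_cover sm me me e(2), of Z] \<iota>(1)[OF xU(1)] lie_group_carrier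
      by (simp add: of_chart left_inv_field_def e0_def \<iota>_def)
    also have "\<dots> = ?D \<mu> (x, e0) (0, Z)"
      using frechet_derivativeI[OF Dr[OF S(3) xU(2,2)]] by (simp add: \<mu>_def)
    finally show ?thesis .
  qed
  have bracket: "lie_bracket GA G X Y = ?H (X, 0) (0, Y) - ?H (Y, 0) (0, X)" for X
  proof -
    have "((\<lambda>x. ?D \<mu> (x, e0) (0, Z)) has_derivative (\<lambda>v. ?H (v, 0) (0, Z))) (at e0)" for Z
      by (rule Dl'[OF smooth_on_derivative[OF S(3)] S(2)])
    then have "(field_rep GA e (left_inv_field GA G Z) has_derivative (\<lambda>v. ?H (v, 0) (0, Z))) (at e0)" for Z
      by (rule has_derivative_transform_within_open[OF _ W]) (use left_rep in \<open>simp add: field_rep_def \<iota>_def\<close>)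
    from frechet_derivativeI[OF this]
    have rep: "?D (field_rep GA e (left_inv_field GA G Z)) e0 v = ?H (v, 0) (0, Z)" for Z v by simp
    have "left_inv_field GA G Z \<one> = Z" for Z
    proof -
      have "(\<lambda>h. \<one> \<otimes> h) = (\<lambda>h. h)" using lie_group_carrier by simp
      then show ?thesis by (simp add: left_inv_field_def tangent_map_ident[OF lie_group_cover])
    qed
    then show ?thesis by (simp add: lie_bracket_def field_bracket_def Let_def rep flip: e_def e0_def)
  qed
  define a where "a x = Ad GA G (\<iota> x) Y" for x
  have a_eq: "a x = ?D C (x, e0) (0, Y)" if "x \<in> W" for x
  proof -
    have "(x, e0) \<in> S'" using that by (simp add: W_def)
    from frechet_derivativeI[OF Dr[OF S'(3) this this]]
    have "?D (\<lambda>y. C (x, y)) e0 Y = ?D C (x, e0) (0, Y)" by simp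
    then show ?thesis
      by (simp add: a_def Ad_def tangent_map_def conj_one C_def o_def flip: e_def e0_def \<iota>_def)
  qed
  define a' where "a' = ?D a e0"
  have a': "(a has_derivative a') (at e0)"
  proof -
    have "((\<lambda>x. ?D C (x, e0) (0, Y)) has_derivative (\<lambda>v. frechet_derivative (\<lambda>z. ?D C z (0, Y)) (at (e0, e0)) (v, 0))) (at e0)"
      by (rule Dl'[OF smooth_on_derivative[OF S'(3)] S'(2)])
    then have "(a has_derivative (\<lambda>v. frechet_derivative (\<lambda>z. ?D C z (0, Y)) (at (e0, e0)) (v, 0))) (at e0)"
      by (rule has_derivative_transform_within_open[OF _ W]) (simp add: a_eq)
    then show ?thesis using frechet_derivative_at by (metis a'_def)
  qed
  \<comment> \<open>\<open>(g h g\<^sup>-\<^sup>1) g = g h\<close>, differentiated in \<open>h\<close>\<close>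
  have relation: "?D \<mu> (e0, x) (a x, 0) = ?D \<mu> (x, e0) (0, Y)" if x: "x \<in> W" for x
  proof -
    have xU: "x \<in> U" "(e0, x) \<in> S" using x by (auto simp: W_def)
    let ?g = "\<iota> x"
    have sm: "smooth_at GA GA (\<lambda>h. h \<otimes> ?g) h'" for h' by (intro smooth_G)
    have sm': "smooth_at GA GA (\<lambda>h. ?g \<otimes> h \<otimes> inv ?g) \<one>" by (intro smooth_G)
    have "tangent_map GA GA (\<lambda>h. (?g \<otimes> h \<otimes> inv ?g) \<otimes> ?g) \<one> Y =
        tangent_map GA GA (\<lambda>h. h \<otimes> ?g) \<one> (Ad GA G ?g Y)"
      using tangent_map_compose[OF lie_group_cover lie_group_cover lie_group_cover sm' sm, of Y]
      by (simp add: conj_one Ad_def)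
    moreover have "(\<lambda>h. (?g \<otimes> h \<otimes> inv ?g) \<otimes> ?g) = (\<lambda>h. ?g \<otimes> h)"
      using lie_group_carrier by (simp add: G.m_assoc)
    ultimately have "in_chart GA e ?g (left_inv_field GA G Y ?g) =
        in_chart GA e ?g (tangent_map GA GA (\<lambda>h. h \<otimes> ?g) \<one> (a x))"
      by (simp add: left_inv_field_def a_def)
    also have "\<dots> = ?D (\<lambda>y. snd e (\<iota> y \<otimes> ?g)) e0 (a x)"
      using in_chart_tangent_map(2)[OF lie_group_cover lie_group_cover sm me me e(2), of "a x"] \<iota>(1)[OF xU(1)] lie_group_carrier
      by (simp add: of_chart e0_def \<iota>_def)
    also have "\<dots> = ?D \<mu> (e0, x) (a x, 0)"
      using frechet_derivativeI[OF Dl'[OF S(3) xU(2)]] by (simp add: \<mu>_def)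
    finally show ?thesis using left_rep[OF x, of Y] by simp
  qed
  have unit: "?D \<mu> (e0, e0) (v, 0) = v" for v
  proof -
    have "((\<lambda>y. y) has_derivative (\<lambda>v. ?D \<mu> (e0, e0) (v, 0))) (at e0)"
      by (rule has_derivative_transform_within_open[OF Dl'[OF S(3,2)] W])
        (use \<iota> lie_group_carrier in \<open>auto simp: \<mu>_def \<iota>0 W_def\<close>)
    from has_derivative_unique[OF this has_derivative_ident] show ?thesis by metis
  qed
  have a0: "a e0 = Y" by (simp add: a_def \<iota>0 Ad_one)
  have "a' v = lie_bracket GA G v Y" for v
  proof -
    \<comment> \<open>Differentiating \<open>relation\<close> at the unit: the left side contributes
      a second derivative of \<mu> and \<open>a'\<close>, the right side another second derivative.
      After an exchange of arguments their difference is the bracket.\<close>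
    have "((\<lambda>x. ?D \<mu> (e0, x) (a x, 0)) has_derivative (\<lambda>v. ?H (0, v) (a e0, 0) + ?D \<mu> (e0, e0) (a' v, 0))) (at e0)"
    proof (rule has_derivative_apply[where F = "\<lambda>x u. ?D \<mu> (e0, x) (u, 0)" and F' = "\<lambda>u v. ?H (0, v) (u, 0)", OF W _ _ a'])
      show "linear (\<lambda>u. ?D \<mu> (e0, x) (u, 0))" if "x \<in> W" for x
        by (rule has_derivative_linear[OF Dl'[OF S(3)]]) (use that in \<open>simp add: W_def\<close>)
      show "((\<lambda>x. ?D \<mu> (e0, x) (u, 0)) has_derivative (\<lambda>v. ?H (0, v) (u, 0))) (at e0)" for u
        by (rule Dr[OF smooth_on_derivative[OF S(3)] S(2) S(2)])
    qed
    then have "((\<lambda>x. ?D \<mu> (x, e0) (0, Y)) has_derivative (\<lambda>v. ?H (0, v) (Y, 0) + a' v)) (at e0)"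
      unfolding a0 unit by (rule has_derivative_transform_within_open[OF _ W]) (rule relation)
    from has_derivative_unique[OF this Dl'[OF smooth_on_derivative[OF S(3)] S(2)]]
    have "?H (0, v) (Y, 0) + a' v = ?H (v, 0) (0, Y)" by metis
    moreover have "?H (0, v) (Y, 0) = ?H (Y, 0) (0, v)" by (rule smooth_on_second_derivative[OF S(1,3,2)])
    ultimately show ?thesis by (simp add: bracket eq_diff_eq add.commute)
  qed
  moreover have "a' X \<in> V"
  proof -
    obtain T where T: "open T" "0 \<in> T" "continuous_on T \<gamma>" using smooth_at_nbhd[OF \<gamma>(1)] by metis
    have oT: "open (T \<inter> \<gamma> -` fst e)" by (rule continuous_open_preimage[OF T(3,1) is_chart_open(1)[OF ie]])
    have "((snd e \<circ> \<gamma>) has_derivative tangent_map std_atlas GA \<gamma> 0) (at 0)"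
      using tangent_map_has_derivative[OF chart_cover_std lie_group_cover \<gamma>(1)] by (simp add: \<gamma>(2) e_def o_def)
    then have "((\<lambda>t. a ((snd e \<circ> \<gamma>) t)) has_derivative (\<lambda>t. a' (tangent_map std_atlas GA \<gamma> 0 t))) (at 0)"
      by (rule has_derivative_compose) (use a' in \<open>simp add: \<gamma>(2) e0_def\<close>)
    from has_derivative_in_subspace[OF this oT _ _ V(1), of 1]
    show ?thesis using T e(2) V(2) \<gamma>(2) by (auto simp: a_def \<iota>_def chart_inv_left[OF ie] X_def velocity_def)
  qed
  ultimately show ?thesis by (simp add: X_def)
qed

lemma velocity_in_parabolic_subalgebra:
  assumes semi: "semisimple sc (lie_bracket GA G)" and grading: "parabolic_grading sc (lie_bracket GA G) m gr"
    and \<gamma>: "smooth_at std_atlas GA \<gamma> 0" "\<gamma> 0 = \<one>" "range \<gamma> \<subseteq> parabolic_subgroup sc GA G gr"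
  shows "velocity GA \<gamma> 0 \<in> parabolic_subalgebra sc gr"
proof -
  have la: "lie_algebra sc (lie_bracket GA G)" using semi by (simp add: semisimple_def)
  have "lie_bracket GA G (velocity GA \<gamma> 0) Y \<in> filtration sc gr j" if "Y \<in> filtration sc gr j" for j Y
    using \<gamma>(3) that by (intro lie_bracket_if_Ad_invariant[OF \<gamma>(1,2) subspace_filtration[OF la]])
      (auto simp: parabolic_subgroup_def)
  then show ?thesis
    unfolding parabolic_subalgebra_def by (rule parabolic_self_normalizing[OF la grading semi])
qed

end

section \<open>Parabolic geometries\<close>

lemma smooth_on_sin_cos: "smooth_on UNIV (sin :: real \<Rightarrow> real)" "smooth_on UNIV (cos :: real \<Rightarrow> real)"
proof -
  have "Ck_on k UNIV (sin :: real \<Rightarrow> real) \<and> Ck_on k UNIV (cos :: real \<Rightarrow> real)" for k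
  proof (induction k)
    case 0
    then show ?case by (simp add: continuous_on_sin continuous_on_cos)
  next
    case (Suc k)
    have s: "(sin has_derivative (\<lambda>h. h * cos x)) (at x)" and c: "(cos has_derivative (\<lambda>h. - h * sin x)) (at x)" for x :: real
      by (auto intro!: derivative_eq_intros)
    have "Ck_on k UNIV (\<lambda>x::real. h * cos x)" "Ck_on k UNIV (\<lambda>x::real. - h * sin x)" for h :: real
      by (rule Ck_on_bounded_linear[OF bounded_linear_mult_right open_UNIV], use Suc in blast)+
    then show ?case
      using Ck_on_Suc_I[OF open_UNIV s, of k] Ck_on_Suc_I[OF open_UNIV c, of k] by blast
  qed
  then show "smooth_on UNIV (sin :: real \<Rightarrow> real)" "smooth_on UNIV (cos :: real \<Rightarrow> real)"
    by (auto simp: smooth_on_def)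
qed

text \<open>A fundamental vector is tested on curves over the whole real line, while a straight line
  may leave the chart. The reparametrisation \<open>d * sin (t / d)\<close> has derivative 1 at 0
  and is bounded by \<open>d\<close>, small enough for the curve to stay within distance
  \<open>e\<close> of \<open>z\<close>.\<close>

lemma bounded_smooth_curve:
  fixes z v :: "'a::euclidean_space"
  assumes "open S" "z \<in> S"
  obtains c :: "real \<Rightarrow> 'a" where "c 0 = z" "\<And>t. c t \<in> S" "smooth_on UNIV c"
    "(c has_derivative (\<lambda>h. h *\<^sub>R v)) (at 0)"
proof -
  obtain e where e: "e > 0" "cball z e \<subseteq> S" using assms open_contains_cball by blast
  define d where "d = e / (norm v + 1)"
  have "norm v + 1 > 0" by (smt (verit) norm_ge_zero)
  then have d: "d > 0" "d * norm v \<le> e" using e(1) by (auto simp: d_def field_simps)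
  define c where "c t = (d * sin (t / d)) *\<^sub>R v + z" for t
  show thesis
  proof (rule that[of c])
    show "c 0 = z" by (simp add: c_def)
    show "c t \<in> S" for t
    proof -
      have "norm (c t - z) = (d * \<bar>sin (t / d)\<bar>) * norm v"
        using d(1) by (simp add: c_def abs_mult)
      also have "\<dots> \<le> (d * 1) * norm v"
        using d(1) by (intro mult_right_mono mult_left_mono) auto
      finally show ?thesis using d(2) e(2) by (auto simp: dist_norm norm_minus_commute subset_iff)
    qed
    have "smooth_on UNIV (\<lambda>t. sin (t / d))"
      using smooth_on_linear[OF open_UNIV _ smooth_on_ident[OF open_UNIV], of "\<lambda>t::real. t / d"]
      by (intro smooth_on_compose[OF open_UNIV open_UNIV _ _ smooth_on_sin_cos(1)])
        (auto simp: linear_iff add_divide_distrib)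
    then have "smooth_on UNIV (\<lambda>t. (d * sin (t / d)) *\<^sub>R v)"
      using smooth_on_linear[OF open_UNIV, of "\<lambda>s. (d * s) *\<^sub>R v" "\<lambda>t. sin (t / d)"]
      by (auto simp: linear_iff algebra_simps)
    then show "smooth_on UNIV c" unfolding c_def by (intro smooth_on_add smooth_on_const open_UNIV)
    show "(c has_derivative (\<lambda>h. h *\<^sub>R v)) (at 0)"
      unfolding c_def using d(1) by (auto intro!: derivative_eq_intros)
  qed
qed

text \<open>Turns the flattening map of \<open>frobenius_leaf\<close> into a chart; membership in
  the maximal atlas rests on the smoothness of both \<Phi> and its inverse \<Psi>.\<close>

lemma compose_chart:
  fixes A :: "('m::{t2_space, second_countable_topology}, 'a::euclidean_space) chart set"
  assumes A: "smooth_atlas A" and d: "d \<in> A" and W: "open W" "W \<subseteq> snd d ` fst d"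
    and \<Phi>: "smooth_on W \<Phi>" "open (\<Phi> ` W)" and \<Psi>: "smooth_on (\<Phi> ` W) \<Psi>" "\<And>y. y \<in> W \<Longrightarrow> \<Psi> (\<Phi> y) = y"
  defines "c \<equiv> (fst d \<inter> snd d -` W, \<Phi> \<circ> snd d)"
  shows "max_chart A c"
    and "y \<in> fst c \<Longrightarrow> in_chart A c y v = frechet_derivative \<Phi> (at (snd d y)) (in_chart A d y v)"
proof -
  have cov: "chart_cover A" by (rule smooth_atlas_cover[OF A])
  have md: "max_chart A d" by (rule smooth_atlas_max_chart[OF A d])
  have id: "is_chart d" by (rule max_chart_is_chart[OF md])
  have im: "snd d ` fst c = W" using W(2) by (auto simp: c_def)
  have "snd c ` fst c = \<Phi> ` (snd d ` fst c)" by (simp add: c_def image_comp)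
  then have imc: "snd c ` fst c = \<Phi> ` W" by (simp only: im)
  have oc: "open (fst c)" using open_chart_preimage[OF id W(1)] by (simp add: c_def)
  have inj: "inj_on (snd c) (fst c)"
    by (rule inj_on_inverseI[where g = "chart_inv d \<circ> \<Psi>"]) (auto simp: c_def \<Psi>(2) chart_inv_left[OF id])
  have inv: "chart_inv c z = chart_inv d (\<Psi> z)" if "z \<in> \<Phi> ` W" for z
  proof -
    have "z \<in> snd c ` fst c" using that by (simp only: imc)
    then obtain y where y: "y \<in> fst c" "z = snd c y" by auto
    then have "chart_inv c z = y" unfolding chart_inv_def using inv_into_f_f[OF inj] by simp
    moreover have "chart_inv d (\<Psi> z) = y" using y by (auto simp: c_def \<Psi>(2) chart_inv_left[OF id])
    ultimately show ?thesis by simp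
  qed
  have \<Psi>im: "\<Psi> z \<in> W" if "z \<in> \<Phi> ` W" for z using that \<Psi>(2) by auto
  have cont: "continuous_on (fst c) (snd c)"
    unfolding c_def fst_conv snd_conv o_def
    by (rule continuous_on_compose2[OF smooth_on_continuous[OF \<Phi>(1)] continuous_on_subset[OF continuous_on_chart[OF id]]]) auto
  have "continuous_on (\<Phi> ` W) (\<lambda>z. chart_inv d (\<Psi> z))"
    by (rule continuous_on_compose2[OF continuous_on_chart_inv[OF id] smooth_on_continuous[OF \<Psi>(1)]]) (use \<Psi>im W(2) in blast)
  then have continv: "continuous_on (\<Phi> ` W) (chart_inv c)" using inv by (simp cong: continuous_on_cong)
  have left: "chart_inv c (snd c y) = y" if "y \<in> fst c" for y
    unfolding chart_inv_def using inv_into_f_f[OF inj that] .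
  have "homeomorphism (fst c) (snd c ` fst c) (snd c) (chart_inv c)"
    by (rule homeomorphismI[OF cont continv[folded imc]]) (auto simp: left)
  then have ic: "is_chart c" using oc \<Phi>(2) by (simp add: is_chart_def imc)
  have "compatible c e" if e: "e \<in> A" for e
  proof -
    have ie: "is_chart e" by (rule chart_cover_is_chart[OF cov e])
    have tr: "smooth_on (snd d ` (fst d \<inter> fst e)) (snd e \<circ> chart_inv d)" "smooth_on (snd e ` (fst d \<inter> fst e)) (snd d \<circ> chart_inv e)"
      using A d e by (auto simp: smooth_atlas_def compatible_def)
    have o1: "open (snd c ` (fst c \<inter> fst e))"
      using open_chart_image[OF ic is_chart_open(1)[OF ie]] by (simp add: Int_commute)
    have o2: "open (snd d ` (fst d \<inter> fst e))"
      using open_chart_image[OF id is_chart_open(1)[OF ie]] by (simp add: Int_commute)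
    have o3: "open (snd e ` (fst c \<inter> fst e))" by (rule open_chart_image[OF ie oc])
    have sub: "snd c ` (fst c \<inter> fst e) \<subseteq> \<Phi> ` W" using imc by blast
    have "smooth_on (snd c ` (fst c \<inter> fst e)) (\<lambda>z. (snd e \<circ> chart_inv d) (\<Psi> z))"
      by (rule smooth_on_compose[OF o1 o2 _ smooth_on_open_subset[OF \<Psi>(1) sub] tr(1)]) (auto simp: c_def \<Psi>(2))
    then have 1: "smooth_on (snd c ` (fst c \<inter> fst e)) (snd e \<circ> chart_inv c)"
      by (rule smooth_on_eq[OF _ o1]) (use sub inv in auto)
    have "smooth_on (snd e ` (fst c \<inter> fst e)) (\<lambda>z. \<Phi> ((snd d \<circ> chart_inv e) z))"
    proof (rule smooth_on_compose[OF o3 W(1) _ smooth_on_open_subset[OF tr(2)] \<Phi>(1)])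
      show "(snd d \<circ> chart_inv e) z \<in> W" if "z \<in> snd e ` (fst c \<inter> fst e)" for z
        using that by (auto simp: chart_inv_left[OF ie] c_def)
      show "snd e ` (fst c \<inter> fst e) \<subseteq> snd e ` (fst d \<inter> fst e)" by (auto simp: c_def)
    qed
    then have 2: "smooth_on (snd e ` (fst c \<inter> fst e)) (snd c \<circ> chart_inv e)" by (simp add: c_def o_def)
    show ?thesis using 1 2 by (simp add: compatible_def)
  qed
  then show "max_chart A c" using ic by (simp add: max_chart_def)
  assume y: "y \<in> fst c"
  then have y': "y \<in> fst d" "snd d y \<in> W" by (auto simp: c_def)
  have "smooth_at std_atlas std_atlas \<Phi> (snd d y)" using W(1) y'(2) \<Phi>(1) by (auto simp: smooth_at_std_iff)
  from tangent_map_compose[OF cov chart_cover_std chart_cover_std smooth_at_chart[OF md y'(1)] this, of v]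
  show "in_chart A c y v = frechet_derivative \<Phi> (at (snd d y)) (in_chart A d y v)"
    by (simp add: in_chart_eq tangent_map_std c_def o_def)
qed

section \<open>The bundle and its local product structure\<close>

locale nested_parabolic_geometry =
  fixes GA :: "('h::{t2_space, second_countable_topology}, 'g::euclidean_space) chart set"
    and G :: "'h monoid" (structure)
    and sc :: "'k::real_normed_field \<Rightarrow> 'g \<Rightarrow> 'g"
    and mq mp :: nat
    and grq grp :: "int \<Rightarrow> 'g set"
    and PA :: "('p::{t2_space, second_countable_topology}, 'b::euclidean_space) chart set"
    and MA :: "('m::{t2_space, second_countable_topology}, 'a::euclidean_space) chart set"
    and \<pi> :: "'p \<Rightarrow> 'm"
    and r :: "'p \<Rightarrow> 'h \<Rightarrow> 'p"
    and \<omega> :: "'p \<Rightarrow> 'b \<Rightarrow> 'g"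
  assumes lie: "lie_group GA G"
    and semi: "semisimple sc (lie_bracket GA G)"
    and grq: "parabolic_grading sc (lie_bracket GA G) mq grq"
    and grp: "parabolic_grading sc (lie_bracket GA G) mp grp"
    and qp: "parabolic_subalgebra sc grq \<subseteq> parabolic_subalgebra sc grp"
    and QP: "parabolic_subgroup sc GA G grq \<subseteq> parabolic_subgroup sc GA G grp"
    and geometry: "parabolic_geometry sc GA G grq PA MA \<pi> r \<omega>"
begin

abbreviation "q \<equiv> parabolic_subalgebra sc grq"
abbreviation "p \<equiv> parabolic_subalgebra sc grp"
abbreviation "Q \<equiv> parabolic_subgroup sc GA G grq"
abbreviation "E \<equiv> subalgebra_distribution PA MA \<pi> \<omega> p"
abbreviation "T\<pi> \<equiv> tangent_map PA MA \<pi>"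

lemma lie_algebra: "lie_algebra sc (lie_bracket GA G)"
  using semi by (simp add: semisimple_def)

lemma principal: "principal_bundle GA G Q PA MA \<pi> r"
  using geometry by (simp add: parabolic_geometry_def)

lemma connection: "cartan_connection GA G Q q PA r \<omega>"
  using geometry by (simp add: parabolic_geometry_def)

lemma atlas_PA: "smooth_atlas PA" and atlas_MA: "smooth_atlas MA"
  using principal by (simp_all add: principal_bundle_def)

lemma atlas_GA: "smooth_atlas GA"
  using lie by (simp add: lie_group_def)

lemma cover: "chart_cover PA" "chart_cover MA" "chart_cover GA"
  using smooth_atlas_cover atlas_PA atlas_MA atlas_GA by blast+

lemmas covers = cover chart_cover_std chart_cover_prod[OF cover(2) cover(1)] chart_cover_prod[OF cover(2) cover(3)]
  chart_cover_prod[OF cover(1) cover(3)]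

lemma smooth_\<pi>: "smooth_at PA MA \<pi> u"
  using principal by (intro smooth_map_on_UNIV_smooth_at covers) (simp add: principal_bundle_def)

lemma open_\<pi>: "open U \<Longrightarrow> open (\<pi> -` U)"
proof -
  assume U: "open U"
  have "continuous_on UNIV \<pi>"
    by (rule continuous_at_imp_continuous_on)
      (metis smooth_at_nbhd smooth_\<pi> continuous_on_eq_continuous_at)
  then show ?thesis using open_vimage[OF U] by blast
qed

lemma one_form: "smooth_one_form PA \<omega>"
  using connection by (simp add: cartan_connection_def)

lemma linear_\<omega>: "linear (\<omega> u)"
  using one_form by (simp add: smooth_one_form_def)

lemma bij_\<omega>: "bij (\<omega> u)"
  using connection by (simp add: cartan_connection_def)

lemma subgroup_Q: "subgroup Q G"
  by (rule subgroup_parabolic_subgroup[OF lie lie_algebra])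

lemma subspace_p: "subspace p" and subspace_q: "subspace q"
  unfolding parabolic_subalgebra_def by (rule subspace_filtration[OF lie_algebra])+

lemma linear_T\<pi>: "linear (T\<pi> u)"
  by (rule linear_tangent_map[OF covers(1,2) smooth_\<pi>])

lemma smooth_at_extension:
  assumes "smooth_map_on A B S f" "x \<in> S"
  obtains W g where "open W" "x \<in> W" "smooth_at A B g x" "\<And>y. y \<in> W \<Longrightarrow> y \<in> S \<Longrightarrow> g y = f y"
proof -
  obtain W g where "x \<in> W" "smooth_map_open A B W g" "\<forall>y\<in>W \<inter> S. g y = f y"
    using assms unfolding smooth_map_on_def by metis
  then show thesis using that[of W g] unfolding smooth_at_def smooth_map_open_def by blast
qed

lemma smooth_right_action:
  assumes "g \<in> Q" shows "smooth_at PA PA (\<lambda>u. r u g) u"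
proof -
  have "smooth_map_on (prod_atlas PA GA) PA (UNIV \<times> Q) (\<lambda>(u, g). r u g)" "(u, g) \<in> UNIV \<times> Q"
    using principal assms by (auto simp: principal_bundle_def)
  then obtain W h where W: "open W" "(u, g) \<in> W" "smooth_at (prod_atlas PA GA) PA h (u, g)"
    "\<And>z. z \<in> W \<Longrightarrow> z \<in> UNIV \<times> Q \<Longrightarrow> h z = (\<lambda>(u, g). r u g) z"
    using smooth_at_extension by metis
  have "smooth_at PA PA (\<lambda>u. h (u, g)) u"
    by (rule smooth_at_compose[OF covers(1,7,1) smooth_at_Pair[OF covers(1,1,3) smooth_at_ident[OF atlas_PA] smooth_at_const[OF covers(1)]] W(3)])
  moreover have "open ((\<lambda>u. (u, g)) -` W)" by (intro open_vimage W(1) continuous_intros)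
  ultimately show ?thesis
    by (rule smooth_at_cong[OF covers(1,1)]) (use W(2,4) assms in auto)
qed

text \<open>In a trivialisation, \<open>K y w\<close> moves \<open>w\<close> to the fibre over
  \<open>y\<close> keeping its group component, and \<open>k w w'\<close> is the element of
  \<open>Q\<close> relating two group components. With a bundle point in place of a group element,
  \<open>K\<close> is smooth on an open set, which avoids smoothness on the subset \<open>Q\<close>.
  It yields sections, lifts of retractions and curves in fibres.\<close>

lemma local_product:
  obtains U K k where "open U" "x \<in> U" "\<exists>u. \<pi> u = x"
    "\<And>y w. y \<in> U \<Longrightarrow> \<pi> w \<in> U \<Longrightarrow> \<pi> (K y w) = y"
    "\<And>w. \<pi> w \<in> U \<Longrightarrow> K (\<pi> w) w = w"
    "\<And>w w'. \<pi> w \<in> U \<Longrightarrow> \<pi> w' \<in> U \<Longrightarrow> k w w' \<in> Q \<and> K (\<pi> w) w' = r w (k w w')"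
    "\<And>w. \<pi> w \<in> U \<Longrightarrow> k w w = \<one>"
    "\<And>w w'. \<pi> w \<in> U \<Longrightarrow> \<pi> w' \<in> U \<Longrightarrow> smooth_at PA GA (k w) w'"
    "\<And>y w. y \<in> U \<Longrightarrow> \<pi> w \<in> U \<Longrightarrow> smooth_at (prod_atlas MA PA) PA (\<lambda>z. K (fst z) (snd z)) (y, w)"
proof -
  have "\<exists>U \<tau>. open U \<and> x \<in> U \<and> bij_betw (\<lambda>u. (\<pi> u, \<tau> u)) (\<pi> -` U) (U \<times> Q) \<and>
        smooth_map_on PA (prod_atlas MA GA) (\<pi> -` U) (\<lambda>u. (\<pi> u, \<tau> u)) \<and>
        smooth_map_on (prod_atlas MA GA) PA (U \<times> Q) (inv_into (\<pi> -` U) (\<lambda>u. (\<pi> u, \<tau> u))) \<and>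
        (\<forall>u\<in>\<pi> -` U. \<forall>g\<in>Q. \<tau> (r u g) = \<tau> u \<otimes> g)"
    using principal by (simp add: principal_bundle_def)
  then obtain U \<tau> where U: "open U" "x \<in> U" and bij: "bij_betw (\<lambda>u. (\<pi> u, \<tau> u)) (\<pi> -` U) (U \<times> Q)"
    and sm: "smooth_map_on PA (prod_atlas MA GA) (\<pi> -` U) (\<lambda>u. (\<pi> u, \<tau> u))"
    and sm': "smooth_map_on (prod_atlas MA GA) PA (U \<times> Q) (inv_into (\<pi> -` U) (\<lambda>u. (\<pi> u, \<tau> u)))"
    and equi: "\<And>u g. \<pi> u \<in> U \<Longrightarrow> g \<in> Q \<Longrightarrow> \<tau> (r u g) = \<tau> u \<otimes> g"
    by auto
  interpret group G using lie by (simp add: lie_group_def)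
  have car: "g \<in> carrier G" for g using lie by (simp add: lie_group_def)
  let ?\<sigma> = "inv_into (\<pi> -` U) (\<lambda>u. (\<pi> u, \<tau> u))"
  define K where "K y w = ?\<sigma> (y, \<tau> w)" for y w
  define k where "k w w' = inv (\<tau> w) \<otimes> \<tau> w'" for w w'
  have \<tau>Q: "\<tau> w \<in> Q" if "\<pi> w \<in> U" for w using bij_betwE[OF bij] that by auto
  have \<sigma>: "\<pi> (?\<sigma> (y, g)) = y" "\<tau> (?\<sigma> (y, g)) = g" if "y \<in> U" "g \<in> Q" for y g
    using bij_betw_inv_into_right[OF bij, of "(y, g)"] that by auto
  have \<sigma>': "?\<sigma> (\<pi> w, \<tau> w) = w" if "\<pi> w \<in> U" for w
    using bij_betw_inv_into_left[OF bij, of w] that by auto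
  have kQ: "k w w' \<in> Q" if "\<pi> w \<in> U" "\<pi> w' \<in> U" for w w'
    unfolding k_def using subgroup_Q \<tau>Q that by (simp add: subgroup.m_inv_closed subgroup.m_closed)
  have Kr: "K (\<pi> w) w' = r w (k w w')" if w: "\<pi> w \<in> U" "\<pi> w' \<in> U" for w w'
  proof -
    have "\<pi> (r w (k w w')) = \<pi> w" using principal kQ[OF w] by (simp add: principal_bundle_def)
    moreover have "\<tau> (r w (k w w')) = \<tau> w'"
      using equi[OF w(1) kQ[OF w]] car by (simp add: k_def flip: m_assoc)
    ultimately show ?thesis using \<sigma>'[of "r w (k w w')"] w by (simp add: K_def)
  qed
  have sm\<tau>: "smooth_at PA GA \<tau> w" if w: "\<pi> w \<in> U" for w
  proof -
    obtain W h where W: "open W" "w \<in> W" "smooth_at PA (prod_atlas MA GA) h w"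
      "\<And>y. y \<in> W \<Longrightarrow> y \<in> \<pi> -` U \<Longrightarrow> h y = (\<pi> y, \<tau> y)"
      using smooth_at_extension[OF sm] w by (metis vimageI)
    have "smooth_at PA GA (\<lambda>w. snd (h w)) w"
      by (rule smooth_at_compose[OF covers(1,6,3) W(3) smooth_at_snd[OF covers(2) atlas_GA]])
    then show ?thesis
      by (rule smooth_at_cong[OF covers(1,3) _ open_Int[OF W(1) open_\<pi>[OF U(1)]]]) (use W(2,4) w in auto)
  qed
  have smK: "smooth_at (prod_atlas MA PA) PA (\<lambda>z. K (fst z) (snd z)) (y, w)" if yw: "y \<in> U" "\<pi> w \<in> U" for y w
  proof -
    let ?f = "\<lambda>z. (fst z, \<tau> (snd z))"
    have "smooth_at (prod_atlas MA PA) GA (\<lambda>z. \<tau> (snd z)) (y, w)"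
      by (rule smooth_at_compose[OF covers(5,1,3) smooth_at_snd[OF covers(2) atlas_PA]]) (simp add: sm\<tau> yw)
    then have f: "smooth_at (prod_atlas MA PA) (prod_atlas MA GA) ?f (y, w)"
      by (rule smooth_at_Pair[OF covers(5,2,3) smooth_at_fst[OF atlas_MA covers(1)]])
    have mem: "(y, \<tau> w) \<in> U \<times> Q" using yw \<tau>Q by simp
    obtain W h where W: "open W" "(y, \<tau> w) \<in> W" "smooth_at (prod_atlas MA GA) PA h (y, \<tau> w)"
      "\<And>z. z \<in> W \<Longrightarrow> z \<in> U \<times> Q \<Longrightarrow> h z = ?\<sigma> z"
      by (rule smooth_at_extension[OF sm' mem]) (rule that)
    obtain V where V: "open V" "(y, w) \<in> V" "continuous_on V ?f" by (rule smooth_at_nbhd[OF f])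
    let ?V = "(V \<inter> ?f -` W) \<inter> (U \<times> (\<pi> -` U))"
    have oV: "open ?V" by (intro open_Int continuous_open_preimage[OF V(3,1) W(1)] open_Times U open_\<pi>)
    have sm: "smooth_at (prod_atlas MA PA) PA (\<lambda>z. h (?f z)) (y, w)"
      by (rule smooth_at_compose[OF covers(5,6,1) f]) (simp add: W(3))
    show ?thesis
    proof (rule smooth_at_cong[OF covers(5,1) sm oV])
      show "(y, w) \<in> ?V" using V(2) W(2) yw by simp
      fix z assume "z \<in> ?V"
      then have "?f z \<in> W" "fst z \<in> U" "\<pi> (snd z) \<in> U" by (auto simp: mem_Times_iff)
      then show "h (?f z) = K (fst z) (snd z)" unfolding K_def using W(4)[of "?f z"] \<tau>Q by simp
    qed
  qed
  show thesis
  proof (rule that[of U K k])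
    show "\<exists>u. \<pi> u = x" using \<sigma>(1)[of x "\<one>"] U(2) subgroup.one_closed[OF subgroup_Q] by blast
    show "smooth_at PA GA (k w) w'" if "\<pi> w \<in> U" "\<pi> w' \<in> U" for w w'
      unfolding k_def by (rule smooth_at_mult[OF lie covers(1) smooth_at_const[OF covers(1)] sm\<tau>[OF that(2)]])
    show "\<pi> (K y w) = y" if "y \<in> U" "\<pi> w \<in> U" for y w unfolding K_def by (rule \<sigma>(1)[OF that(1) \<tau>Q[OF that(2)]])
    show "K (\<pi> w) w = w" if "\<pi> w \<in> U" for w unfolding K_def by (rule \<sigma>'[OF that])
    show "k w w' \<in> Q \<and> K (\<pi> w) w' = r w (k w w')" if "\<pi> w \<in> U" "\<pi> w' \<in> U" for w w'
      using kQ[OF that] Kr[OF that] by blast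
    show "k w w = \<one>" for w unfolding k_def using car by simp
  qed (fact U smK)+
qed

lemma fibre_transitive:
  assumes "\<pi> u' = \<pi> u" obtains g where "g \<in> Q" "u' = r u g"
proof -
  obtain U K k where "\<pi> u \<in> U" "\<And>w. \<pi> w \<in> U \<Longrightarrow> K (\<pi> w) w = w"
    "\<And>w w'. \<pi> w \<in> U \<Longrightarrow> \<pi> w' \<in> U \<Longrightarrow> k w w' \<in> Q \<and> K (\<pi> w) w' = r w (k w w')"
    by (rule local_product[of "\<pi> u"]) (rule that)
  then show thesis using that[of "k u u'"] assms by metis
qed

text \<open>The map \<open>K (\<pi> w) w\<close> is the identity near \<open>u\<close>, so its
  tangent map sends \<open>v\<close> to \<open>v\<close>; any pair \<open>f\<close>,
  \<open>g\<close> with the same first-order data gives the same result. This replaces a computation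
  with partial derivatives of \<open>K\<close>.\<close>

lemma tangent_map_product:
  assumes K: "smooth_at (prod_atlas MA PA) PA (\<lambda>z. K (fst z) (snd z)) (\<pi> u, u)"
    and triv: "open V" "u \<in> V" "\<And>w. w \<in> V \<Longrightarrow> K (\<pi> w) w = w"
    and B: "chart_cover B" and f: "smooth_at B MA f x" "f x = \<pi> u" and g: "smooth_at B PA g x" "g x = u"
    and v: "tangent_map B MA f x a = T\<pi> u v" "tangent_map B PA g x a = v"
  shows "smooth_at B PA (\<lambda>x. K (f x) (g x)) x" "tangent_map B PA (\<lambda>x. K (f x) (g x)) x a = v"
proof -
  have fg: "smooth_at B (prod_atlas MA PA) (\<lambda>x. (f x, g x)) x"
    by (rule smooth_at_Pair[OF B covers(2,1) f(1) g(1)])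
  have pu: "smooth_at PA (prod_atlas MA PA) (\<lambda>w. (\<pi> w, w)) u"
    by (rule smooth_at_Pair[OF covers(1,2,1) smooth_\<pi> smooth_at_ident[OF atlas_PA]])
  have K': "smooth_at (prod_atlas MA PA) PA (\<lambda>z. K (fst z) (snd z)) (f x, g x)"
    using K by (simp add: f(2) g(2))
  show "smooth_at B PA (\<lambda>x. K (f x) (g x)) x"
    using smooth_at_compose[OF B covers(5,1) fg K'] by simp
  have "tangent_map B PA (\<lambda>x. K (f x) (g x)) x a =
      tangent_map (prod_atlas MA PA) PA (\<lambda>z. K (fst z) (snd z)) (\<pi> u, u) (tangent_map B (prod_atlas MA PA) (\<lambda>x. (f x, g x)) x a)"
    using tangent_map_compose[OF B covers(5,1) fg K', of a] by (simp add: f(2) g(2))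
  also have "tangent_map B (prod_atlas MA PA) (\<lambda>x. (f x, g x)) x a = tangent_map PA (prod_atlas MA PA) (\<lambda>w. (\<pi> w, w)) u v"
    by (rule tangent_map_Pair_eq[OF B covers(1) atlas_MA atlas_PA f(1) g(1) smooth_\<pi> smooth_at_ident[OF atlas_PA] f(2) g(2) v(1)])
      (simp add: v(2) tangent_map_ident[OF covers(1)])
  also have "tangent_map (prod_atlas MA PA) PA (\<lambda>z. K (fst z) (snd z)) (\<pi> u, u) (tangent_map PA (prod_atlas MA PA) (\<lambda>w. (\<pi> w, w)) u v) =
      tangent_map PA PA (\<lambda>w. K (\<pi> w) w) u v"
    using tangent_map_compose[OF covers(1,5,1) pu K, of v] by simp
  also have "tangent_map PA PA (\<lambda>w. K (\<pi> w) w) u = tangent_map PA PA (\<lambda>w. w) u"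
    by (rule tangent_map_cong[OF covers(1,1) smooth_at_ident[OF atlas_PA] triv(1,2)]) (simp add: triv(3))
  finally show "tangent_map B PA (\<lambda>x. K (f x) (g x)) x a = v" by (simp add: tangent_map_ident[OF covers(1)])
qed

text \<open>A vertical tangent vector is the velocity of a curve \<open>r u (\<gamma> t)\<close> with \<open>\<gamma>\<close> in \<open>Q\<close>, and the
  velocity of \<open>\<gamma>\<close> normalises the filtration, hence lies in \<open>q\<close>.\<close>

lemma vertical_in_q:
  assumes v: "T\<pi> u v = 0" shows "\<omega> u v \<in> q"
proof -
  obtain U K k where U: "open U" "\<pi> u \<in> U" and
    K: "\<And>w. \<pi> w \<in> U \<Longrightarrow> K (\<pi> w) w = w" and
    k: "\<And>w w'. \<pi> w \<in> U \<Longrightarrow> \<pi> w' \<in> U \<Longrightarrow> k w w' \<in> Q \<and> K (\<pi> w) w' = r w (k w w')"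
    "\<And>w. \<pi> w \<in> U \<Longrightarrow> k w w = \<one>"
    "\<And>w w'. \<pi> w \<in> U \<Longrightarrow> \<pi> w' \<in> U \<Longrightarrow> smooth_at PA GA (k w) w'" and
    smK: "\<And>y w. y \<in> U \<Longrightarrow> \<pi> w \<in> U \<Longrightarrow> smooth_at (prod_atlas MA PA) PA (\<lambda>z. K (fst z) (snd z)) (y, w)"
    by (rule local_product[of "\<pi> u"]) (rule that)
  let ?c = "chart_at PA u"
  have c: "?c \<in> PA" "u \<in> fst ?c" using chart_at[OF covers(1)] by auto
  have mc: "max_chart PA ?c" by (rule smooth_atlas_max_chart[OF atlas_PA c(1)])
  have ic: "is_chart ?c" by (rule max_chart_is_chart[OF mc])
  let ?O = "snd ?c ` (\<pi> -` U \<inter> fst ?c)"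
  have "open ?O" by (rule open_chart_image[OF ic open_\<pi>[OF U(1)]])
  moreover have "snd ?c u \<in> ?O" using U c by blast
  ultimately obtain z where z: "z 0 = snd ?c u" "\<And>t. z t \<in> ?O" "smooth_on UNIV z" "(z has_derivative (\<lambda>h. h *\<^sub>R v)) (at 0)"
    by (rule bounded_smooth_curve[of _ _ v]) (rule that)
  define w where "w t = chart_inv ?c (z t)" for t
  have w0: "w 0 = u" by (simp add: w_def z(1) chart_inv_left[OF ic c(2)])
  have wU: "\<pi> (w t) \<in> U" for t using z(2)[of t] by (auto simp: w_def chart_inv_left[OF ic])
  have smz: "smooth_at std_atlas std_atlas z t" for t using z(3) by (auto simp: smooth_at_std_iff)
  have smc: "smooth_at std_atlas PA (chart_inv ?c) (z t)" for t
    by (rule smooth_at_chart_inv[OF mc]) (use z(2) in blast)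
  have smw: "smooth_at std_atlas PA w t" for t
    using smooth_at_compose[OF covers(4,4,1) smz smc] by (simp add: w_def[abs_def])
  have "tangent_map std_atlas PA w 0 1 = of_chart PA ?c u (frechet_derivative z (at 0) 1)"
    using tangent_map_compose[OF covers(4,4,1) smz smc, of 0 1]
    by (simp add: w_def[abs_def] tangent_map_std of_chart_eq[OF ic c(2)] z(1))
  also have "frechet_derivative z (at 0) 1 = v" using frechet_derivativeI[OF z(4)] by simp
  also have "of_chart PA ?c u v = v"
    using tangent_map_ident[OF covers(1), of u] by (simp add: of_chart_def tangent_map_def o_def)
  finally have Tw: "tangent_map std_atlas PA w 0 1 = v" .
  define \<gamma> where "\<gamma> t = k u (w t)" for t
  have sm\<gamma>: "smooth_at std_atlas GA \<gamma> t" for t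
    unfolding \<gamma>_def by (rule smooth_at_compose[OF covers(4,1,3) smw k(3)[OF U(2) wU]])
  have \<gamma>: "\<gamma> 0 = \<one>" "range \<gamma> \<subseteq> Q" using k(1,2) U(2) wU by (auto simp: \<gamma>_def w0)
  have X: "velocity GA \<gamma> 0 \<in> q"
    by (rule velocity_in_parabolic_subalgebra[OF lie semi grq sm\<gamma> \<gamma>])
  have "smooth_map_on std_atlas GA UNIV \<gamma>"
    using sm\<gamma> unfolding smooth_map_on_def smooth_at_def by blast
  then have fund: "fundamental_vector GA G Q PA r (velocity GA \<gamma> 0) u (velocity PA (\<lambda>t. r u (\<gamma> t)) 0)"
    using \<gamma> unfolding fundamental_vector_def by blast
  \<comment> \<open>The orbit curve is \<open>w\<close> pushed into the fibre of \<open>u\<close>.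
    Because \<open>v\<close> is vertical, the constant base curve has the same first-order data as
    the projection of \<open>w\<close>, so the push preserves the velocity.\<close>
  have "(\<lambda>t. r u (\<gamma> t)) = (\<lambda>t. K (\<pi> u) (w t))" using k(1)[OF U(2) wU] by (auto simp: \<gamma>_def)
  moreover have "tangent_map std_atlas PA (\<lambda>t. K (\<pi> u) (w t)) 0 1 = v"
    by (rule tangent_map_product(2)[OF smK[OF U(2,2)] open_\<pi>[OF U(1)] _ _ covers(4) smooth_at_const[OF covers(4)] refl smw w0 _ Tw])
      (use U K v in \<open>auto simp: tangent_map_const\<close>)
  ultimately have "velocity PA (\<lambda>t. r u (\<gamma> t)) 0 = v" by (simp add: velocity_def)
  then show ?thesis using fund X connection unfolding cartan_connection_def by metis
qed

section \<open>The distribution seen from the total space\<close>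

lemma \<omega>_right_action:
  assumes "g \<in> Q" "\<omega> u v \<in> p"
  shows "\<omega> (r u g) (tangent_map PA PA (\<lambda>w. r w g) u v) \<in> p"
proof -
  \<comment> \<open>The inclusion of the groups enters here: elements of \<open>Q\<close> preserve
    the filtration of the larger parabolic, in particular \<open>p\<close>.\<close>
  have "inv g \<in> parabolic_subgroup sc GA G grp"
    using subgroup.m_inv_closed[OF subgroup_Q assms(1)] QP by blast
  then have "Ad GA G (inv g) (\<omega> u v) \<in> p"
    using assms(2) unfolding parabolic_subgroup_def parabolic_subalgebra_def by blast
  then show ?thesis using connection assms(1) by (simp add: cartan_connection_def)
qed

lemma T\<pi>_right_action:
  assumes "g \<in> Q" shows "T\<pi> (r u g) (tangent_map PA PA (\<lambda>w. r w g) u v) = T\<pi> u v"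
proof -
  have "(\<lambda>w. \<pi> (r w g)) = \<pi>" using principal assms by (auto simp: principal_bundle_def)
  then show ?thesis
    using tangent_map_compose[OF covers(1,1,2) smooth_right_action[OF assms] smooth_\<pi>, of u v] by simp
qed

text \<open>Membership in \<open>E\<close> provides some point of the fibre and some lift. Right
  translation moves the point to \<open>u\<close>, equivariance keeps the value in \<open>p\<close>,
  and two lifts at \<open>u\<close> differ by a vertical vector.\<close>

lemma E_iff: "T\<pi> u v \<in> E (\<pi> u) \<longleftrightarrow> \<omega> u v \<in> p"
proof
  assume "T\<pi> u v \<in> E (\<pi> u)"
  then obtain u' v' where u': "\<pi> u' = \<pi> u" "\<omega> u' v' \<in> p" "T\<pi> u v = T\<pi> u' v'"
    by (auto simp: subalgebra_distribution_def)
  obtain g where g: "g \<in> Q" "u = r u' g" using fibre_transitive[OF u'(1)[symmetric]] .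
  let ?w = "tangent_map PA PA (\<lambda>w. r w g) u' v'"
  have w: "\<omega> u ?w \<in> p" "T\<pi> u ?w = T\<pi> u v"
    using \<omega>_right_action[OF g(1) u'(2)] T\<pi>_right_action[OF g(1), of u' v'] u'(3) by (simp_all add: g(2))
  have "T\<pi> u (v - ?w) = 0" by (simp add: linear_diff[OF linear_T\<pi>] w(2))
  then have "\<omega> u v - \<omega> u ?w \<in> p" using vertical_in_q qp by (force simp flip: linear_diff[OF linear_\<omega>])
  then show "\<omega> u v \<in> p" using subspace_add[OF subspace_p _ w(1)] by force
qed (auto simp: subalgebra_distribution_def)

section \<open>Curvature, involutivity and integrability\<close>

lemma bracket_p: "X \<in> p \<Longrightarrow> Y \<in> p \<Longrightarrow> lie_bracket GA G X Y \<in> p"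
  unfolding parabolic_subalgebra_def by (rule filtration_bracket_zero[OF lie_algebra grp])

lemma curvature_p_iff:
  "(\<forall>u. \<forall>X\<in>p. \<forall>Y\<in>p. curvature PA (lie_bracket GA G) \<omega> u X Y \<in> p) \<longleftrightarrow>
   (\<forall>u v w. \<omega> u v \<in> p \<longrightarrow> \<omega> u w \<in> p \<longrightarrow> ext_deriv PA \<omega> u v w \<in> p)"
proof (intro iffI allI impI ballI)
  fix u v w
  assume curv: "\<forall>u. \<forall>X\<in>p. \<forall>Y\<in>p. curvature PA (lie_bracket GA G) \<omega> u X Y \<in> p" and vw: "\<omega> u v \<in> p" "\<omega> u w \<in> p"
  have "inv_into UNIV (\<omega> u) (\<omega> u a) = a" for a using bij_\<omega>[of u] by (simp add: bij_def)
  then have "ext_deriv PA \<omega> u v w = curvature PA (lie_bracket GA G) \<omega> u (\<omega> u v) (\<omega> u w) - lie_bracket GA G (\<omega> u v) (\<omega> u w)"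
    by (simp add: curvature_def)
  then show "ext_deriv PA \<omega> u v w \<in> p" using curv vw bracket_p subspace_diff[OF subspace_p] by simp
next
  fix u X Y
  assume ext: "\<forall>u v w. \<omega> u v \<in> p \<longrightarrow> \<omega> u w \<in> p \<longrightarrow> ext_deriv PA \<omega> u v w \<in> p" and XY: "X \<in> p" "Y \<in> p"
  have "\<omega> u (inv_into UNIV (\<omega> u) a) = a" for a using bij_\<omega>[of u] by (simp add: bij_def surj_f_inv_f)
  then show "curvature PA (lie_bracket GA G) \<omega> u X Y \<in> p"
    using ext XY bracket_p subspace_add[OF subspace_p] by (simp add: curvature_def)
qed

text \<open>Stands for the quotient map modulo \<open>p\<close>, with values kept in a Euclidean
  space so that the calculus of forms applies.\<close>

lemma annihilator:
  obtains L :: "'g \<Rightarrow> 'g" where "linear L" "\<And>X. L X = 0 \<longleftrightarrow> X \<in> p"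
proof -
  obtain P where P: "linear P" "\<And>X. P X \<in> p" "\<And>X. X \<in> p \<Longrightarrow> P X = X" using subspace_projection[OF subspace_p] by blast
  show thesis
    by (rule that[of "\<lambda>X. X - P X"]) (use P in \<open>auto intro!: linear_compose_sub linear_ident simp: eq_iff_diff_eq_0[symmetric], metis\<close>)
qed

text \<open>An integral submanifold gives a retraction \<open>\<rho>\<close> of a neighbourhood of \<open>u\<close> onto its preimage in the
  bundle. The form \<open>\<omega>\<close> modulo \<open>p\<close> pulls back to zero along \<open>\<rho>\<close>.\<close>

lemma integrable_imp_involutive:
  assumes int: "integrable_distribution MA E" and vw: "\<omega> u v \<in> p" "\<omega> u w \<in> p"
  shows "ext_deriv PA \<omega> u v w \<in> p"
proof -
  let ?x = "\<pi> u"
  obtain N where N: "submanifold MA N" "?x \<in> N" "\<And>y. y \<in> N \<Longrightarrow> submanifold_tangent MA N y = E y"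
    using int unfolding integrable_distribution_def by metis
  obtain c V where cV: "adapted_chart MA N ?x c V" using N(1,2) unfolding submanifold_def by blast
  note c = adapted_chartD[OF cV]
  have ic: "is_chart c" by (rule max_chart_is_chart[OF c(1)])
  have EV: "E y = {a. in_chart MA c y a \<in> V}" if "y \<in> N" "y \<in> fst c" for y
  proof -
    have "adapted_chart MA N y c V" using cV that by (simp add: adapted_chart_def)
    then show ?thesis using submanifold_tangent_eq[OF atlas_MA _ that(1)] N(3)[OF that(1)] by blast
  qed
  obtain P where P: "linear P" "\<And>x. P x \<in> V" "\<And>x. x \<in> V \<Longrightarrow> P x = x" using subspace_projection[OF c(3)] by blast
  have bP: "bounded_linear P" using P(1) by (simp add: linear_conv_bounded_linear)
  \<comment> \<open>In the adapted chart, a projection onto \<open>V\<close> retracts a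
    neighbourhood in the base onto \<open>N\<close>.\<close>
  define \<rho>M where "\<rho>M y = chart_inv c (P (snd c y))" for y
  define D where "D = fst c \<inter> (\<lambda>y. P (snd c y)) -` (snd c ` fst c)"
  have "continuous_on (fst c) (\<lambda>y. P (snd c y))"
    by (rule bounded_linear.continuous_on[OF bP continuous_on_chart[OF ic]])
  then have D: "open D"
    unfolding D_def by (rule continuous_open_preimage[OF _ is_chart_open(1)[OF ic] is_chart_open(2)[OF ic]])
  have Px: "P (snd c ?x) = snd c ?x" using c(2,4) N(2) P(3) by blast
  have xD: "?x \<in> D" using c(2) by (simp add: D_def Px)
  have \<rho>Mx: "\<rho>M ?x = ?x" by (simp add: \<rho>M_def Px chart_inv_left[OF ic c(2)])
  have \<rho>M: "\<rho>M y \<in> fst c" "snd c (\<rho>M y) = P (snd c y)" "\<rho>M y \<in> N" if "y \<in> D" for y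
  proof -
    show 1: "\<rho>M y \<in> fst c" "snd c (\<rho>M y) = P (snd c y)"
      using that chart_inv_in[OF ic] chart_inv_right[OF ic] by (auto simp: D_def \<rho>M_def)
    show "\<rho>M y \<in> N" using c(4)[OF 1(1)] P(2) by (simp add: 1(2))
  qed
  have smP: "smooth_at std_atlas std_atlas P z" for z
    using smooth_on_linear[OF open_UNIV P(1) smooth_on_ident[OF open_UNIV]] by (auto simp: smooth_at_std_iff)
  have smPc: "smooth_at MA std_atlas (\<lambda>y. P (snd c y)) y" if "y \<in> D" for y
    by (rule smooth_at_compose[OF covers(2,4,4) smooth_at_chart[OF c(1)] smP]) (use that in \<open>simp add: D_def\<close>)
  have sm\<rho>M: "smooth_at MA MA \<rho>M y" if "y \<in> D" for y
    unfolding \<rho>M_def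
    by (rule smooth_at_compose[OF covers(2,4,2) smPc[OF that] smooth_at_chart_inv[OF c(1)]]) (use that in \<open>simp add: D_def\<close>)
  have T\<rho>M: "in_chart MA c (\<rho>M y) (tangent_map MA MA \<rho>M y a) = P (in_chart MA c y a)" if y: "y \<in> D" for y a
  proof -
    have yc: "y \<in> fst c" using y by (simp add: D_def)
    have "in_chart MA c (\<rho>M y) (tangent_map MA MA \<rho>M y a) = tangent_map MA std_atlas (\<lambda>y. snd c (\<rho>M y)) y a"
      using tangent_map_compose[OF covers(2,2,4) sm\<rho>M[OF y] smooth_at_chart[OF c(1) \<rho>M(1)[OF y]], of a]
      by (simp add: in_chart_eq)
    also have "\<dots> = tangent_map MA std_atlas (\<lambda>y. P (snd c y)) y a"
      using tangent_map_cong[OF covers(2,4) smPc[OF y] D y, of "\<lambda>y. snd c (\<rho>M y)"] \<rho>M(2) by simp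
    also have "\<dots> = P (in_chart MA c y a)"
      using tangent_map_compose[OF covers(2,4,4) smooth_at_chart[OF c(1) yc] smP, of a]
        frechet_derivativeI[OF bounded_linear.has_derivative[OF bP has_derivative_ident]]
      by (simp add: in_chart_eq tangent_map_std)
    finally show ?thesis .
  qed
  have T\<rho>M_E: "tangent_map MA MA \<rho>M y a \<in> E (\<rho>M y)" if "y \<in> D" for y a
    using EV[OF \<rho>M(3,1)[OF that]] T\<rho>M[OF that] P(2) by simp
  have T\<rho>M_id: "tangent_map MA MA \<rho>M ?x a = a" if "a \<in> E ?x" for a
  proof -
    have "in_chart MA c ?x (tangent_map MA MA \<rho>M ?x a) = in_chart MA c ?x a"
      using T\<rho>M[OF xD, of a] that EV[OF N(2) c(2)] P(3) by (simp add: \<rho>Mx)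
    then show ?thesis using of_chart_in_chart[OF covers(2) c(1,2) atlas_MA] by metis
  qed
  obtain U K where U: "open U" "?x \<in> U" and K: "\<And>y w. y \<in> U \<Longrightarrow> \<pi> w \<in> U \<Longrightarrow> \<pi> (K y w) = y"
    "\<And>w. \<pi> w \<in> U \<Longrightarrow> K (\<pi> w) w = w" and
    smK: "\<And>y w. y \<in> U \<Longrightarrow> \<pi> w \<in> U \<Longrightarrow> smooth_at (prod_atlas MA PA) PA (\<lambda>z. K (fst z) (snd z)) (y, w)"
    by (rule local_product[of "?x"]) (rule that)
  \<comment> \<open>The lift of the base retraction that keeps the group component; it fixes
    \<open>u\<close> and its image lies over \<open>N\<close>.\<close>
  define \<rho> where "\<rho> w = K (\<rho>M (\<pi> w)) w" for w
  have cont\<rho>M: "continuous_on D \<rho>M"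
    by (rule continuous_at_imp_continuous_on) (metis smooth_at_nbhd sm\<rho>M continuous_on_eq_continuous_at)
  define W where "W = \<pi> -` (U \<inter> (D \<inter> \<rho>M -` U))"
  have W: "open W" "u \<in> W"
    unfolding W_def using U xD \<rho>Mx open_\<pi>[OF open_Int[OF U(1) continuous_open_preimage[OF cont\<rho>M D U(1)]]] by auto
  have sm\<rho>M\<pi>: "smooth_at PA MA (\<lambda>w. \<rho>M (\<pi> w)) w" if "w \<in> W" for w
    using that by (intro smooth_at_compose[OF covers(1,2,2) smooth_\<pi>] sm\<rho>M) (simp add: W_def)
  have sm\<rho>: "smooth_at PA PA \<rho> w" if "w \<in> W" for w
  proof -
    have "smooth_at (prod_atlas MA PA) PA (\<lambda>z. K (fst z) (snd z)) (\<rho>M (\<pi> w), w)"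
      using that by (intro smK) (auto simp: W_def)
    from smooth_at_compose[OF covers(1,5,1) smooth_at_Pair[OF covers(1,2,1) sm\<rho>M\<pi>[OF that] smooth_at_ident[OF atlas_PA]] this]
    show ?thesis by (simp add: \<rho>_def[abs_def])
  qed
  have \<rho>u: "\<rho> u = u" using K(2) U(2) by (simp add: \<rho>_def \<rho>Mx)
  \<comment> \<open>The vector projects into \<open>E\<close>, on which the base retraction is the
    identity to first order; \<open>tangent_map_product\<close> lifts this to the bundle.\<close>
  have T\<rho>: "tangent_map PA PA \<rho> u v = v" if "\<omega> u v \<in> p" for v
    unfolding \<rho>_def
  proof (rule tangent_map_product(2)[OF smK[OF U(2,2)] open_\<pi>[OF U(1)] _ _ covers(1) sm\<rho>M\<pi>[OF W(2)] \<rho>Mx smooth_at_ident[OF atlas_PA] refl])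
    have "T\<pi> u v \<in> E ?x" using that E_iff by blast
    then show "tangent_map PA MA (\<lambda>w. \<rho>M (\<pi> w)) u v = T\<pi> u v"
      using tangent_map_compose[OF covers(1,2,2) smooth_\<pi> sm\<rho>M[OF xD], of v] T\<rho>M_id by simp
  qed (use U K in \<open>auto simp: tangent_map_ident[OF covers(1)]\<close>)
  \<comment> \<open>The image of the tangent map projects to vectors tangent to \<open>N\<close>,
    hence in \<open>E\<close>, and \<open>E_iff\<close> translates this back.\<close>
  have in_p: "\<omega> (\<rho> w) (tangent_map PA PA \<rho> w a) \<in> p" if w: "w \<in> W" for w a
  proof -
    have wD: "\<pi> w \<in> D" "\<pi> w \<in> U" "\<rho>M (\<pi> w) \<in> U" using w by (auto simp: W_def)
    have "T\<pi> (\<rho> w) (tangent_map PA PA \<rho> w a) = tangent_map PA MA (\<lambda>w. \<pi> (\<rho> w)) w a"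
      using tangent_map_compose[OF covers(1,1,2) sm\<rho>[OF w] smooth_\<pi>, of a] by simp
    also have "tangent_map PA MA (\<lambda>w. \<pi> (\<rho> w)) w = tangent_map PA MA (\<lambda>w. \<rho>M (\<pi> w)) w"
      by (rule tangent_map_cong[OF covers(1,2) sm\<rho>M\<pi>[OF w] W(1) w]) (auto simp: \<rho>_def W_def K(1))
    also have "\<dots> a = tangent_map MA MA \<rho>M (\<pi> w) (T\<pi> w a)"
      using tangent_map_compose[OF covers(1,2,2) smooth_\<pi> sm\<rho>M[OF wD(1)], of a] by simp
    also have "\<dots> \<in> E (\<rho>M (\<pi> w))" by (rule T\<rho>M_E[OF wD(1)])
    also have "\<rho>M (\<pi> w) = \<pi> (\<rho> w)" by (simp add: \<rho>_def K(1)[OF wD(3,2)])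
    finally show ?thesis unfolding E_iff .
  qed
  obtain L :: "'g \<Rightarrow> 'g" where L: "linear L" "\<And>X. L X = 0 \<longleftrightarrow> X \<in> p" using annihilator by blast
  have "ext_deriv PA (\<lambda>x v. L (\<omega> x v)) (\<rho> u) (tangent_map PA PA \<rho> u v) (tangent_map PA PA \<rho> u w) = 0"
    by (rule ext_deriv_zero_if_pullback_zero[OF atlas_PA smooth_one_form_linear[OF atlas_PA one_form L(1)] sm\<rho>[OF W(2)] W])
      (simp add: L(2) in_p)
  then show ?thesis
    by (simp add: \<rho>u T\<rho>[OF vw(1)] T\<rho>[OF vw(2)] ext_deriv_linear[OF atlas_PA one_form L(1)] L(2))
qed

lemma involutive_imp_integrable:
  assumes inv: "\<And>u v w. \<omega> u v \<in> p \<Longrightarrow> \<omega> u w \<in> p \<Longrightarrow> ext_deriv PA \<omega> u v w \<in> p"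
  shows "integrable_distribution MA E"
  unfolding integrable_distribution_def
proof
  fix x
  obtain U K where U: "open U" "x \<in> U" and ex: "\<exists>u. \<pi> u = x" and K: "\<And>y w. y \<in> U \<Longrightarrow> \<pi> w \<in> U \<Longrightarrow> \<pi> (K y w) = y"
    "\<And>w. \<pi> w \<in> U \<Longrightarrow> K (\<pi> w) w = w" and
    smK: "\<And>y w. y \<in> U \<Longrightarrow> \<pi> w \<in> U \<Longrightarrow> smooth_at (prod_atlas MA PA) PA (\<lambda>z. K (fst z) (snd z)) (y, w)"
    by (rule local_product[of x]) (rule that)
  obtain u where u: "\<pi> u = x" using ex by blast
  \<comment> \<open>A local section through \<open>u\<close> with constant group component.\<close>
  define s where "s y = K y u" for y
  have \<pi>s: "\<pi> (s y) = y" if "y \<in> U" for y unfolding s_def by (rule K(1)[OF that]) (simp add: u U)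
  have sx: "s x = u" using K(2)[of u] by (simp add: s_def u U)
  have sms: "smooth_at MA PA s y" if "y \<in> U" for y
  proof -
    have "smooth_at (prod_atlas MA PA) PA (\<lambda>z. K (fst z) (snd z)) (y, u)"
      by (rule smK[OF that]) (simp add: u U)
    from smooth_at_compose[OF covers(2,5,1) smooth_at_Pair[OF covers(2,2,1) smooth_at_ident[OF atlas_MA] smooth_at_const[OF covers(2)]] this]
    show ?thesis by (simp add: s_def[abs_def])
  qed
  let ?Ts = "tangent_map MA PA s"
  have T\<pi>s: "T\<pi> (s y) (?Ts y a) = a" if y: "y \<in> U" for y a
  proof -
    have "tangent_map MA MA (\<lambda>y. \<pi> (s y)) y = tangent_map MA MA (\<lambda>y. y) y"
      by (rule tangent_map_cong[OF covers(2,2) smooth_at_ident[OF atlas_MA] U(1) y]) (simp add: \<pi>s)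
    then show ?thesis
      using tangent_map_compose[OF covers(2,1,2) sms[OF y] smooth_\<pi>, of a] by (simp add: tangent_map_ident[OF covers(2)])
  qed
  have Es: "a \<in> E y \<longleftrightarrow> \<omega> (s y) (?Ts y a) \<in> p" if y: "y \<in> U" for y a
    using E_iff[of "s y" "?Ts y a"] by (simp add: \<pi>s[OF y] T\<pi>s[OF y])
  let ?d = "chart_at MA x"
  have d: "?d \<in> MA" "x \<in> fst ?d" using chart_at[OF covers(2)] by auto
  have md: "max_chart MA ?d" by (rule smooth_atlas_max_chart[OF atlas_MA d(1)])
  have id: "is_chart ?d" by (rule max_chart_is_chart[OF md])
  define O' where "O' = snd ?d ` (U \<inter> fst ?d)"
  have O': "open O'" "snd ?d x \<in> O'" "O' \<subseteq> snd ?d ` fst ?d"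
    unfolding O'_def using open_chart_image[OF id U(1)] U(2) d(2) by auto
  have inO': "chart_inv ?d y \<in> U" "chart_inv ?d y \<in> fst ?d" "snd ?d (chart_inv ?d y) = y" if "y \<in> O'" for y
    using that by (auto simp: O'_def chart_inv_left[OF id])
  obtain L :: "'g \<Rightarrow> 'g" where L: "linear L" "\<And>X. L X = 0 \<longleftrightarrow> X \<in> p" using annihilator by blast
  let ?L\<omega> = "\<lambda>u v. L (\<omega> u v)"
  have L\<omega>: "smooth_one_form PA ?L\<omega>" by (rule smooth_one_form_linear[OF atlas_PA one_form L(1)])
  define \<theta> where "\<theta> y a = ?L\<omega> (s (chart_inv ?d y)) (?Ts (chart_inv ?d y) (of_chart MA ?d (chart_inv ?d y) a))" for y a
  have \<theta>_zero: "\<theta> y a = 0 \<longleftrightarrow> of_chart MA ?d (chart_inv ?d y) a \<in> E (chart_inv ?d y)" if "y \<in> O'" for y a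
    by (simp add: \<theta>_def L(2) Es[OF inO'(1)[OF that]])
  have locally: "\<exists>S. open S \<and> y \<in> S \<and> smooth_on S (\<lambda>y. \<theta> y a)"
    and deriv: "form_deriv \<theta> y a b = ext_deriv PA ?L\<omega> (s (chart_inv ?d y)) (?Ts (chart_inv ?d y) (of_chart MA ?d (chart_inv ?d y) a))
      (?Ts (chart_inv ?d y) (of_chart MA ?d (chart_inv ?d y) b))" if y: "y \<in> O'" for y a b
  proof -
    let ?y = "chart_inv ?d y"
    obtain S where S: "open S" "snd ?d ?y \<in> S" "S \<subseteq> snd ?d ` fst ?d" "\<And>y. y \<in> S \<Longrightarrow> smooth_at MA PA s (chart_inv ?d y)"
      "\<And>w. smooth_on S (\<lambda>y. \<theta> y w)"
      "\<And>v w. form_deriv \<theta> (snd ?d ?y) v w = ext_deriv PA ?L\<omega> (s ?y) (?Ts ?y (of_chart MA ?d ?y v)) (?Ts ?y (of_chart MA ?d ?y w))"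
      by (rule ext_deriv_pullback[OF atlas_PA atlas_MA sms[OF inO'(1)[OF y]] d(1) inO'(2)[OF y] L\<omega>, folded \<theta>_def])
        (rule that)
    show "\<exists>S. open S \<and> y \<in> S \<and> smooth_on S (\<lambda>y. \<theta> y a)" using S(1,2,5) inO'(3)[OF y] by auto
    show "form_deriv \<theta> y a b = ext_deriv PA ?L\<omega> (s ?y) (?Ts ?y (of_chart MA ?d ?y a)) (?Ts ?y (of_chart MA ?d ?y b))"
      using S(6)[of a b] inO'(3)[OF y] by simp
  qed
  have \<theta>x: "\<theta> (snd ?d x) a = L (\<omega> u (?Ts x (of_chart MA ?d x a)))" for a
    by (simp add: \<theta>_def chart_inv_left[OF id d(2)] sx)
  \<comment> \<open>Every value \<open>L X\<close> is attained at \<open>x\<close>: a tangent vector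
    at \<open>u\<close> differs from the lift of its projection by a vertical vector, whose value
    under \<omega> is annihilated by \<open>L\<close>. This is the hypothesis on ranges in
    \<open>frobenius_leaf\<close>.\<close>
  have range: "L X \<in> range (\<theta> (snd ?d x))" for X
  proof -
    obtain v where v: "X = \<omega> u v" using bij_\<omega>[of u] by (metis bij_pointE)
    let ?a = "T\<pi> u v"
    have "T\<pi> u (v - ?Ts x ?a) = 0" using T\<pi>s[OF U(2), of ?a] by (simp add: linear_diff[OF linear_T\<pi>] sx)
    then have "L (\<omega> u (v - ?Ts x ?a)) = 0" using vertical_in_q qp L(2) by blast
    then have "L X = \<theta> (snd ?d x) (in_chart MA ?d x ?a)"
      by (simp add: \<theta>x v linear_diff[OF linear_\<omega>] linear_diff[OF L(1)] of_chart_in_chart[OF covers(2) md d(2) atlas_MA])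
    then show ?thesis by blast
  qed
  have \<theta>1: "linear (\<theta> y)" if y: "y \<in> O'" for y
    unfolding \<theta>_def
    by (intro linear_compose[OF linear_compose[OF linear_compose[OF linear_of_chart[OF covers(2) md inO'(2)[OF y]]
            linear_tangent_map[OF covers(2,1) sms[OF inO'(1)[OF y]]]] linear_\<omega>] L(1), unfolded o_def])
  have \<theta>2: "smooth_on O' (\<lambda>y. \<theta> y v)" for v by (rule smooth_on_local) (rule locally)
  have \<theta>3: "\<theta> y v \<in> range (\<theta> (snd ?d x))" if "y \<in> O'" for y v unfolding \<theta>_def[of y] by (rule range)
  \<comment> \<open>By naturality this is the exterior derivative of \<omega> modulo
    \<open>p\<close> on the lifted vectors, and the vanishing of \<theta> says that \<omega> maps
    these to \<open>p\<close>.\<close>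
  have \<theta>4: "form_deriv \<theta> y v w = 0" if y: "y \<in> O'" and vw: "\<theta> y v = 0" "\<theta> y w = 0" for y v w
    unfolding deriv[OF y] ext_deriv_linear[OF atlas_PA one_form L(1)] L(2)
    by (rule inv) (use vw in \<open>simp_all add: \<theta>_zero[OF y] flip: Es[OF inO'(1)[OF y]]\<close>)
  obtain W S and \<Phi> \<Psi> :: "'a \<Rightarrow> 'a" where W: "open W" "snd ?d x \<in> W" "W \<subseteq> O'" and S: "subspace S" and \<Phi>: "smooth_on W \<Phi>" "open (\<Phi> ` W)"
    and \<Psi>: "smooth_on (\<Phi> ` W) \<Psi>" "\<And>y. y \<in> W \<Longrightarrow> \<Psi> (\<Phi> y) = y" and \<Phi>x: "\<Phi> (snd ?d x) \<in> S"
    and tangent: "\<And>y v. y \<in> W \<Longrightarrow> \<Phi> y \<in> S \<Longrightarrow> frechet_derivative \<Phi> (at y) v \<in> S \<longleftrightarrow> \<theta> y v = 0"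
    by (rule frobenius_leaf[OF O'(1,2) \<theta>1 \<theta>2 \<theta>3 \<theta>4]) (assumption+, rule that)
  define c where "c = (fst ?d \<inter> snd ?d -` W, \<Phi> \<circ> snd ?d)"
  \<comment> \<open>The leaf is a slice of the single chart \<open>c\<close>, which is therefore
    adapted at each of its points.\<close>
  define N where "N = {y \<in> fst c. snd c y \<in> S}"
  have W': "W \<subseteq> snd ?d ` fst ?d" using W(3) O'(3) by blast
  note chart = compose_chart[OF atlas_MA d(1) W(1) W' \<Phi> \<Psi>, folded c_def]
  have adapted: "adapted_chart MA N y c S" if "y \<in> N" for y
    using that chart(1) S by (auto simp: adapted_chart_def N_def max_chart_def)
  have "submanifold_tangent MA N y = E y" if y: "y \<in> N" for y
  proof -
    have yc: "y \<in> fst c" "y \<in> fst ?d" "snd ?d y \<in> W" "\<Phi> (snd ?d y) \<in> S" using y by (auto simp: N_def c_def)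
    have yi: "chart_inv ?d (snd ?d y) = y" by (rule chart_inv_left[OF id yc(2)])
    have "in_chart MA c y a \<in> S \<longleftrightarrow> a \<in> E y" for a
      using tangent[OF yc(3,4)] \<theta>_zero[of "snd ?d y"] W(3) yc(3)
      by (simp add: chart(2)[OF _ yc(1)] yi of_chart_in_chart[OF covers(2) md yc(2) atlas_MA] subset_iff)
    then show ?thesis unfolding submanifold_tangent_eq[OF atlas_MA adapted[OF y] y] by blast
  qed
  moreover have "submanifold MA N" using adapted unfolding submanifold_def by blast
  moreover have "x \<in> N" using W(2) d(2) \<Phi>x by (simp add: N_def c_def)
  ultimately show "\<exists>N. submanifold MA N \<and> x \<in> N \<and> (\<forall>y\<in>N. submanifold_tangent MA N y = E y)" by blast
qed

end

theorem proposition2p5: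
  fixes GA :: "('h::{t2_space, second_countable_topology}, 'g::euclidean_space) chart set"
    and G :: "'h monoid"
    and sc :: "'k::real_normed_field \<Rightarrow> 'g \<Rightarrow> 'g"
    and br :: "'g \<Rightarrow> 'g \<Rightarrow> 'g"
    and mq mp :: nat
    and grq grp :: "int \<Rightarrow> 'g set"
    and q p :: "'g set"
    and Q P :: "'h set"
    and PA :: "('p::{t2_space, second_countable_topology}, 'b::euclidean_space) chart set"
    and MA :: "('m::{t2_space, second_countable_topology}, 'a::euclidean_space) chart set"
    and \<pi> :: "'p \<Rightarrow> 'm"
    and r :: "'p \<Rightarrow> 'h \<Rightarrow> 'p"
    and \<omega> :: "'p \<Rightarrow> 'b \<Rightarrow> 'g"
  assumes "lie_group GA G"
    and "br = lie_bracket GA G"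
    and "semisimple sc br"
    and "parabolic_grading sc br mq grq"
    and "parabolic_grading sc br mp grp"
    and "q = parabolic_subalgebra sc grq"
    and "p = parabolic_subalgebra sc grp"
    and "Q = parabolic_subgroup sc GA G grq"
    and "P = parabolic_subgroup sc GA G grp"
    and "q \<subseteq> p"
    and "Q \<subseteq> P"
    and "parabolic_geometry sc GA G grq PA MA \<pi> r \<omega>"
  shows "integrable_distribution MA (subalgebra_distribution PA MA \<pi> \<omega> p) \<longleftrightarrow>
    (\<forall>u. \<forall>X\<in>p. \<forall>Y\<in>p. curvature PA br \<omega> u X Y \<in> p)"
proof -
  interpret nested_parabolic_geometry GA G sc mq mp grq grp PA MA \<pi> r \<omega>
    using assms by unfold_locales simp_all
  show ?thesis
    using curvature_p_iff integrable_imp_involutive involutive_imp_integrable assms(2,7) by blast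
qed

end
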